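(* Let $K,M,N\ge 3$ with $M\asymp N$ (i.e. $C_1N\le M\le C_2N$ for fixed constants $C_1,C_2>0$), let $\gamma\in(0,1)$, and let $\mathcal{K}>0$. Let $p\in\mathbf{Z}$, $q\in\mathbf{N}$ with $p/q$ of type $(2+\gamma,\mathcal{K})$. Assume that \[ q^{1+\delta}\le\Big(\frac{N^2}{K}\Big)^{1/(1+\gamma)} \] for some $\delta>0$, and that $KN/q\ge1$. Then \[ \sum_{|r|\le K}\ \sum_{pm\equiv r\ (\mathrm{mod}\ q)}\tau_{M,N}(m)=\frac{2KMN}{q}+O\Big(N(KN/q)^{7/8}+\frac{N^2}{q}\Big(\tau(q)^2(\log N)^3+\frac{K(\log\log N)^2}{(\log N)^{1/4}}\Big)\Big), \] uniformly in $M$, $K$, $p$ and $q$.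
   Context: $\tau_{M,N}(m)=\#\{(a,b)\in\mathbf{N}^2: a\le M,\ b\le N,\ ab=m\}$ for $m\in\mathbf{N}$; $\tau$ is the ordinary divisor function. In the sum, $r$ ranges over integers with $|r|\le K$ and $m$ over positive integers. A rational number $p/q$ is of type $(e,\mathcal{K})$ if $|p/q-u/v|\ge 1/(\mathcal{K}v^e)$ for every rational $u/v\ne p/q$ (with $v\in\mathbf{N}$).
   Formalization: The fraction p/q is assumed to be in lowest terms (p and q coprime); without this the claim fails, e.g. for p = 0, q about the square root of N and K = q/4. *)

theory Defs
  imports "HOL-Analysis.Analysis" "HOL-Number_Theory.Number_Theory"
begin

definition divisor_tau :: "nat \<Rightarrow> nat" where
  "divisor_tau n = card {d. d dvd n}"

definition tau_box :: "real \<Rightarrow> real \<Rightarrow> nat \<Rightarrow> nat" where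
  "tau_box M N m =
     card {(a::nat, b::nat). 0 < a \<and> 0 < b \<and> real a \<le> M \<and> real b \<le> N \<and> a * b = m}"

text \<open>The fractions \<open>u/v\<close> need not be reduced; a reduced one gives the strongest condition
  (for \<open>e \<ge> 0\<close> and \<open>\<K> > 0\<close>).\<close>

definition rat_of_type :: "rat \<Rightarrow> real \<Rightarrow> real \<Rightarrow> bool" where
  "rat_of_type x e \<K> \<longleftrightarrow>
     (\<forall>(u::int) (v::nat). 0 < v \<longrightarrow> of_int u / of_nat v \<noteq> x \<longrightarrow>
        of_rat \<bar>x - of_int u / of_nat v\<bar> \<ge> 1 / (\<K> * real v powr e))"

text \<open>The inner sum ranges over infinitely many \<open>m\<close>, hence the unordered infinite sum; by the
  finite support shown below it is really a finite one.\<close>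

definition residue_sum :: "int \<Rightarrow> nat \<Rightarrow> real \<Rightarrow> real \<Rightarrow> real \<Rightarrow> real" where
  "residue_sum p q K M N =
     (\<Sum>r\<in>{r::int. \<bar>real_of_int r\<bar> \<le> K}.
        \<Sum>\<^sub>\<infinity>m\<in>{m::nat. 0 < m \<and> [p * int m = r] (mod int q)}. real (tau_box M N m))"

lemma tau_box_eq_0:
  assumes "real m > M * N"
  shows "tau_box M N m = 0"
proof -
  have False if "0 < a" "0 < b" "real a \<le> M" "real b \<le> N" "a * b = m" for a b :: nat
    using mult_mono[of "real a" M "real b" N] that assms by auto
  then have "{(a::nat, b::nat). 0 < a \<and> 0 < b \<and> real a \<le> M \<and> real b \<le> N \<and> a * b = m} = {}"
    by blast
  then show ?thesis by (simp only: tau_box_def card.empty)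
qed

lemma finite_abs_le_real: "finite {r::int. \<bar>real_of_int r\<bar> \<le> K}"
  by (rule finite_subset[of _ "{-\<lfloor>K\<rfloor>..\<lfloor>K\<rfloor>}"]) (auto simp: le_floor_iff abs_le_iff; linarith)+

lemma infsum_tau_box_eq_sum:
  "(\<Sum>\<^sub>\<infinity>m\<in>A. real (tau_box M N m)) = (\<Sum>m\<in>{m\<in>A. real m \<le> M * N}. real (tau_box M N m))"
proof -
  have "{m\<in>A. real m \<le> M * N} \<subseteq> {..nat \<lfloor>M * N\<rfloor>}"
    by (auto simp: le_nat_floor)
  then have fin: "finite {m\<in>A. real m \<le> M * N}"
    using finite_subset by blast
  have "(\<Sum>\<^sub>\<infinity>m\<in>A. real (tau_box M N m)) = (\<Sum>\<^sub>\<infinity>m\<in>{m\<in>A. real m \<le> M * N}. real (tau_box M N m))"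
    by (rule infsum_cong_neutral) (auto simp: tau_box_eq_0)
  with fin show ?thesis by simp
qed

end

theory Submission
  imports Defs "HOL-Real_Asymp.Real_Asymp"
begin

text \<open>Put \<open>\<alpha> = p/q\<close>, \<open>\<eta> = (\<lfloor>K\<rfloor> + 1/2)/q\<close> and \<open>W = \<eta>N\<^sup>2\<close>. The sum counts the triples
  \<open>(a, b, e)\<close> with \<open>\<bar>\<alpha>ab - e\<bar> \<le> \<eta>\<close>. For fixed \<open>a\<close> this is a lattice point count in a box, equal to
  \<open>2\<eta>N\<close> up to the reciprocal of the first minimum of the lattice, so one has to bound the number of
  pairs \<open>(a, v)\<close> with \<open>v\<close> short and \<open>\<alpha>av\<close> very close to an integer. That number is bounded by
  induction on the scale \<open>\<kappa>\<close>, for all boxes \<open>a \<le> A\<close>, \<open>b \<le> B\<close> with \<open>AB \<le> \<kappa>N\<^sup>2\<close> and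
  \<open>0 < \<bar>\<alpha>ab - e\<bar> \<le> \<kappa>\<eta>\<close> at once. For very unbalanced boxes the lattice bound for the longer variable
  suffices. Otherwise a prime factor of the shorter variable, of size between a power of
  \<open>1/\<kappa>\<close> and \<open>exp(\<kappa>\<^bsup>-3/4\<^esup>)\<close>, is moved to the longer variable, which unbalances the box; integers without
  such a prime factor are sparse by a sieve bound. When \<open>\<kappa>\<close> is a negative power of \<open>ln N\<close>, Landreau's
  inequality for the divisor function and the equidistribution of \<open>{n. \<parallel>\<alpha>n\<parallel> \<le> \<kappa>\<eta>}\<close> in the
  multiples of small integers take over; the latter is where the type of \<open>p/q\<close> is used.\<close>

section \<open>Lattice points near a line\<close>

text \<open>For fixed b the lattice bound costs 2J, where J is the multiplicity tolerated; a larger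
  multiplicity of order 2^j is charged, with weight of order 2^j, to the same problem at a scale of
  order \<kappa>/2^j. So a bound \<kappa>^(1+s) with s > 0 reproduces itself, and the real
  difficulty is the term J B: it must be O(\<kappa>^(6/5) W), but a balanced box only gives B \<le>
  \<kappa>^(1/2) N, and W may be as small as order N. The prime factors supply the missing power of
  \<kappa>. If the moved primes go up to exp(\<kappa>^(-t)), the sieve leaves about \<kappa>^(1/2+t)
  N values of b, while the roughly \<kappa>^(-t) dyadic ranges for the prime, each costing
  \<kappa>^2 W, leave \<kappa>^(2-t) W. The choice t = 3/4 balances both at \<kappa>^(5/4). From the
  other side, the exponent 7/8 of the theorem asks for s \<ge> 1/7: with T = KN/q and multiplicity
  cut-off T^(7/8) the tail is of order T^(1-7s/8) N. Exact relations \<alpha>ab = e would not shrink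
  with \<kappa>; they are kept out of these counts and enter once, through gcd(a,q).\<close>

definition near_multiples :: "real \<Rightarrow> real \<Rightarrow> real \<Rightarrow> (nat \<times> int) set" where
  "near_multiples \<alpha> A \<xi> = {(a, c). 1 \<le> a \<and> real a \<le> A \<and> 0 < \<bar>\<alpha> * real a - real_of_int c\<bar> \<and>
     \<bar>\<alpha> * real a - real_of_int c\<bar> \<le> \<xi>}"

lemma int_Icc_real: "{s::int. x \<le> real_of_int s \<and> real_of_int s \<le> y} = {\<lceil>x\<rceil>..\<lfloor>y\<rfloor>}"
  by (auto simp: ceiling_le_iff le_floor_iff)

lemma card_int_Icc_real_le:
  assumes "y - x + 1 \<ge> 0"
  shows "real (card {s::int. x \<le> real_of_int s \<and> real_of_int s \<le> y}) \<le> y - x + 1"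
proof -
  have "real_of_int (\<lfloor>y\<rfloor> - \<lceil>x\<rceil> + 1) \<le> y - x + 1" by linarith
  moreover have "real (nat (\<lfloor>y\<rfloor> - \<lceil>x\<rceil> + 1)) = max 0 (real_of_int (\<lfloor>y\<rfloor> - \<lceil>x\<rceil> + 1))" by linarith
  ultimately show ?thesis unfolding int_Icc_real card_atLeastAtMost_int using assms by linarith
qed

lemma card_int_Icc_real_ge:
  "y - x - 1 \<le> real (card {s::int. x \<le> real_of_int s \<and> real_of_int s \<le> y})"
proof -
  have "real_of_int (\<lfloor>y\<rfloor> - \<lceil>x\<rceil> + 1) \<ge> y - x - 1" by linarith
  then show ?thesis unfolding int_Icc_real card_atLeastAtMost_int by linarith
qed

lemma finite_int_Icc_real: "finite {s::int. x \<le> real_of_int s \<and> real_of_int s \<le> y}"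
  unfolding int_Icc_real by simp

lemma finite_nat_le_real: "finite {n::nat. real n \<le> x}"
  by (rule finite_subset[of _ "{..nat \<lfloor>x\<rfloor>}"]) (auto simp: le_nat_floor)

lemma real_div_ge: "real (n div e) \<le> real n / real e"
  using of_int_floor_le[of "real n / real e"] by (simp add: floor_divide_of_nat_eq)

lemma real_div_le: "real n / real e \<le> real (n div e) + 1"
  using floor_correct[of "real n / real e"] by (simp add: floor_divide_of_nat_eq)

lemma card_le_fibres:
  assumes "finite S" and "\<And>k. k \<in> f ` S \<Longrightarrow> real (card {x\<in>S. f x = k}) \<le> m"
  shows "real (card S) \<le> real (card (f ` S)) * m"
proof -
  have "S = (\<Union>k\<in>f ` S. {x\<in>S. f x = k})" by auto
  then have "card S \<le> (\<Sum>k\<in>f ` S. card {x\<in>S. f x = k})"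
    using card_UN_le[of "f ` S" "\<lambda>k. {x\<in>S. f x = k}"] assms(1) by simp
  then have "real (card S) \<le> (\<Sum>k\<in>f ` S. real (card {x\<in>S. f x = k}))"
    by (metis of_nat_le_iff of_nat_sum)
  also have "\<dots> \<le> real (card (f ` S)) * m"
    by (rule sum_bounded_above) (use assms(2) in auto)
  finally show ?thesis .
qed

lemma finite_near_multiples: "finite (near_multiples \<alpha> A \<xi>)"
proof -
  have "near_multiples \<alpha> A \<xi> \<subseteq> Sigma {a::nat. real a \<le> A} (\<lambda>a. {c::int. \<alpha> * real a - \<xi> \<le> real_of_int c \<and> real_of_int c \<le> \<alpha> * real a + \<xi>})"
    unfolding near_multiples_def by (auto simp: abs_le_iff)
  moreover have "finite (Sigma {a::nat. real a \<le> A} (\<lambda>a. {c::int. \<alpha> * real a - \<xi> \<le> real_of_int c \<and> real_of_int c \<le> \<alpha> * real a + \<xi>}))"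
    by (intro finite_SigmaI finite_nat_le_real finite_int_Icc_real)
  ultimately show ?thesis by (rule finite_subset)
qed

text \<open>Take the point (a, c) with least a and put t = \<alpha> a - c. The determinant with (a,
  c) maps the set to integers of size at most a \<xi> + A |t|, and a fibre lies in an arithmetic
  progression with difference (a, c), so it has at most n + 1 points with n = min(A / a, 2 \<xi> /
  |t|). The witness is returned with n because a large n makes (a, c) a solution of the same problem
  with A and 2 \<xi> divided by n.\<close>

lemma card_near_multiples_le:
  assumes "near_multiples \<alpha> A \<xi> \<noteq> {}"
  obtains a c n where "(a, c) \<in> near_multiples \<alpha> A \<xi>" "1 \<le> n" "real a \<le> A / n"
    "\<bar>\<alpha> * real a - real_of_int c\<bar> \<le> 2 * \<xi> / n" "real (card (near_multiples \<alpha> A \<xi>)) \<le> 10 * A * \<xi> + 2 * n"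
proof -
  let ?S = "near_multiples \<alpha> A \<xi>"
  have "\<exists>w. w \<in> ?S" using assms by blast
  then obtain w where w: "w \<in> ?S" and wmin: "\<And>v. v \<in> ?S \<Longrightarrow> fst w \<le> fst v"
    using ex_has_least_nat[of "\<lambda>w. w \<in> ?S" _ fst] by (metis (lifting))
  define a c where "a = fst w" and "c = snd w"
  have ac: "(a, c) \<in> ?S" and amin: "\<And>b d. (b, d) \<in> ?S \<Longrightarrow> a \<le> b"
    using w wmin unfolding a_def c_def by (simp, fastforce)
  define th where "th = (\<lambda>(b::nat, d::int). \<alpha> * real b - real_of_int d)"
  define t where "t = \<alpha> * real a - real_of_int c"
  have a1: "1 \<le> a" "real a \<le> A" "0 < \<bar>t\<bar>" "\<bar>t\<bar> \<le> \<xi>"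
    using ac unfolding near_multiples_def t_def by auto
  \<comment> \<open>Dividing (a, c) by a common factor would give a point of the set with smaller
    first coordinate.\<close>
  have cop: "coprime (int a) c"
  proof (rule ccontr)
    assume nc: "\<not> coprime (int a) c"
    define g where "g = gcd (int a) c"
    have gpos: "g > 0" using a1(1) unfolding g_def by simp
    have g1: "g \<noteq> 1" using nc unfolding g_def coprime_iff_gcd_eq_1 by simp
    with gpos have g2: "g \<ge> 2" by linarith
    obtain a'' where a'': "int a = g * a''" using g_def by (metis gcd_dvd1 dvdE)
    obtain c'' where c'': "c = g * c''" using g_def by (metis gcd_dvd2 dvdE)
    have pa: "a'' > 0" using a'' a1(1) gpos
      by (metis mult.commute of_nat_0_less_iff less_le_trans zero_less_one zero_less_mult_pos2)
    define b where "b = nat a''"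
    have b: "int b = a''" using pa b_def by simp
    have rb: "real a = real_of_int g * real b" using a'' b by (metis of_int_mult of_int_of_nat_eq)
    have tt: "t = real_of_int g * (\<alpha> * real b - real_of_int c'')"
      unfolding t_def rb c'' by (simp add: algebra_simps)
    have gr: "real_of_int g \<ge> 2" using g2 by simp
    have "\<bar>t\<bar> = real_of_int g * \<bar>\<alpha> * real b - real_of_int c''\<bar>"
      using tt gr by (simp add: abs_mult)
    then have "\<bar>\<alpha> * real b - real_of_int c''\<bar> \<le> \<bar>t\<bar>" "0 < \<bar>\<alpha> * real b - real_of_int c''\<bar>"
      using gr a1(3) mult_right_mono[of 1 "real_of_int g" "\<bar>\<alpha> * real b - real_of_int c''\<bar>"] by (simp, force)
    moreover have "2 * real b \<le> real a" unfolding rb using gr by (intro mult_right_mono) auto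
    moreover have "b \<ge> 1" using pa b_def by linarith
    ultimately have "(b, c'') \<in> ?S" using a1 unfolding near_multiples_def by auto
    from amin[OF this] \<open>2 * real b \<le> real a\<close> \<open>b \<ge> 1\<close> show False by linarith
  qed
  define R where "R = real a * \<xi> + A * \<bar>t\<bar>"
  have A0: "A > 0" and xi0: "\<xi> > 0" using a1 by auto
  have R0: "R \<ge> 0" unfolding R_def using A0 xi0 by auto
  define f where "f = (\<lambda>(b::nat, d::int). int b * c - int a * d)"
  define n where "n = min (A / real a) (2 * \<xi> / \<bar>t\<bar>)"
  have thx: "\<bar>th x\<bar> \<le> \<xi>" "1 \<le> fst x" "real (fst x) \<le> A" if "x \<in> ?S" for x
    using that unfolding near_multiples_def th_def by (auto split: prod.splits)
  have fR: "\<bar>real_of_int (f x)\<bar> \<le> R" if "x \<in> ?S" for x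
  proof -
    obtain b d where x: "x = (b, d)" by (cases x)
    have "real_of_int (f x) = real a * th x - real b * t"
      unfolding f_def th_def t_def x by (simp add: algebra_simps)
    moreover have "\<bar>real a * th x\<bar> \<le> real a * \<xi>" using thx[OF that] by (simp add: abs_mult mult_left_mono)
    moreover have "\<bar>real b * t\<bar> \<le> A * \<bar>t\<bar>" using thx(3)[OF that] x by (simp add: abs_mult mult_right_mono)
    ultimately show ?thesis unfolding R_def by linarith
  qed
  have cardf: "real (card (f ` ?S)) \<le> 2 * R + 1"
  proof -
    have "f ` ?S \<subseteq> {s. - R \<le> real_of_int s \<and> real_of_int s \<le> R}" using fR by (force simp: abs_le_iff)
    then have "card (f ` ?S) \<le> card {s. - R \<le> real_of_int s \<and> real_of_int s \<le> R}"
      by (rule card_mono[OF finite_int_Icc_real])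
    then show ?thesis using card_int_Icc_real_le[where x="-R" and y=R] R0 by linarith
  qed
  have fib: "real (card {x \<in> ?S. f x = k}) \<le> n + 1" for k
  proof -
    let ?F = "{x \<in> ?S. f x = k}"
    \<comment> \<open>Points of one fibre differ by a vector of determinant 0 with (a, c); as (a, c)
      is primitive, that vector is an integer multiple of it.\<close>
    have key: "\<exists>s. int (fst x) - int (fst y) = int a * s \<and> snd x - snd y = c * s" if "x \<in> ?F" "y \<in> ?F" for x y
    proof -
      have e: "(int (fst x) - int (fst y)) * c = int a * (snd x - snd y)"
        using that unfolding f_def by (auto simp: algebra_simps split: prod.splits)
      then have "int a dvd (int (fst x) - int (fst y)) * c" by simp
      then have "int a dvd int (fst x) - int (fst y)" using cop coprime_dvd_mult_left_iff by blast
      then obtain s where s: "int (fst x) - int (fst y) = int a * s" by blast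
      have "int a * (c * s) = int a * (snd x - snd y)" using e s by (simp add: algebra_simps)
      then have "c * s = snd x - snd y" using a1(1) by simp
      then show ?thesis using s by auto
    qed
    have b1: "real (card ?F) \<le> A / real a + 1"
    proof -
      have "inj_on (\<lambda>x. int (fst x div a)) ?F"
      proof (rule inj_onI)
        fix x y assume xy: "x \<in> ?F" "y \<in> ?F" "int (fst x div a) = int (fst y div a)"
        obtain s where s: "int (fst x) - int (fst y) = int a * s" "snd x - snd y = c * s" using key[OF xy(1,2)] by blast
        have "int (fst x) = int a * s + int (fst y)" using s(1) by simp
        then have "int (fst x) div int a = s + int (fst y) div int a" using a1(1) by simp
        then have "s = 0" using xy(3) by (simp add: zdiv_int)
        then show "x = y" using s by (auto intro: prod_eqI)
      qed
      then have "card ?F = card ((\<lambda>x. int (fst x div a)) ` ?F)" by (simp add: card_image)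
      also have "\<dots> \<le> card {s::int. 0 \<le> real_of_int s \<and> real_of_int s \<le> A / real a}"
      proof (rule card_mono[OF finite_int_Icc_real], rule image_subsetI)
        fix x assume "x \<in> ?F"
        then have "real (fst x) / real a \<le> A / real a" using thx by (simp add: divide_right_mono)
        moreover have "real (fst x div a) \<le> real (fst x) / real a" by (rule real_div_ge)
        ultimately show "int (fst x div a) \<in> {s. 0 \<le> real_of_int s \<and> real_of_int s \<le> A / real a}" by simp
      qed
      finally show ?thesis using card_int_Icc_real_le[where x=0 and y="A / real a"] A0 by (auto intro: order_trans)
    qed
    have b2: "real (card ?F) \<le> 2 * \<xi> / \<bar>t\<bar> + 1"
    proof -
      \<comment> \<open>Adding s (a, c) changes \<open>th\<close> by s t, so rounding in units of
        |t| separates the points of a fibre; \<open>th\<close> ranges over an interval of length 2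
        \<xi>.\<close>
      have "inj_on (\<lambda>x. \<lfloor>(th x + \<xi>) / \<bar>t\<bar>\<rfloor>) ?F"
      proof (rule inj_onI)
        fix x y assume xy: "x \<in> ?F" "y \<in> ?F" "\<lfloor>(th x + \<xi>) / \<bar>t\<bar>\<rfloor> = \<lfloor>(th y + \<xi>) / \<bar>t\<bar>\<rfloor>"
        obtain s where s: "int (fst x) - int (fst y) = int a * s" "snd x - snd y = c * s" using key[OF xy(1,2)] by blast
        have sr: "real (fst x) - real (fst y) = real a * real_of_int s" "real_of_int (snd x) - real_of_int (snd y) = real_of_int c * real_of_int s"
          using arg_cong[OF s(1), of real_of_int] arg_cong[OF s(2), of real_of_int] by simp_all
        have "th x - th y = \<alpha> * (real (fst x) - real (fst y)) - (real_of_int (snd x) - real_of_int (snd y))"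
          unfolding th_def by (simp add: algebra_simps split: prod.splits)
        also have "\<dots> = real_of_int s * t" unfolding sr t_def by (simp add: algebra_simps)
        finally have "(th x + \<xi>) / \<bar>t\<bar> = (th y + \<xi>) / \<bar>t\<bar> + real_of_int s * (t / \<bar>t\<bar>)"
          using a1(3) by (simp add: field_simps)
        moreover have "real_of_int s * (t / \<bar>t\<bar>) = real_of_int (if t > 0 then s else - s)"
          using a1(3) by (auto simp: abs_if)
        ultimately have "\<lfloor>(th x + \<xi>) / \<bar>t\<bar>\<rfloor> = \<lfloor>(th y + \<xi>) / \<bar>t\<bar>\<rfloor> + (if t > 0 then s else - s)"
          by (simp only: floor_add_int)
        then have "s = 0" using xy(3) by (simp split: if_splits)
        then show "x = y" using s by (auto intro: prod_eqI)
      qed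
      then have "card ?F = card ((\<lambda>x. \<lfloor>(th x + \<xi>) / \<bar>t\<bar>\<rfloor>) ` ?F)" by (simp add: card_image)
      also have "\<dots> \<le> card {s::int. 0 \<le> real_of_int s \<and> real_of_int s \<le> 2 * \<xi> / \<bar>t\<bar>}"
      proof (rule card_mono[OF finite_int_Icc_real], rule image_subsetI)
        fix x assume "x \<in> ?F"
        then have "\<bar>th x\<bar> \<le> \<xi>" using thx by blast
        then have "0 \<le> (th x + \<xi>) / \<bar>t\<bar>" "(th x + \<xi>) / \<bar>t\<bar> \<le> 2 * \<xi> / \<bar>t\<bar>"
          by (auto intro!: divide_nonneg_nonneg divide_right_mono)
        then show "\<lfloor>(th x + \<xi>) / \<bar>t\<bar>\<rfloor> \<in> {s. 0 \<le> real_of_int s \<and> real_of_int s \<le> 2 * \<xi> / \<bar>t\<bar>}"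
          by (auto intro: order_trans[OF of_int_floor_le])
      qed
      finally show ?thesis using card_int_Icc_real_le[where x=0 and y="2 * \<xi> / \<bar>t\<bar>"] xi0 by (auto intro: order_trans)
    qed
    show ?thesis using b1 b2 unfolding n_def by linarith
  qed
  have tot: "real (card ?S) \<le> (2 * R + 1) * (n + 1)"
  proof -
    have n0: "n + 1 \<ge> 0" unfolding n_def using A0 xi0 by simp
    have "real (card ?S) \<le> real (card (f ` ?S)) * (n + 1)"
      by (rule card_le_fibres[OF finite_near_multiples]) (rule fib)
    also have "\<dots> \<le> (2 * R + 1) * (n + 1)" using cardf n0 by (rule mult_right_mono)
    finally show ?thesis .
  qed
  have n1: "n \<ge> 1" unfolding n_def using a1 by (auto simp: field_simps)
  have na: "n * real a \<le> A" and nt: "n * \<bar>t\<bar> \<le> 2 * \<xi>"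
    using a1 mult_right_mono[of n "A / real a" "real a"] mult_right_mono[of n "2 * \<xi> / \<bar>t\<bar>" "\<bar>t\<bar>"]
    unfolding n_def by (auto simp: field_simps min_def)
  have "(n * real a) * \<xi> \<le> A * \<xi>" "A * (n * \<bar>t\<bar>) \<le> A * (2 * \<xi>)" "real a * \<xi> \<le> A * \<xi>" "A * \<bar>t\<bar> \<le> A * \<xi>"
    using na nt A0 xi0 a1 by (auto intro!: mult_right_mono mult_left_mono)
  \<comment> \<open>10 = 6 + 4: n R is at most 3 A \<xi>, R is at most 2 A \<xi>, and n + 1 \<le> 2
    n.\<close>
  then have "(2 * R + 1) * (n + 1) \<le> 10 * A * \<xi> + 2 * n"
    unfolding R_def using n1 by (simp add: algebra_simps)
  with tot have "real (card ?S) \<le> 10 * A * \<xi> + 2 * n" by linarith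
  moreover have "real a \<le> A / n" "\<bar>\<alpha> * real a - real_of_int c\<bar> \<le> 2 * \<xi> / n"
    using na nt n1 unfolding t_def by (auto simp: field_simps)
  ultimately show ?thesis using that[OF ac n1] by blast
qed

section \<open>Elementary prime number estimates\<close>

definition cheb_psi :: "nat \<Rightarrow> real" where "cheb_psi n = (\<Sum>e\<in>{1..n}. mangoldt e)"

lemma card_multiples: "d > 0 \<Longrightarrow> card {k\<in>{1..n::nat}. d dvd k} = n div d"
proof -
  assume d: "d > 0"
  have "{k\<in>{1..n}. d dvd k} = (\<lambda>m. d * m) ` {1..n div d}"
    using d by (auto simp: image_iff less_eq_div_iff_mult_less_eq mult.commute elim!: dvdE)
  moreover have "inj_on (\<lambda>m. d * m) {1..n div d}" using d by (auto intro: inj_onI)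
  ultimately show ?thesis by (simp add: card_image)
qed

text \<open>Legendre's identity: ln k is the sum of \<open>mangoldt\<close> over the divisors of k,
  and e divides n div e of the numbers up to n.\<close>

lemma ln_fact_mangoldt: "ln (fact n) = (\<Sum>e\<in>{1..n}. mangoldt e * real (n div e))"
proof -
  have "ln (fact n :: real) = (\<Sum>k\<in>{1..n}. ln (real k))"
    unfolding fact_prod of_nat_prod by (subst ln_prod) auto
  also have "\<dots> = (\<Sum>k\<in>{1..n}. \<Sum>e\<in>{e\<in>{1..n}. e dvd k}. mangoldt e)"
  proof (rule sum.cong[OF refl])
    fix k assume k: "k \<in> {1..n}"
    then have "{e\<in>{1..n}. e dvd k} = {e. e dvd k}" by (auto dest: dvd_imp_le dvd_pos_nat intro: Suc_leI)
    then show "ln (real k) = (\<Sum>e\<in>{e\<in>{1..n}. e dvd k}. mangoldt e)"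
      using mangoldt_sum[of k, where ?'a = real] k by auto
  qed
  also have "\<dots> = (\<Sum>e\<in>{1..n}. \<Sum>k\<in>{k\<in>{1..n}. e dvd k}. mangoldt e)"
    by (rule sum.swap_restrict) auto
  also have "\<dots> = (\<Sum>e\<in>{1..n}. mangoldt e * real (n div e))"
    by (rule sum.cong[OF refl]) (subst sum_constant, subst card_multiples, auto)
  finally show ?thesis .
qed

text \<open>The middle binomial coefficient is at most 2^n, and the two factorials in its
  denominator differ by a factor of at most n + 1. This is the input for Chebyshev's bound.\<close>

lemma fact_le_half: "ln (fact n) - 2 * ln (fact (n div 2)) \<le> 2 * real n"
proof -
  let ?h = "n div 2"
  have e: "fact n = real (n choose ?h) * (fact ?h * fact (n - ?h))"
    using binomial_fact_lemma[of ?h n] by (metis (no_types, lifting) div_le_dividend mult.commute of_nat_fact of_nat_mult)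
  have f2: "fact (n - ?h) \<le> real (n + 1) * fact ?h"
  proof (cases "even n")
    case True
    then have "n - ?h = ?h" by auto
    then show ?thesis by simp
  next
    case False
    then have "n - ?h = Suc ?h" by (auto elim!: oddE)
    then have "fact (n - ?h) = real (Suc ?h) * fact ?h" by simp
    also have "\<dots> \<le> real (n + 1) * fact ?h" by (intro mult_right_mono) auto
    finally show ?thesis .
  qed
  have "(fact n :: real) \<le> 2 ^ n * (fact ?h * (real (n + 1) * fact ?h))"
  proof -
    have "real (n choose ?h) \<le> real (2 ^ n)"
    proof -
      have "(n choose ?h) \<le> (\<Sum>k\<le>n. n choose k)" by (rule member_le_sum) auto
      then show ?thesis by (simp add: choose_row_sum del: of_nat_power)
    qed
    then show ?thesis unfolding e using f2 by (intro mult_mono) (auto)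
  qed
  then have "ln (fact n :: real) \<le> ln (2 ^ n * (fact ?h * (real (n + 1) * fact ?h)))"
    by (subst ln_le_cancel_iff) auto
  also have "\<dots> = real n * ln 2 + 2 * ln (fact ?h) + ln (real (n + 1))"
    by (simp add: ln_mult ln_realpow)
  finally have "ln (fact n :: real) - 2 * ln (fact ?h) \<le> real n * ln 2 + ln (real (n + 1))" by simp
  also have "\<dots> \<le> real n * 1 + real n"
    using ln_add_one_self_le_self[of "real n"] ln_2_less_1
    by (intro add_mono mult_left_mono) (auto simp: add.commute)
  finally show ?thesis by simp
qed

text \<open>Chebyshev's argument: n div e - 2 * ((n div 2) div e) is never negative and is at least
  1 for n div 2 < e \<le> n, so psi grows by at most 2 n between n div 2 and n; repeated halving
  doubles the constant.\<close>

lemma cheb_psi_le: "cheb_psi n \<le> 4 * real n"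
proof (induction n rule: less_induct)
  case (less n)
  show ?case
  proof (cases "n = 0")
    case False
    let ?h = "n div 2"
    have h: "ln (fact ?h) = (\<Sum>e\<in>{1..n}. mangoldt e * real (?h div e))"
      unfolding ln_fact_mangoldt by (rule sum.mono_neutral_left) auto
    have "cheb_psi n - cheb_psi ?h = (\<Sum>e\<in>{1..n} - {1..?h}. mangoldt e)"
      unfolding cheb_psi_def by (subst sum_diff) auto
    also have "\<dots> = (\<Sum>e\<in>{1..n}. mangoldt e * (if e \<le> ?h then 0 else 1))"
      by (rule sum.mono_neutral_cong_left) auto
    also have "\<dots> \<le> (\<Sum>e\<in>{1..n}. mangoldt e * (real (n div e) - 2 * real (?h div e)))"
    proof (rule sum_mono, rule mult_left_mono)
      fix e assume e: "e \<in> {1..n}"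
      show "(if e \<le> ?h then 0 else 1) \<le> real (n div e) - 2 * real (?h div e)"
      proof (cases "e \<le> ?h")
        case True
        have "2 * (?h div e) \<le> n div e"
        proof -
          have "?h div e * e \<le> ?h" by simp
          then have "2 * (?h div e) * e \<le> n" by linarith
          then show ?thesis using e by (simp add: less_eq_div_iff_mult_less_eq)
        qed
        then have "real (2 * (?h div e)) \<le> real (n div e)" by (rule of_nat_mono)
        then show ?thesis using True by simp
      next
        case False
        then have "n div e \<ge> 1" using e by (simp add: Suc_le_eq div_greater_zero_iff)
        then show ?thesis using False by simp
      qed
    qed (rule mangoldt_nonneg)
    also have "\<dots> = ln (fact n) - 2 * ln (fact ?h)"
      unfolding h ln_fact_mangoldt[of n] by (simp add: algebra_simps sum_subtractf sum_distrib_left)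
    also have "\<dots> \<le> 2 * real n" by (rule fact_le_half)
    finally have "cheb_psi n \<le> cheb_psi ?h + 2 * real n" by simp
    moreover have "cheb_psi ?h \<le> 4 * real ?h" using less.IH[of ?h] False by simp
    moreover have "2 * real ?h \<le> real n" by linarith
    ultimately show ?thesis by linarith
  qed (simp add: cheb_psi_def)
qed

text \<open>Mertens' estimate: ln n! is at most n ln n, and replacing n / e by n div e costs at most
  psi(n) \<le> 4 n.\<close>

lemma sum_mangoldt_div_le:
  assumes "n \<ge> 1" shows "(\<Sum>e\<in>{1..n}. mangoldt e / real e) \<le> ln (real n) + 4"
proof -
  have "real n * (\<Sum>e\<in>{1..n}. mangoldt e / real e) = (\<Sum>e\<in>{1..n}. mangoldt e * (real n / real e))"
    by (simp add: sum_distrib_left algebra_simps)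
  also have "\<dots> \<le> (\<Sum>e\<in>{1..n}. mangoldt e * (real (n div e) + 1))"
  proof (intro sum_mono mult_left_mono)
    fix e assume e: "e \<in> {1..n}"
    show "real n / real e \<le> real (n div e) + 1"
      by (rule real_div_le)
  qed (rule mangoldt_nonneg)
  also have "\<dots> = ln (fact n) + cheb_psi n"
    unfolding ln_fact_mangoldt cheb_psi_def by (simp add: algebra_simps sum.distrib)
  also have "\<dots> \<le> real n * ln (real n) + 4 * real n"
  proof (intro add_mono cheb_psi_le)
    have "ln (fact n :: real) = (\<Sum>k\<in>{1..n}. ln (real k))" unfolding fact_prod of_nat_prod by (subst ln_prod) auto
    also have "\<dots> \<le> (\<Sum>k\<in>{1..n}. ln (real n))" by (rule sum_mono) auto
    finally show "ln (fact n :: real) \<le> real n * ln (real n)" by simp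
  qed
  also have "\<dots> = real n * (ln (real n) + 4)" by (simp add: algebra_simps)
  finally show ?thesis using assms by simp
qed

section \<open>Reciprocal sums over smooth numbers\<close>

definition smooth :: "real \<Rightarrow> nat \<Rightarrow> bool" where
  "smooth y d \<longleftrightarrow> (\<forall>p. prime p \<longrightarrow> p dvd d \<longrightarrow> real p \<le> y)"

lemma smooth_dvd: "smooth y d \<Longrightarrow> e dvd d \<Longrightarrow> smooth y e"
  unfolding smooth_def by (meson dvd_trans)

definition smooth_sum :: "real \<Rightarrow> nat \<Rightarrow> real" where
  "smooth_sum y X = (\<Sum>d\<in>{d\<in>{1..X}. smooth y d}. 1 / real d)"

lemma sum_inverse_le: "(\<Sum>k\<in>{1..n}. 1 / real k) \<le> 1 + ln (real n)" if "n \<ge> 1"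
  using that
proof (induction n rule: dec_induct)
  case (step n)
  have "1 / real (Suc n) \<le> ln (real (Suc n)) - ln (real n)"
  proof -
    have "ln (real n / real (Suc n)) \<le> real n / real (Suc n) - 1" using step.hyps by (intro ln_le_minus_one) auto
    then show ?thesis using step.hyps by (simp add: ln_div field_simps)
  qed
  then show ?case using step.IH by (simp add: sum.nat_ivl_Suc')
qed simp

lemma sum_inverse_ge: "ln (real n + 1) \<le> (\<Sum>k\<in>{1..n}. 1 / real k)"
proof (induction n)
  case (Suc n)
  have "ln (real (Suc n) + 1) - ln (real n + 1) \<le> 1 / real (Suc n)"
    using ln_le_minus_one[of "(real (Suc n) + 1) / (real n + 1)"]
    by (simp add: ln_div field_simps)
  then show ?case using Suc.IH by (simp add: sum.nat_ivl_Suc')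
qed simp

lemma sum_ln_prime_div_le:
  assumes "y \<ge> 1"
  shows "(\<Sum>p\<in>{p::nat. prime p \<and> real p \<le> y}. ln (real p) / real p) \<le> ln y + 4"
proof -
  let ?n = "nat \<lfloor>y\<rfloor>"
  have "(\<Sum>p\<in>{p::nat. prime p \<and> real p \<le> y}. ln (real p) / real p)
      = (\<Sum>p\<in>{p::nat. prime p \<and> real p \<le> y}. mangoldt p / real p)"
    by (rule sum.cong) auto
  also have "\<dots> \<le> (\<Sum>e\<in>{1..?n}. mangoldt e / real e)"
  proof (rule sum_mono2)
    show "{p. prime p \<and> real p \<le> y} \<subseteq> {1..?n}" by (auto simp: le_nat_floor Suc_le_eq prime_gt_0_nat)
  qed (auto intro: divide_nonneg_nonneg mangoldt_nonneg)
  also have "\<dots> \<le> ln (real ?n) + 4" using assms by (intro sum_mangoldt_div_le) (simp add: le_nat_floor)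
  also have "\<dots> \<le> ln y + 4" using assms by (simp add: le_nat_floor)
  finally show ?thesis .
qed

lemma ln_eq_sum_multiplicity:
  assumes "d > 0" "smooth y d"
  shows "ln (real d) = (\<Sum>p\<in>{p::nat. prime p \<and> real p \<le> y}. real (multiplicity p d) * ln (real p))"
proof -
  have "real d = (\<Prod>p\<in>prime_factors d. real p ^ multiplicity p d)"
    using prime_factorization_nat[of d] assms(1) by (metis (mono_tags, lifting) of_nat_power of_nat_prod prod.cong)
  then have "ln (real d) = ln (\<Prod>p\<in>prime_factors d. real p ^ multiplicity p d)" by simp
  also have "\<dots> = (\<Sum>p\<in>prime_factors d. ln (real p ^ multiplicity p d))"
    by (rule ln_prod) (auto simp: in_prime_factors_iff prime_gt_0_nat)
  also have "\<dots> = (\<Sum>p\<in>prime_factors d. real (multiplicity p d) * ln (real p))"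
    by (rule sum.cong) (auto simp: ln_realpow in_prime_factors_iff prime_gt_0_nat)
  also have "\<dots> = (\<Sum>p\<in>{p::nat. prime p \<and> real p \<le> y}. real (multiplicity p d) * ln (real p))"
  proof (rule sum.mono_neutral_left)
    show "finite {p::nat. prime p \<and> real p \<le> y}" by (rule finite_subset[OF _ finite_nat_le_real[of y]]) auto
    show "prime_factors d \<subseteq> {p. prime p \<and> real p \<le> y}"
      using assms(2) by (auto simp: smooth_def in_prime_factors_iff)
    show "\<forall>p\<in>{p. prime p \<and> real p \<le> y} - prime_factors d. real (multiplicity p d) * ln (real p) = 0"
      using assms(1) by (auto simp: in_prime_factors_iff not_dvd_imp_multiplicity_0)
  qed
  finally show ?thesis .
qed

lemma smooth_sum_nonneg: "smooth_sum y X \<ge> 0"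
  unfolding smooth_sum_def by (rule sum_nonneg) auto

text \<open>The average of \<open>ln d\<close> over smooth \<open>d\<close> with weight \<open>1/d\<close> is \<open>O(ln y)\<close>; by Markov's
  inequality half of the weight then sits on \<open>d\<close> below a fixed power of \<open>y\<close>.\<close>

lemma smooth_sum_le:
  assumes "y \<ge> 1"
  shows "smooth_sum y X \<le> 34 * (1 + ln y)"
proof -
  let ?D = "{d\<in>{1..X}. smooth y d}"
  let ?P = "{p::nat. prime p \<and> real p \<le> y}"
  define H where "H = smooth_sum y X"
  have H0: "H \<ge> 0" unfolding H_def by (rule smooth_sum_nonneg)
  have finP: "finite ?P" by (rule finite_subset[OF _ finite_nat_le_real[of y]]) auto
  define S where "S = (\<lambda>p. \<Sum>d\<in>?D. real (multiplicity p d) / real d)"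
  \<comment> \<open>Writing d = p m lowers the multiplicity by one, so S p \<le> (H + S p) / p, and
    p \<ge> 2 absorbs the second S p.\<close>
  have S: "S p \<le> 2 * H / real p" if p: "p \<in> ?P" for p
  proof -
    have pp: "prime p" "p \<ge> 2" using p prime_ge_2_nat by auto
    have "S p = (\<Sum>d\<in>{d\<in>?D. p dvd d}. real (multiplicity p d) / real d)"
      unfolding S_def by (rule sum.mono_neutral_right) (auto simp: not_dvd_imp_multiplicity_0)
    also have "\<dots> \<le> (\<Sum>m\<in>?D. (1 + real (multiplicity p m)) / (real p * real m))"
    proof (rule sum_le_included[where i = "\<lambda>m. p * m"])
      show "\<forall>d\<in>{d \<in> ?D. p dvd d}. \<exists>m\<in>?D. p * m = d \<and>
        real (multiplicity p d) / real d \<le> (1 + real (multiplicity p m)) / (real p * real m)"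
      proof
        fix d assume d: "d \<in> {d \<in> ?D. p dvd d}"
        then obtain m where m: "d = p * m" by blast
        have m0: "m > 0" using d m by (auto intro: Nat.gr0I)
        have "m \<le> p * m" using pp(2) by simp
        moreover have "p * m \<le> X" using d m by simp
        ultimately have "m \<le> X" by (rule order_trans)
        then have "m \<in> ?D" using d m m0 smooth_dvd[of y d m] by auto
        moreover have "multiplicity p d = Suc (multiplicity p m)"
          unfolding m using pp m0 by (intro multiplicity_times_same) auto
        ultimately show "\<exists>m\<in>?D. p * m = d \<and>
          real (multiplicity p d) / real d \<le> (1 + real (multiplicity p m)) / (real p * real m)"
          using m by (intro bexI[of _ m]) auto
      qed
    qed auto
    also have "\<dots> = (H + S p) / real p"
      unfolding H_def S_def smooth_sum_def
      by (simp add: add_divide_distrib sum.distrib sum_divide_distrib algebra_simps)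
    finally have "S p * real p \<le> H + S p" using pp by (simp add: field_simps)
    moreover have "S p \<ge> 0" unfolding S_def by (intro sum_nonneg) auto
    then have "2 * S p \<le> S p * real p" using pp mult_right_mono[of 2 "real p" "S p"] by (simp add: mult.commute)
    ultimately have "S p * real p \<le> 2 * H" by linarith
    then show ?thesis using pp by (simp add: field_simps)
  qed
  have "(\<Sum>d\<in>?D. ln (real d) / real d) = (\<Sum>d\<in>?D. \<Sum>p\<in>?P. ln (real p) * (real (multiplicity p d) / real d))"
  proof (rule sum.cong[OF refl])
    fix d assume d: "d \<in> ?D"
    then show "ln (real d) / real d = (\<Sum>p\<in>?P. ln (real p) * (real (multiplicity p d) / real d))"
      by (subst ln_eq_sum_multiplicity[of d y]) (auto simp: sum_divide_distrib algebra_simps)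
  qed
  also have "\<dots> = (\<Sum>p\<in>?P. ln (real p) * S p)"
    unfolding S_def by (subst sum.swap) (simp add: sum_distrib_left)
  also have "\<dots> \<le> (\<Sum>p\<in>?P. ln (real p) * (2 * H / real p))"
    by (intro sum_mono mult_left_mono S) (auto intro!: ln_ge_zero dest: prime_gt_0_nat simp: Suc_le_eq)
  also have "\<dots> = 2 * H * (\<Sum>p\<in>?P. ln (real p) / real p)" by (simp add: sum_distrib_left algebra_simps)
  also have "\<dots> \<le> 2 * H * (ln y + 4)"
    using H0 by (intro mult_left_mono sum_ln_prime_div_le assms) auto
  finally have A: "(\<Sum>d\<in>?D. ln (real d) / real d) \<le> 2 * H * (ln y + 4)" .
  \<comment> \<open>Twice the bound 2 (ln y + 4) for the average of ln d, so the part with ln d > L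
    is at most H / 2. The other d are at most exp L, whence H \<le> 2 (1 + L) = 34 + 8 ln y.\<close>
  define L where "L = 4 * (ln y + 4)"
  have lny: "ln y \<ge> 0" using assms by simp
  have L0: "L > 0" unfolding L_def using lny by simp
  have "H = (\<Sum>d\<in>{d\<in>?D. ln (real d) > L}. 1 / real d) + (\<Sum>d\<in>{d\<in>?D. \<not> ln (real d) > L}. 1 / real d)"
    unfolding H_def smooth_sum_def by (subst sum.union_disjoint[symmetric]) (auto intro: sum.cong)
  also have "(\<Sum>d\<in>{d\<in>?D. ln (real d) > L}. 1 / real d) \<le> (\<Sum>d\<in>{d\<in>?D. ln (real d) > L}. (ln (real d) / L) * (1 / real d))"
  proof (rule sum_mono)
    fix d assume "d \<in> {d\<in>?D. ln (real d) > L}"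
    then have "1 \<le> ln (real d) / L" using L0 by simp
    then show "1 / real d \<le> (ln (real d) / L) * (1 / real d)"
      using mult_right_mono[of 1 "ln (real d) / L" "1 / real d"] by simp
  qed
  also have "\<dots> \<le> (\<Sum>d\<in>?D. (ln (real d) / L) * (1 / real d))"
    by (rule sum_mono2) (use L0 in auto)
  also have "\<dots> = (\<Sum>d\<in>?D. ln (real d) / real d) / L" by (simp add: sum_divide_distrib mult.commute)
  also have "\<dots> \<le> 2 * H * (ln y + 4) / L" using A L0 by (simp add: divide_right_mono)
  also have "\<dots> = H / 2" unfolding L_def using lny by (simp add: field_simps)
  also have "(\<Sum>d\<in>{d\<in>?D. \<not> ln (real d) > L}. 1 / real d) \<le> (\<Sum>d\<in>{1..nat \<lfloor>exp L\<rfloor>}. 1 / real d)"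
  proof (rule sum_mono2)
    show "{d\<in>?D. \<not> ln (real d) > L} \<subseteq> {1..nat \<lfloor>exp L\<rfloor>}"
    proof
      fix d assume d: "d \<in> {d\<in>?D. \<not> ln (real d) > L}"
      then have "0 < real d" "ln (real d) \<le> L" by auto
      then have "real d \<le> exp L" by (metis exp_le_cancel_iff exp_ln)
      then show "d \<in> {1..nat \<lfloor>exp L\<rfloor>}" using d by (auto simp: le_nat_floor)
    qed
  qed auto
  also have "\<dots> \<le> 1 + ln (real (nat \<lfloor>exp L\<rfloor>))" using L0 by (intro sum_inverse_le) (simp add: le_nat_floor)
  also have "\<dots> \<le> 1 + L"
  proof -
    have "1 \<le> exp L" using L0 by simp
    then have "0 < real (nat \<lfloor>exp L\<rfloor>)" "real (nat \<lfloor>exp L\<rfloor>) \<le> exp L" by linarith+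
    then have "ln (real (nat \<lfloor>exp L\<rfloor>)) \<le> ln (exp L)" by (subst ln_le_cancel_iff) auto
    then show ?thesis by simp
  qed
  finally have "H \<le> 2 * (1 + L)" by simp
  then show ?thesis unfolding H_def[symmetric] L_def using lny by (simp add: algebra_simps)
qed

text \<open>The classical argument of Hall: compare \<open>\<Sum> ln b\<close> with \<open>\<Sum> \<Lambda>\<close>.\<close>

lemma divisor_closed_card_le:
  assumes U: "U \<subseteq> {1..x}" and x: "x \<ge> 1" and cl: "\<And>b e. b \<in> U \<Longrightarrow> e dvd b \<Longrightarrow> e \<in> U"
  shows "real (card U) * ln (real x) \<le> 5 * real x * (\<Sum>m\<in>U. 1 / real m)"
proof -
  have fin: "finite U" using U finite_subset by blast
  have "(\<Sum>b\<in>U. ln (real b)) = (\<Sum>b\<in>U. \<Sum>e\<in>{e. e dvd b}. mangoldt e)"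
  proof (rule sum.cong[OF refl])
    fix b assume "b \<in> U"
    then have "b \<noteq> 0" using U by auto
    then show "ln (real b) = (\<Sum>e\<in>{e. e dvd b}. mangoldt e)" using mangoldt_sum[of b, where ?'a=real] by simp
  qed
  also have "\<dots> = (\<Sum>w\<in>Sigma U (\<lambda>b. {e. e dvd b}). mangoldt (snd w))"
    using fin U by (subst sum.Sigma) (auto intro!: finite_divisors_nat simp: case_prod_unfold)
  \<comment> \<open>With b = m e the cofactor m lies in U by closure under divisors, and e runs up
    to x div m.\<close>
  also have "\<dots> \<le> (\<Sum>w\<in>Sigma U (\<lambda>m. {1..x div m}). mangoldt (snd w))"
  proof (rule sum_le_included[where i = "\<lambda>w. (fst w * snd w, snd w)"], goal_cases)
    case 1
    show ?case using fin U by (intro finite_SigmaI) (auto intro!: finite_divisors_nat)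
  next
    case 2
    show ?case using fin by auto
  next
    case 3
    show ?case by (auto intro: mangoldt_nonneg)
  next
    case 4
    show ?case
    proof
      fix y assume y: "y \<in> Sigma U (\<lambda>b. {e. e dvd b})"
      then obtain b e where be: "y = (b, e)" "b \<in> U" "e dvd b" by auto
      then obtain m where m: "b = m * e" by (metis dvdE mult.commute)
      have b1: "1 \<le> b" "b \<le> x" using be U by auto
      have mU: "m \<in> U" using cl[OF be(2), of m] m by simp
      have me: "m > 0" "e > 0" using m b1 by (auto intro: Nat.gr0I)
      have "e \<le> x div m" using m b1 \<open>m > 0\<close> by (simp add: less_eq_div_iff_mult_less_eq mult.commute)
      then have "(m, e) \<in> Sigma U (\<lambda>m. {1..x div m})" using mU me by auto
      then show "\<exists>ya\<in>Sigma U (\<lambda>m. {1..x div m}). (fst ya * snd ya, snd ya) = y \<and>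
        mangoldt (snd y) \<le> (mangoldt (snd ya) :: real)"
        using be m by (intro bexI[of _ "(m, e)"]) auto
    qed
  qed
  also have "\<dots> = (\<Sum>m\<in>U. cheb_psi (x div m))"
    unfolding cheb_psi_def using fin by (subst sum.Sigma) (auto simp: case_prod_unfold)
  also have "\<dots> \<le> (\<Sum>m\<in>U. 4 * (real x / real m))"
    by (intro sum_mono order_trans[OF cheb_psi_le] mult_left_mono real_div_ge) auto
  finally have 1: "(\<Sum>b\<in>U. ln (real b)) \<le> 4 * real x * (\<Sum>m\<in>U. 1 / real m)" by (simp add: sum_distrib_left)
  \<comment> \<open>Replacing ln b by ln x costs ln(x / b) \<le> x / b for each b; this is the step
    from 4 to 5 in the constant.\<close>
  have "(\<Sum>b\<in>U. ln (real x) - ln (real b)) \<le> (\<Sum>b\<in>U. real x * (1 / real b))"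
  proof (rule sum_mono)
    fix b assume "b \<in> U"
    then have b: "b \<ge> 1" using U by auto
    have "ln (real x / real b) \<le> real x / real b - 1" using b x by (intro ln_le_minus_one) auto
    then show "ln (real x) - ln (real b) \<le> real x * (1 / real b)" using b x by (simp add: ln_div)
  qed
  then have "real (card U) * ln (real x) - (\<Sum>b\<in>U. ln (real b)) \<le> real x * (\<Sum>m\<in>U. 1 / real m)"
    by (simp add: sum_subtractf sum_distrib_left)
  then show ?thesis using 1 by (simp add: algebra_simps)
qed

section \<open>Sieving by the primes of an interval\<close>

lemma smooth_rough_factorization:
  fixes n :: nat
  assumes "n > 0"
  shows "\<exists>s t. n = s * t \<and> smooth P s \<and> (\<forall>p. prime p \<longrightarrow> p dvd t \<longrightarrow> P < real p)"
  using assms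
proof (induction n rule: less_induct)
  case (less n)
  show ?case
  proof (cases "n = 1")
    case True
    then show ?thesis by (intro exI[of _ 1]) (auto simp: smooth_def)
  next
    case False
    then obtain p where p: "prime p" "p dvd n" using prime_factor_nat by blast
    then obtain m where m: "n = p * m" by blast
    have "m > 0" "m < n" using m less.prems prime_gt_1_nat[OF p(1)] by (auto intro: Nat.gr0I)
    then obtain s t where st: "m = s * t" "smooth P s" "\<forall>p. prime p \<longrightarrow> p dvd t \<longrightarrow> P < real p"
      using less.IH by blast
    show ?thesis
    proof (cases "real p \<le> P")
      case True
      have "smooth P (p * s)" unfolding smooth_def
      proof (intro allI impI)
        fix r assume "prime r" "r dvd p * s"
        then have "r dvd p \<or> r dvd s" by (simp add: prime_dvd_mult_iff)
        then show "real r \<le> P" using st(2) \<open>prime r\<close> p(1) True primes_dvd_imp_eq unfolding smooth_def by blast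
      qed
      then show ?thesis using st m by (intro exI[of _ "p * s"] exI[of _ t]) auto
    next
      case False
      have "\<forall>r. prime r \<longrightarrow> r dvd p * t \<longrightarrow> P < real r"
      proof (intro allI impI)
        fix r assume "prime r" "r dvd p * t"
        then have "r dvd p \<or> r dvd t" by (simp add: prime_dvd_mult_iff)
        then show "P < real r" using st(3) \<open>prime r\<close> p(1) False primes_dvd_imp_eq[of r p] by auto
      qed
      then show ?thesis using st m by (intro exI[of _ s] exI[of _ "p * t"]) auto
    qed
  qed
qed

text \<open>Hall's bound reduces the count to u, the sum of 1/n over the sifted n \<le> X. Let v be
  the sum of 1/m over the m \<le> z all of whose primes exceed P. Such n and m are coprime, so the
  products n m are distinct and u v is at most 3 ln X. Every k \<le> z is a P-smooth number times
  such an m, so v times the smooth sum is at least ln z, and the smooth sum is at most 34 (1 + ln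
  P). Hence 510 = 5 * 3 * 34.\<close>

lemma sifted_card_le:
  assumes P: "1 \<le> P" and z: "1 < z" "z \<le> real X" and X: "X \<ge> 3"
  shows "real (card {b\<in>{1..X}. \<forall>l. prime l \<longrightarrow> l dvd b \<longrightarrow> \<not> (P < real l \<and> real l \<le> z)}) * ln z
     \<le> 510 * real X * (1 + ln P)"
proof -
  let ?U = "{b\<in>{1..X}. \<forall>l. prime l \<longrightarrow> l dvd b \<longrightarrow> \<not> (P < real l \<and> real l \<le> z)}"
  define Z where "Z = nat \<lfloor>z\<rfloor>"
  have Z: "real Z \<le> z" "z < real Z + 1" "Z \<ge> 1" unfolding Z_def using z by (linarith, linarith, simp add: le_nat_floor)
  let ?V = "{m\<in>{1..Z}. \<forall>p. prime p \<longrightarrow> p dvd m \<longrightarrow> P < real p}"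
  define u where "u = (\<Sum>n\<in>?U. 1 / real n)"
  define v where "v = (\<Sum>n\<in>?V. 1 / real n)"
  have uv: "u * v \<le> 1 + ln (real (X * Z))"
  proof -
    have "u * v = (\<Sum>(n, m)\<in>?U \<times> ?V. 1 / real n * (1 / real m))"
      unfolding u_def v_def sum_product by (rule sum.cartesian_product)
    also have "\<dots> = (\<Sum>k\<in>(\<lambda>(n, m). n * m) ` (?U \<times> ?V). 1 / real k)"
    proof (rule sum.reindex_cong[symmetric, where l = "\<lambda>(n, m). n * m"])
      \<comment> \<open>A common prime would exceed P and be at most m \<le> z, a range in which n
        has no prime factor.\<close>
      have cop: "coprime n m" if "n \<in> ?U" "m \<in> ?V" for n m
      proof (rule ccontr)
        assume "\<not> coprime n m"
        then obtain p where p: "prime p" "p dvd n" "p dvd m" using that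
          by (metis coprime_iff_gcd_eq_1 gcd_greatest_iff prime_factor_nat dvd_refl)
        then have "P < real p" using that by auto
        moreover have "p \<le> m" using p that by (auto intro: dvd_imp_le)
        then have "real p \<le> z" using that Z(1) by auto
        ultimately show False using p that by auto
      qed
      show "inj_on (\<lambda>(n, m). n * m) (?U \<times> ?V)"
      proof (rule inj_onI, clarify)
        fix n m n' m' assume a: "n \<in> {1..X}" "\<forall>l. prime l \<longrightarrow> l dvd n \<longrightarrow> \<not> (P < real l \<and> real l \<le> z)" "m \<in> {1..Z}" "\<forall>p. prime p \<longrightarrow> p dvd m \<longrightarrow> P < real p"
          "n' \<in> {1..X}" "\<forall>l. prime l \<longrightarrow> l dvd n' \<longrightarrow> \<not> (P < real l \<and> real l \<le> z)" "m' \<in> {1..Z}" "\<forall>p. prime p \<longrightarrow> p dvd m' \<longrightarrow> P < real p" and e: "n * m = n' * m'"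
        have "coprime n m'" "coprime n' m" using a by (auto intro!: cop)
        then have "n dvd n'" "n' dvd n" using e coprime_dvd_mult_left_iff[of n m' n'] coprime_dvd_mult_left_iff[of n' m n]
          by (metis dvd_triv_left, metis dvd_triv_left)
        then have "n = n'" by (rule dvd_antisym)
        then show "n = n' \<and> m = m'" using e a by auto
      qed
    qed auto
    also have "\<dots> \<le> (\<Sum>k\<in>{1..X * Z}. 1 / real k)"
      by (rule sum_mono2) (auto intro: mult_le_mono)
    also have "\<dots> \<le> 1 + ln (real (X * Z))" by (rule sum_inverse_le) (use X Z in auto)
    finally show ?thesis .
  qed
  have vH: "ln z \<le> v * smooth_sum P Z"
  proof -
    have "ln z \<le> ln (real Z + 1)" using z Z by simp
    also have "\<dots> \<le> (\<Sum>k\<in>{1..Z}. 1 / real k)" by (rule sum_inverse_ge)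
    also have "\<dots> \<le> (\<Sum>(m, s)\<in>?V \<times> {d\<in>{1..Z}. smooth P d}. 1 / real m * (1 / real s))"
    proof (rule sum_le_included[where i = "\<lambda>(m, s). s * m"])
      show "\<forall>k\<in>{1..Z}. \<exists>y\<in>?V \<times> {d\<in>{1..Z}. smooth P d}. (case y of (m, s) \<Rightarrow> s * m) = k \<and>
         1 / real k \<le> (case y of (m, s) \<Rightarrow> 1 / real m * (1 / real s))"
      proof
        fix k assume k: "k \<in> {1..Z}"
        then obtain s t where st: "k = s * t" "smooth P s" "\<forall>p. prime p \<longrightarrow> p dvd t \<longrightarrow> P < real p"
          using smooth_rough_factorization[of k P] by auto
        have "s \<ge> 1" "t \<ge> 1" using st k by (auto intro: Nat.gr0I Suc_leI)
        moreover have "s \<le> Z" "t \<le> Z" using st k \<open>s \<ge> 1\<close> \<open>t \<ge> 1\<close>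
          by (auto intro: order_trans[of _ "s * t"])
        ultimately show "\<exists>y\<in>?V \<times> {d\<in>{1..Z}. smooth P d}. (case y of (m, s) \<Rightarrow> s * m) = k \<and>
         1 / real k \<le> (case y of (m, s) \<Rightarrow> 1 / real m * (1 / real s))"
          using st by (intro bexI[of _ "(t, s)"]) (auto simp: mult.commute)
      qed
    qed auto
    also have "\<dots> = v * smooth_sum P Z"
      unfolding v_def smooth_sum_def sum_product by (rule sum.cartesian_product[symmetric])
    finally show ?thesis .
  qed
  have u0: "u \<ge> 0" "v \<ge> 0" unfolding u_def v_def by (auto intro!: sum_nonneg)
  have lnP: "ln P \<ge> 0" using P by simp
  have lnX: "ln (real X) \<ge> 1"
  proof -
    have "exp 1 \<le> real X" using exp_le X by linarith
    then show ?thesis using X by (subst ln_ge_iff) auto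
  qed
  have "ln (real Z) \<le> ln (real X)" using Z z X by simp
  moreover have "ln (real (X * Z)) = ln (real X) + ln (real Z)" using X Z by (simp add: ln_mult)
  ultimately have "1 + ln (real (X * Z)) \<le> 3 * ln (real X)" using lnX by linarith
  then have "u * v \<le> 3 * ln (real X)" using uv by linarith
  then have "(u * v) * smooth_sum P Z \<le> (3 * ln (real X)) * (34 * (1 + ln P))"
  proof (rule mult_mono)
    show "smooth_sum P Z \<le> 34 * (1 + ln P)" by (rule smooth_sum_le[OF P])
  qed (use lnX in \<open>auto intro: smooth_sum_nonneg\<close>)
  moreover have "u * ln z \<le> u * (v * smooth_sum P Z)" using vH u0 by (intro mult_left_mono) auto
  ultimately have u: "u * ln z \<le> 102 * ln (real X) * (1 + ln P)" by (simp add: algebra_simps)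
  have "real (card ?U) * ln (real X) \<le> 5 * real X * u"
    unfolding u_def
  proof (rule divisor_closed_card_le)
    fix b e assume be: "b \<in> ?U" "e dvd b"
    then have "e \<le> b" "e > 0" by (auto intro: dvd_imp_le dvd_pos_nat)
    then show "e \<in> ?U" using be by (auto dest: dvd_trans[OF _ be(2)])
  qed (use X in auto)
  then have "real (card ?U) * ln (real X) * ln z \<le> 5 * real X * u * ln z"
    using z by (intro mult_right_mono) auto
  also have "\<dots> \<le> 5 * real X * (102 * ln (real X) * (1 + ln P))" using mult_left_mono[OF u, of "5 * real X"] by (simp add: algebra_simps)
  finally have "ln (real X) * (real (card ?U) * ln z) \<le> ln (real X) * (510 * real X * (1 + ln P))"
    by (simp add: algebra_simps)
  then show ?thesis using lnX by simp
qed

section \<open>Divisor function and prime factors in an interval\<close>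

lemma divisor_tau_mult_le:
  assumes "a > 0" "b > 0" shows "divisor_tau (a * b) \<le> divisor_tau a * divisor_tau b"
proof -
  have "{d. d dvd a * b} \<subseteq> (\<lambda>(x, y). x * y) ` ({d. d dvd a} \<times> {d. d dvd b})"
  proof
    fix d assume "d \<in> {d. d dvd a * b}"
    then obtain b' c' where "d = b' * c'" "b' dvd a" "c' dvd b" using division_decomp[of d a b] by auto
    then show "d \<in> (\<lambda>(x, y). x * y) ` ({d. d dvd a} \<times> {d. d dvd b})" by (intro image_eqI[of _ _ "(b', c')"]) auto
  qed
  moreover have fin: "finite ({d. d dvd a} \<times> {d. d dvd b})" using assms by (auto intro!: finite_divisors_nat)
  ultimately have "divisor_tau (a * b) \<le> card ((\<lambda>(x, y). x * y) ` ({d. d dvd a} \<times> {d. d dvd b}))"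
    unfolding divisor_tau_def by (intro card_mono) auto
  also have "\<dots> \<le> card ({d. d dvd a} \<times> {d. d dvd b})" by (rule card_image_le[OF fin])
  finally show ?thesis by (simp add: divisor_tau_def card_cartesian_product)
qed

lemma divisor_tau_prime: "prime p \<Longrightarrow> divisor_tau p = 2"
proof -
  assume p: "prime p"
  then have "{d. d dvd p} = {1, p}" by (auto simp: prime_nat_iff)
  then show ?thesis unfolding divisor_tau_def using prime_gt_1_nat[OF p] by simp
qed

lemma divisor_tau_pos: "n > 0 \<Longrightarrow> divisor_tau n \<ge> 1"
  unfolding divisor_tau_def by (simp add: Suc_le_eq card_gt_0_iff finite_divisors_nat) (use dvd_refl in blast)

text \<open>For the largest divisor \<open>d \<le> \<surd>n\<close> and any prime \<open>p\<close> dividing \<open>n/d\<close> the cofactor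
  \<open>n/(dp)\<close> is also below \<open>\<surd>n\<close>.\<close>

lemma divisor_tau_sqrt_divisor:
  assumes "n > 0" shows "\<exists>d. d dvd n \<and> d ^ 2 \<le> n \<and> divisor_tau n \<le> 2 * divisor_tau d ^ 2"
proof -
  let ?S = "{d. d dvd n \<and> d ^ 2 \<le> n}"
  have fin: "finite ?S" using finite_divisors_nat[OF assms] by (rule rev_finite_subset) auto
  have ne: "?S \<noteq> {}" using assms by (auto intro!: exI[of _ 1])
  define d where "d = Max ?S"
  have d: "d dvd n" "d ^ 2 \<le> n" using Max_in[OF fin ne] unfolding d_def by auto
  have mx: "e \<le> d" if "e dvd n" "e ^ 2 \<le> n" for e using Max_ge[OF fin, of e] that unfolding d_def by simp
  obtain m where m: "n = d * m" using d(1) by blast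
  have pos: "d > 0" "m > 0" using m assms by (auto intro: Nat.gr0I)
  show ?thesis
  proof (cases "m = 1")
    case True
    then have "d = 1" using d(2) m pos by (simp add: power2_eq_square)
    then show ?thesis using True m by (intro exI[of _ 1]) (simp add: divisor_tau_def)
  next
    case False
    then obtain p where p: "prime p" "p dvd m" using prime_factor_nat by blast
    then obtain e where e: "m = p * e" by blast
    have e0: "e > 0" using e pos by (auto intro: Nat.gr0I)
    have p1: "p > 1" by (rule prime_gt_1_nat[OF p(1)])
    have "\<not> (d * p) ^ 2 \<le> n"
    proof
      assume "(d * p) ^ 2 \<le> n"
      then have "d * p \<le> d" using m e by (intro mx) auto
      then show False using pos p1 by simp
    qed
    then have gt: "n < (d * p) ^ 2" by simp
    have "e ^ 2 \<le> n"
    proof (rule ccontr)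
      assume "\<not> e ^ 2 \<le> n"
      then have "n * n < (d * p) ^ 2 * e ^ 2" using gt pos p1 by (intro mult_strict_mono) auto
      then show False using m e by (simp add: power2_eq_square algebra_simps)
    qed
    have "divisor_tau n = divisor_tau (d * (p * e))" using m e by simp
    also have "\<dots> \<le> divisor_tau d * (divisor_tau p * divisor_tau e)"
      using pos p1 e0 by (intro order_trans[OF divisor_tau_mult_le] mult_left_mono divisor_tau_mult_le) auto
    finally have le: "divisor_tau n \<le> 2 * (divisor_tau d * divisor_tau e)" by (simp add: divisor_tau_prime[OF p(1)])
    show ?thesis
    proof (cases "divisor_tau e \<le> divisor_tau d")
      case True
      then have "divisor_tau d * divisor_tau e \<le> divisor_tau d ^ 2" by (simp add: power2_eq_square)
      then show ?thesis using le d by (intro exI[of _ d]) auto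
    next
      case False
      then have "divisor_tau d * divisor_tau e \<le> divisor_tau e ^ 2" by (simp add: power2_eq_square)
      then show ?thesis using le m e \<open>e ^ 2 \<le> n\<close> by (intro exI[of _ e]) auto
    qed
  qed
qed

text \<open>Landreau's inequality, by iterating the square root step: each iteration doubles both
  exponents 2^j. It trades \<tau>(n) for divisors of size at most n^(1/2^j), small enough for
  equidistribution in their multiples to be of use.\<close>

lemma divisor_tau_small_divisor:
  assumes "n > 0"
  shows "\<exists>d. d dvd n \<and> d ^ (2 ^ j) \<le> n \<and> divisor_tau n \<le> 2 ^ (2 ^ j) * divisor_tau d ^ (2 ^ j)"
proof (induction j)
  case 0
  show ?case by (intro exI[of _ n]) simp
next
  case (Suc j)
  let ?m = "2 ^ j :: nat"
  obtain d where d: "d dvd n" "d ^ ?m \<le> n" "divisor_tau n \<le> 2 ^ ?m * divisor_tau d ^ ?m" using Suc by blast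
  have "d > 0" using d(1) assms by (rule dvd_pos_nat[rotated])
  then obtain e where e: "e dvd d" "e ^ 2 \<le> d" "divisor_tau d \<le> 2 * divisor_tau e ^ 2"
    using divisor_tau_sqrt_divisor by blast
  have "divisor_tau n \<le> 2 ^ ?m * (2 * divisor_tau e ^ 2) ^ ?m"
    using d(3) e(3) by (meson le_trans mult_le_mono2 power_mono le0)
  also have "\<dots> = 2 ^ (2 ^ Suc j) * divisor_tau e ^ (2 ^ Suc j)"
    unfolding power_Suc mult_2[of "2 ^ j"] power_add power_mult_distrib power2_eq_square by simp
  finally have "divisor_tau n \<le> 2 ^ (2 ^ Suc j) * divisor_tau e ^ (2 ^ Suc j)" .
  moreover have "e ^ (2 ^ Suc j) \<le> n"
  proof -
    have "e ^ (2 ^ Suc j) = (e ^ 2) ^ ?m" by (simp add: power_mult)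
    also have "\<dots> \<le> d ^ ?m" using e(2) by (intro power_mono) auto
    finally show ?thesis using d(2) by simp
  qed
  ultimately show ?case using d(1) e(1) dvd_trans by blast
qed

text \<open>Expanding one factor \<tau>(d) over d = e f and using \<tau>(e f) \<le> \<tau>(e)
  \<tau>(f) bounds the sum for k + 1 by the square of the sum for k; closure under divisors keeps e
  and f in S.\<close>

lemma sum_divisor_tau_power_le:
  assumes fin: "finite S" and S0: "0 \<notin> S" and cl: "\<And>d e. d \<in> S \<Longrightarrow> e dvd d \<Longrightarrow> e \<in> S"
  shows "(\<Sum>d\<in>S. real (divisor_tau d) ^ k / real d) \<le> (\<Sum>d\<in>S. 1 / real d) ^ (2 ^ k)"
proof (induction k)
  case (Suc k)
  let ?g = "\<lambda>d. real (divisor_tau d) ^ k / real d"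
  have finD: "finite {e. e dvd d}" if "d \<in> S" for d using that S0 by (auto intro!: finite_divisors_nat Nat.gr0I)
  have "(\<Sum>d\<in>S. real (divisor_tau d) ^ Suc k / real d) = (\<Sum>d\<in>S. \<Sum>e\<in>{e. e dvd d}. ?g d)"
    by (rule sum.cong) (auto simp: divisor_tau_def)
  also have "\<dots> = (\<Sum>w\<in>Sigma S (\<lambda>d. {e. e dvd d}). ?g (fst w))"
    using fin finD by (subst sum.Sigma) (auto simp: case_prod_unfold)
  also have "\<dots> \<le> (\<Sum>w\<in>S \<times> S. ?g (fst w) * ?g (snd w))"
  proof (rule sum_le_included[where i = "\<lambda>w. (fst w * snd w, fst w)"], goal_cases)
    case 1
    show ?case using fin finD by (intro finite_SigmaI) auto
  next
    case 4
    show ?case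
    proof
      fix y assume y: "y \<in> Sigma S (\<lambda>d. {e. e dvd d})"
      then obtain d e where de: "y = (d, e)" "d \<in> S" "e dvd d" by auto
      then obtain f where f: "d = e * f" by blast
      have d0: "d > 0" using de S0 by (auto intro: Nat.gr0I)
      then have pos: "e > 0" "f > 0" using f by (auto intro: Nat.gr0I)
      have mem: "(e, f) \<in> S \<times> S" using cl[OF de(2)] f by auto
      have "real (divisor_tau d) \<le> real (divisor_tau e) * real (divisor_tau f)"
        unfolding f using divisor_tau_mult_le[OF pos] by (metis of_nat_le_iff of_nat_mult)
      then have "real (divisor_tau d) ^ k \<le> (real (divisor_tau e) * real (divisor_tau f)) ^ k" by (intro power_mono) auto
      then have "?g d \<le> (real (divisor_tau e) * real (divisor_tau f)) ^ k / real d" by (rule divide_right_mono) simp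
      also have "\<dots> = ?g e * ?g f" using f by (simp add: power_mult_distrib)
      finally show "\<exists>ya\<in>S \<times> S. (fst ya * snd ya, fst ya) = y \<and> ?g (fst y) \<le> ?g (fst ya) * ?g (snd ya)"
        using mem de f by (intro bexI[of _ "(e, f)"]) auto
    qed
  qed (use fin in auto)
  also have "\<dots> = (\<Sum>d\<in>S. ?g d) * (\<Sum>d\<in>S. ?g d)"
    unfolding sum_product sum.cartesian_product by (simp add: case_prod_unfold)
  also have "\<dots> \<le> (\<Sum>d\<in>S. 1 / real d) ^ (2 ^ k) * (\<Sum>d\<in>S. 1 / real d) ^ (2 ^ k)"
    by (rule mult_mono[OF Suc.IH Suc.IH]) (auto intro!: sum_nonneg zero_le_power simp: divide_nonneg_nonneg)
  also have "\<dots> = (\<Sum>d\<in>S. 1 / real d) ^ (2 ^ Suc k)" by (simp add: mult_2 power_add)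
  finally show ?case .
qed simp

text \<open>Such a t has at most m prime factors, counted with multiplicity, and each of them at
  most doubles the number of divisors.\<close>

lemma divisor_tau_rough:
  assumes "t > 0" "1 \<le> z" "\<And>p. prime p \<Longrightarrow> p dvd t \<Longrightarrow> z < real p" "real t < z ^ Suc m"
  shows "divisor_tau t \<le> 2 ^ m"
  using assms
proof (induction m arbitrary: t)
  case 0
  have "t = 1"
  proof (rule ccontr)
    assume "t \<noteq> 1"
    then obtain p where p: "prime p" "p dvd t" using prime_factor_nat by blast
    then have "real p \<le> real t" using 0 by (auto intro: dvd_imp_le)
    then show False using 0(3)[OF p] 0(4) by simp
  qed
  then show ?case by (simp add: divisor_tau_def)
next
  case (Suc m)
  show ?case
  proof (cases "t = 1")
    case False
    then obtain p where p: "prime p" "p dvd t" using prime_factor_nat by blast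
    then obtain s where s: "t = p * s" by blast
    have s0: "s > 0" using s Suc.prems by (auto intro: Nat.gr0I)
    have zp: "z < real p" using Suc.prems p by blast
    have "z * real s \<le> real t" using zp s by (simp add: mult_right_mono)
    also have "\<dots> < z * z ^ Suc m" using Suc.prems by simp
    finally have "real s < z ^ Suc m" using Suc.prems by simp
    then have "divisor_tau s \<le> 2 ^ m" using Suc.IH[of s] Suc.prems s0 s by auto
    then show ?thesis using divisor_tau_mult_le[of p s] s s0 divisor_tau_prime[OF p(1)] prime_gt_0_nat[OF p(1)] by simp
  qed (simp add: divisor_tau_def)
qed

definition omega_in :: "real \<Rightarrow> real \<Rightarrow> nat \<Rightarrow> nat" where
  "omega_in P z a = card {l. prime l \<and> P < real l \<and> real l \<le> z \<and> l dvd a}"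

lemma prod_primes_dvd:
  assumes "finite A" "\<And>p. p \<in> A \<Longrightarrow> prime p \<and> p dvd (a::nat)"
  shows "\<Prod>A dvd a"
  using assms
proof (induction A)
  case (insert p A)
  have "coprime p (\<Prod>A)" using insert by (intro prod_coprime_right) (auto intro: primes_coprime)
  then show ?case using insert by (auto intro: divides_mult)
qed simp

text \<open>Different sets of such primes have different products, and these products are z-smooth
  divisors of a.\<close>

lemma two_power_omega_le:
  assumes "a > 0" shows "2 ^ omega_in P z a \<le> card {d. d dvd a \<and> smooth z d}"
proof -
  let ?L = "{l. prime l \<and> P < real l \<and> real l \<le> z \<and> l dvd a}"
  have finL: "finite ?L" using finite_divisors_nat[OF assms] by (rule rev_finite_subset) auto
  have key: "q \<in> A" if "A \<subseteq> ?L" "prime q" "q dvd \<Prod>A" for A q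
  proof -
    have "finite A" using that(1) finL finite_subset by blast
    note q = that
    then obtain r where "r \<in> A" "q dvd r"
      using prime_dvd_prod_iff[OF \<open>finite A\<close> q(2), of "\<lambda>x. x"] q(3) by auto
    then show ?thesis using that primes_dvd_imp_eq[of q r] by auto
  qed
  have "inj_on (\<lambda>A. \<Prod>A) (Pow ?L)"
  proof (rule inj_onI)
    fix A B assume AB: "A \<in> Pow ?L" "B \<in> Pow ?L" "\<Prod>A = \<Prod>B"
    have fin: "finite A" "finite B" using AB finL by (auto intro: finite_subset)
    show "A = B"
    proof (intro equalityI subsetI)
      fix x assume "x \<in> A"
      then have "x dvd \<Prod>B" using AB(3) dvd_prodI[OF fin(1), of x "\<lambda>x. x"] by simp
      then show "x \<in> B" using key[of B x] AB \<open>x \<in> A\<close> by blast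
    next
      fix x assume "x \<in> B"
      then have "x dvd \<Prod>A" using AB(3) dvd_prodI[OF fin(2), of x "\<lambda>x. x"] by simp
      then show "x \<in> A" using key[of A x] AB \<open>x \<in> B\<close> by blast
    qed
  qed
  then have "card (Pow ?L) = card ((\<lambda>A. \<Prod>A) ` Pow ?L)" by (simp add: card_image)
  also have "\<dots> \<le> card {d. d dvd a \<and> smooth z d}"
  proof (rule card_mono)
    show "finite {d. d dvd a \<and> smooth z d}" using finite_divisors_nat[OF assms] by (rule rev_finite_subset) auto
    show "(\<lambda>A. \<Prod>A) ` Pow ?L \<subseteq> {d. d dvd a \<and> smooth z d}"
    proof (rule image_subsetI)
      fix A assume A: "A \<in> Pow ?L"
      then have "\<Prod>A dvd a" using finL by (intro prod_primes_dvd) (auto intro: finite_subset)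
      moreover have "smooth z (\<Prod>A)" unfolding smooth_def using key A by blast
      ultimately show "\<Prod>A \<in> {d. d dvd a \<and> smooth z d}" by simp
    qed
  qed
  finally show ?thesis using card_Pow[OF finL] by (simp add: omega_in_def)
qed

text \<open>Markov's inequality for 2^omega, which is at most the number of z-smooth divisors;
  summed over a \<le> X, that number is at most X times the reciprocal sum over smooth d.\<close>

lemma many_prime_divisors_card_le:
  "2 ^ k * real (card {a\<in>{1..X}. k \<le> omega_in P z a}) \<le> real X * smooth_sum z X"
proof -
  let ?D = "{d\<in>{1..X}. smooth z d}"
  have "2 ^ k * real (card {a\<in>{1..X}. k \<le> omega_in P z a}) = (\<Sum>a\<in>{a\<in>{1..X}. k \<le> omega_in P z a}. 2 ^ k)"
    by simp
  also have "\<dots> \<le> (\<Sum>a\<in>{a\<in>{1..X}. k \<le> omega_in P z a}. 2 ^ omega_in P z a)"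
    by (rule sum_mono) (auto intro: power_increasing)
  also have "\<dots> \<le> (\<Sum>a\<in>{1..X}. 2 ^ omega_in P z a)" by (rule sum_mono2) auto
  also have "\<dots> \<le> (\<Sum>a\<in>{1..X}. \<Sum>d\<in>{d\<in>?D. d dvd a}. 1)"
  proof (rule sum_mono)
    fix a assume a: "a \<in> {1..X}"
    have "{d. d dvd a \<and> smooth z d} = {d\<in>?D. d dvd a}" using a by (fastforce dest: dvd_imp_le dvd_pos_nat[rotated])
    moreover have "real (2 ^ omega_in P z a) \<le> real (card {d. d dvd a \<and> smooth z d})"
      using two_power_omega_le[of a] a by (intro of_nat_mono) auto
    ultimately show "(2::real) ^ omega_in P z a \<le> (\<Sum>d\<in>{d\<in>?D. d dvd a}. 1)" by simp
  qed
  also have "\<dots> = (\<Sum>d\<in>?D. \<Sum>a\<in>{a\<in>{1..X}. d dvd a}. 1)" by (rule sum.swap_restrict) auto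
  also have "\<dots> = (\<Sum>d\<in>?D. real (X div d))"
    by (rule sum.cong[OF refl]) (subst sum_constant, subst card_multiples, auto)
  also have "\<dots> \<le> (\<Sum>d\<in>?D. real X * (1 / real d))"
    by (intro sum_mono order_trans[OF real_div_ge]) auto
  finally show ?thesis unfolding smooth_sum_def by (simp add: sum_distrib_left)
qed

section \<open>Products close to integers\<close>

definition near_products :: "real \<Rightarrow> real \<Rightarrow> real \<Rightarrow> real \<Rightarrow> (nat \<times> nat \<times> int) set" where
  "near_products \<alpha> A B \<xi> = {(a, b, c). 1 \<le> a \<and> real a \<le> A \<and> 1 \<le> b \<and> real b \<le> B \<and>
     0 < \<bar>\<alpha> * real (a * b) - real_of_int c\<bar> \<and> \<bar>\<alpha> * real (a * b) - real_of_int c\<bar> \<le> \<xi>}"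

lemma near_products_swap: "near_products \<alpha> B A \<xi> = (\<lambda>(a, b, c). (b, a, c)) ` near_products \<alpha> A B \<xi>"
  by (auto simp: near_products_def image_iff mult.commute)

lemma card_near_products_swap: "card (near_products \<alpha> B A \<xi>) = card (near_products \<alpha> A B \<xi>)"
  unfolding near_products_swap[of \<alpha> B A] by (rule card_image) (auto intro: inj_onI)

lemma card_near_products_fibre:
  assumes "Sb \<subseteq> {b. 1 \<le> b \<and> real b \<le> B}"
  shows "finite {(a, b, c). (a, b, c) \<in> near_products \<alpha> A B \<xi> \<and> b \<in> Sb}"
    and "card {(a, b, c). (a, b, c) \<in> near_products \<alpha> A B \<xi> \<and> b \<in> Sb} = (\<Sum>b\<in>Sb. card (near_multiples (\<alpha> * real b) A \<xi>))"
proof -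
  let ?T = "{(a, b, c). (a, b, c) \<in> near_products \<alpha> A B \<xi> \<and> b \<in> Sb}"
  have finS: "finite Sb" by (rule finite_subset[OF _ finite_nat_le_real[of B]]) (use assms in auto)
  have eq: "?T = (\<lambda>(b, a, c). (a, b, c)) ` Sigma Sb (\<lambda>b. near_multiples (\<alpha> * real b) A \<xi>)"
    using assms by (auto simp: near_products_def near_multiples_def image_iff algebra_simps)
  show "finite ?T" unfolding eq using finS by (intro finite_imageI finite_SigmaI finite_near_multiples)
  have "card ?T = card (Sigma Sb (\<lambda>b. near_multiples (\<alpha> * real b) A \<xi>))"
    unfolding eq by (rule card_image) (auto intro: inj_onI)
  then show "card ?T = (\<Sum>b\<in>Sb. card (near_multiples (\<alpha> * real b) A \<xi>))"
    using finS by (simp add: card_SigmaI finite_near_multiples)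
qed

lemma near_products_fibre_conv: "near_products \<alpha> A B \<xi> = {(a, b, c). (a, b, c) \<in> near_products \<alpha> A B \<xi> \<and> b \<in> {b. 1 \<le> b \<and> real b \<le> B}}"
  by (auto simp: near_products_def)

lemma finite_near_products: "finite (near_products \<alpha> A B \<xi>)"
  by (subst near_products_fibre_conv) (rule card_near_products_fibre(1), simp)

lemma card_near_products: "card (near_products \<alpha> A B \<xi>) = (\<Sum>b\<in>{b. 1 \<le> b \<and> real b \<le> B}. card (near_multiples (\<alpha> * real b) A \<xi>))"
  by (subst near_products_fibre_conv) (rule card_near_products_fibre(2), simp)

lemma near_products_mono: "A \<le> A' \<Longrightarrow> B \<le> B' \<Longrightarrow> \<xi> \<le> \<xi>' \<Longrightarrow> card (near_products \<alpha> A B \<xi>) \<le> card (near_products \<alpha> A' B' \<xi>')"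
  by (rule card_mono[OF finite_near_products]) (auto simp: near_products_def)

section \<open>Dyadic form of the lattice bound\<close>

lemma dyadic_exponent:
  assumes "1 \<le> (n::real)" obtains j :: nat where "2 ^ j \<le> n" "n < 2 ^ (j + 1)"
proof -
  define j where "j = nat \<lfloor>log 2 n\<rfloor>"
  have "log 2 n \<ge> 0" using assms by simp
  then have "real j \<le> log 2 n" "log 2 n < real (j + 1)" unfolding j_def by linarith+
  then have "2 powr real j \<le> n" "n < 2 powr real (j + 1)"
    using assms by (simp_all only: le_log_iff log_less_iff)
  moreover have "(2::real) powr real j = 2 ^ j" "(2::real) powr real (j + 1) = 2 ^ (j + 1)"
    by (rule powr_realpow, simp)+
  ultimately show ?thesis using that[of j] by simp
qed

lemma finite_dyadic_range: "finite {j::nat. J < 2 ^ (j + 1) \<and> 2 ^ j \<le> (A::real)}"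
proof (rule finite_subset)
  show "{j::nat. J < 2 ^ (j + 1) \<and> 2 ^ j \<le> A} \<subseteq> {j. real j \<le> A}"
  proof
    fix j :: nat assume "j \<in> {j. J < 2 ^ (j + 1) \<and> 2 ^ j \<le> A}"
    moreover have "real j \<le> 2 ^ j" using of_nat_less_two_power[of j, where ?'a=real] by simp
    ultimately show "j \<in> {j. real j \<le> A}" unfolding mem_Collect_eq by linarith
  qed
qed (rule finite_nat_le_real)

text \<open>If the multiplicity n exceeds J, the point causing it survives when A and 2 \<xi> are
  divided by the power 2^j just below n. That smaller set is nonempty, so its term alone is at least
  2^(j+2) > 2 n. Existence has become a count, which can be summed over the other variable.\<close>

lemma card_near_multiples_le_dyadic:
  assumes xi: "\<xi> > 0" and A: "A > 0" and J: "J \<ge> 1"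
  shows "real (card (near_multiples \<beta> A \<xi>)) \<le> 10 * A * \<xi> + 2 * J +
     (\<Sum>j\<in>{j. J < 2 ^ (j + 1) \<and> 2 ^ j \<le> A}. 2 ^ (j + 2) * real (card (near_multiples \<beta> (A / 2 ^ j) (2 * \<xi> / 2 ^ j))))"
    (is "_ \<le> _ + (\<Sum>j\<in>?Js. ?f j)")
proof -
  have finJ: "finite ?Js" by (rule finite_dyadic_range)
  have pos: "(\<Sum>j\<in>?Js. ?f j) \<ge> 0" by (intro sum_nonneg) auto
  show ?thesis
  proof (cases "near_multiples \<beta> A \<xi> = {}")
    case True
    then show ?thesis using pos xi A J by simp
  next
    case False
    then obtain a c n where n: "(a, c) \<in> near_multiples \<beta> A \<xi>" "1 \<le> n" "real a \<le> A / n"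
      "\<bar>\<beta> * real a - real_of_int c\<bar> \<le> 2 * \<xi> / n" "real (card (near_multiples \<beta> A \<xi>)) \<le> 10 * A * \<xi> + 2 * n"
      by (rule card_near_multiples_le)
    show ?thesis
    proof (cases "n \<le> J")
      case True
      then show ?thesis using n(5) pos by linarith
    next
      case False
      obtain j :: nat where j: "2 ^ j \<le> n" "n < 2 ^ (j + 1)" by (rule dyadic_exponent[OF n(2)])
      have aj: "real a \<le> A / 2 ^ j" "\<bar>\<beta> * real a - real_of_int c\<bar> \<le> 2 * \<xi> / 2 ^ j"
      proof -
        have "A / n \<le> A / 2 ^ j" by (rule divide_left_mono) (use A n j in auto)
        then show "real a \<le> A / 2 ^ j" using n(3) by linarith
        have "2 * \<xi> / n \<le> 2 * \<xi> / 2 ^ j" by (rule divide_left_mono) (use xi n j in auto)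
        then show "\<bar>\<beta> * real a - real_of_int c\<bar> \<le> 2 * \<xi> / 2 ^ j" using n(4) by linarith
      qed
      have a1: "1 \<le> a" "0 < \<bar>\<beta> * real a - real_of_int c\<bar>" using n(1) unfolding near_multiples_def by auto
      then have "(a, c) \<in> near_multiples \<beta> (A / 2 ^ j) (2 * \<xi> / 2 ^ j)" using aj unfolding near_multiples_def by auto
      then have "card (near_multiples \<beta> (A / 2 ^ j) (2 * \<xi> / 2 ^ j)) \<ge> 1"
        by (metis One_nat_def Suc_leI card_gt_0_iff empty_iff finite_near_multiples)
      then have fj: "2 ^ (j + 2) \<le> ?f j" by simp
      have "1 \<le> real a" using a1 by simp
      then have "1 \<le> A / 2 ^ j" using aj by linarith
      then have "2 ^ j \<le> A" by (simp add: field_simps)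
      then have "j \<in> ?Js" using j False by auto
      then have "?f j \<le> (\<Sum>j\<in>?Js. ?f j)" by (intro member_le_sum finJ) auto
      moreover have "2 * n \<le> 2 ^ (j + 2)" using j by simp
      ultimately show ?thesis using n(5) fj J by linarith
    qed
  qed
qed

text \<open>Only the main term is charged to Sb; in the tail b runs through the whole box, so that
  bounds for full boxes at smaller scales apply. A sparse Sb thus lowers the cost of J.\<close>

lemma near_products_fibre_recursion:
  assumes xi: "\<xi> > 0" and A: "A > 0" and J: "J \<ge> 1" and Sb: "Sb \<subseteq> {b. 1 \<le> b \<and> real b \<le> B}"
  shows "real (card {(a, b, c). (a, b, c) \<in> near_products \<alpha> A B \<xi> \<and> b \<in> Sb}) \<le> real (card Sb) * (10 * A * \<xi> + 2 * J) +
     (\<Sum>j\<in>{j. J < 2 ^ (j + 1) \<and> 2 ^ j \<le> A}. 2 ^ (j + 2) * real (card (near_products \<alpha> (A / 2 ^ j) B (2 * \<xi> / 2 ^ j))))"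
    (is "_ \<le> _ + (\<Sum>j\<in>?Js. _)")
proof -
  have "real (card {(a, b, c). (a, b, c) \<in> near_products \<alpha> A B \<xi> \<and> b \<in> Sb}) = (\<Sum>b\<in>Sb. real (card (near_multiples (\<alpha> * real b) A \<xi>)))"
    by (simp add: card_near_products_fibre(2)[OF Sb])
  also have "\<dots> \<le> (\<Sum>b\<in>Sb. 10 * A * \<xi> + 2 * J + (\<Sum>j\<in>?Js. 2 ^ (j + 2) * real (card (near_multiples (\<alpha> * real b) (A / 2 ^ j) (2 * \<xi> / 2 ^ j)))))"
    by (intro sum_mono card_near_multiples_le_dyadic xi A J)
  also have "\<dots> = real (card Sb) * (10 * A * \<xi> + 2 * J) + (\<Sum>j\<in>?Js. 2 ^ (j + 2) * (\<Sum>b\<in>Sb. real (card (near_multiples (\<alpha> * real b) (A / 2 ^ j) (2 * \<xi> / 2 ^ j)))))"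
    by (subst sum.distrib, subst sum.swap) (simp add: sum_distrib_left)
  also have "\<dots> \<le> real (card Sb) * (10 * A * \<xi> + 2 * J) + (\<Sum>j\<in>?Js. 2 ^ (j + 2) * real (card (near_products \<alpha> (A / 2 ^ j) B (2 * \<xi> / 2 ^ j))))"
  proof (intro add_left_mono sum_mono mult_left_mono)
    fix j
    show "(\<Sum>b\<in>Sb. real (card (near_multiples (\<alpha> * real b) (A / 2 ^ j) (2 * \<xi> / 2 ^ j)))) \<le> real (card (near_products \<alpha> (A / 2 ^ j) B (2 * \<xi> / 2 ^ j)))"
      unfolding card_near_products of_nat_sum
      by (rule sum_mono2[OF _ Sb]) (auto intro: finite_subset[OF _ finite_nat_le_real[of B]])
  qed auto
  finally show ?thesis .
qed

lemma two_powr_neg_less_one: "r > 0 \<Longrightarrow> 2 powr (- r) < (1::real)"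
  using powr_less_cancel_iff[of 2 "- r" 0] by simp

text \<open>The least exponent in \<open>Js\<close> already satisfies 2^j > J / 2, so the leading
  term is at most (2 / J)^r.\<close>

lemma geometric_tail_le:
  fixes J r :: real
  assumes fin: "finite Js" and Js: "\<And>j. j \<in> Js \<Longrightarrow> J < 2 ^ (j + 1)" and J: "J \<ge> 1" and r: "r > 0"
  shows "(\<Sum>j\<in>Js. (2 powr (- r)) ^ j) \<le> (2 / J) powr r / (1 - 2 powr (- r))"
proof (cases "Js = {}")
  case True
  then show ?thesis using two_powr_neg_less_one[OF r] by simp
next
  case False
  define j0 where "j0 = Min Js"
  let ?q = "2 powr (- r) :: real"
  have q: "0 < ?q" "?q < 1" using r by (auto simp: two_powr_neg_less_one)
  have j0: "j0 \<in> Js" "\<And>j. j \<in> Js \<Longrightarrow> j0 \<le> j" unfolding j0_def using fin False by auto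
  have "(\<Sum>j\<in>Js. ?q ^ j) \<le> (\<Sum>j\<in>{j0..Max Js}. ?q ^ j)"
    by (rule sum_mono2) (use fin j0 q in auto)
  also have "\<dots> = (\<Sum>i\<in>{..Max Js - j0}. ?q ^ (i + j0))"
    by (rule sum.reindex_bij_witness[where i = "\<lambda>i. i + j0" and j = "\<lambda>j. j - j0"]) (use Max_ge[OF fin j0(1)] in auto)
  also have "\<dots> = ?q ^ j0 * (\<Sum>i\<in>{..Max Js - j0}. ?q ^ i)" by (simp add: power_add sum_distrib_left mult.commute)
  also have "\<dots> \<le> ?q ^ j0 * (1 / (1 - ?q))"
  proof (rule mult_left_mono)
    have "(\<Sum>i\<in>{..Max Js - j0}. ?q ^ i) \<le> (\<Sum>i. ?q ^ i)"
      using q by (intro sum_le_suminf summable_geometric) auto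
    also have "\<dots> = 1 / (1 - ?q)" using q by (intro suminf_geometric) auto
    finally show "(\<Sum>i\<in>{..Max Js - j0}. ?q ^ i) \<le> 1 / (1 - ?q)" .
  qed (use q in auto)
  also have "\<dots> \<le> (2 / J) powr r * (1 / (1 - ?q))"
  proof (rule mult_right_mono)
    have "?q ^ j0 = (2 ^ j0) powr (- r)"
      by (simp add: powr_realpow[symmetric] powr_powr mult.commute)
    also have "\<dots> \<le> (J / 2) powr (- r)"
    proof (rule powr_mono2')
      show "J / 2 \<le> 2 ^ j0" using Js[OF j0(1)] by simp
    qed (use r J in auto)
    also have "\<dots> = (2 / J) powr r" using J by (simp add: powr_minus powr_divide divide_simps)
    finally show "?q ^ j0 \<le> (2 / J) powr r" .
  qed (use q in auto)
  finally show ?thesis by simp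
qed

text \<open>32 = 4 * 2^3 bounds the factor 4 * 2^(1+2s) of the dyadic sum below, and the denominator
  comes from its geometric series. One constant serves for all exponents s between r and
  1/5.\<close>

definition rec_const :: "real \<Rightarrow> real" where "rec_const r = 32 / (1 - 2 powr (- r))"

lemma rec_const_ge: "r > 0 \<Longrightarrow> rec_const r \<ge> 32"
  unfolding rec_const_def by (simp add: field_simps two_powr_neg_less_one)

text \<open>The weight 2^j uses up one power of the scale \<kappa> / 2^j and leaves 2^(-s j): an
  exponent above 1 makes the sum over scales converge and even gains J^(-s).\<close>

lemma dyadic_power_sum_le:
  assumes fin: "finite Js" and Js: "\<And>j. j \<in> Js \<Longrightarrow> J < 2 ^ (j + 1)" and J: "J \<ge> 1"
    and r: "0 < r" "r \<le> s" "s \<le> 1/5" and k: "\<kappa> > 0"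
  shows "(\<Sum>j\<in>Js. 2 ^ (j + 2) * (2 * \<kappa> / 2 ^ j) powr (1 + s)) \<le> rec_const r * (\<kappa> powr (1 + s) * J powr (- s))"
proof -
  have s0: "s > 0" using r by simp
  have e: "2 ^ (j + 2) * (2 * \<kappa> / 2 ^ j) powr (1 + s) = 4 * (2 * \<kappa>) powr (1 + s) * (2 powr (- s)) ^ j" for j :: nat
  proof -
    have "(2 * \<kappa> / 2 ^ j) powr (1 + s) = (2 * \<kappa>) powr (1 + s) / (2 ^ j) powr (1 + s)" using k by (simp add: powr_divide)
    also have "(2 ^ j :: real) powr (1 + s) = 2 ^ j * (2 ^ j) powr s" by (simp add: powr_add)
    also have "(2 ^ j :: real) powr s = 1 / (2 powr (- s)) ^ j"
      by (simp add: powr_realpow[symmetric] powr_powr powr_minus mult.commute power_inverse divide_simps)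
    finally show ?thesis by (simp add: power_add)
  qed
  have "(\<Sum>j\<in>Js. 2 ^ (j + 2) * (2 * \<kappa> / 2 ^ j) powr (1 + s)) = 4 * (2 * \<kappa>) powr (1 + s) * (\<Sum>j\<in>Js. (2 powr (- s)) ^ j)"
    unfolding e by (simp add: sum_distrib_left)
  also have "\<dots> \<le> 4 * (2 * \<kappa>) powr (1 + s) * ((2 / J) powr s / (1 - 2 powr (- s)))"
    by (intro mult_left_mono geometric_tail_le fin Js J s0) auto
  also have "\<dots> = 4 * 2 powr (1 + 2 * s) * (\<kappa> powr (1 + s) * J powr (- s)) * (1 / (1 - 2 powr (- s)))"
    using k J by (simp add: powr_mult powr_divide powr_minus powr_add[symmetric] field_simps)
  also have "\<dots> \<le> 4 * 2 powr 3 * (\<kappa> powr (1 + s) * J powr (- s)) * (1 / (1 - 2 powr (- r)))"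
  proof (rule mult_mono)
    show "4 * 2 powr (1 + 2 * s) * (\<kappa> powr (1 + s) * J powr - s) \<le> 4 * 2 powr 3 * (\<kappa> powr (1 + s) * J powr - s)"
      using r by (intro mult_right_mono mult_left_mono powr_mono) auto
    have "1 - 2 powr (- r) \<le> 1 - 2 powr (- s :: real)" using r by simp
    moreover have "0 < 1 - 2 powr (- r)" using two_powr_neg_less_one[OF r(1)] by simp
    moreover have "0 < 1 - 2 powr (- s)" using two_powr_neg_less_one[OF s0] by simp
    ultimately show "1 / (1 - 2 powr - s) \<le> 1 / (1 - 2 powr - r)" by (intro divide_left_mono mult_pos_pos) auto
    show "0 \<le> 1 / (1 - 2 powr - s)" using two_powr_neg_less_one[OF s0] by simp
  qed auto
  also have "\<dots> = rec_const r * (\<kappa> powr (1 + s) * J powr (- s))" unfolding rec_const_def by simp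
  finally show ?thesis .
qed

section \<open>Asymptotic count for one multiplier\<close>

text \<open>A multiplicity and not an indicator: \<eta> may exceed 1/2, and then one b is hit by
  several c.\<close>

definition hits :: "real \<Rightarrow> real \<Rightarrow> nat \<Rightarrow> nat" where
  "hits \<alpha> \<eta> b = card {c::int. \<bar>\<alpha> * real b - real_of_int c\<bar> \<le> \<eta>}"

lemma finite_hits: "finite {c::int. \<bar>x - real_of_int c\<bar> \<le> \<eta>}"
  by (rule finite_subset[OF _ finite_int_Icc_real[of "x - \<eta>" "x + \<eta>"]]) (auto simp: abs_le_iff)

text \<open>Up to a constant and an error of at most 1 / v, the quantity \<alpha> (b0 + i) - c is g
  / v with g = u (b0 + i) - v c. As u is invertible modulo v, the map from (i, c) to g is a
  bijection from the block onto all integers, so what is counted are integers in an interval of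
  length 2 \<eta> v, with an error of at most 3.\<close>

lemma hits_block:
  fixes u :: int and v b0 :: nat
  assumes cop: "coprime u (int v)" and v: "v \<ge> 1" and app: "\<bar>\<alpha> * real v - real_of_int u\<bar> \<le> 1 / real v" and eta: "\<eta> \<ge> 0"
  shows "\<bar>(\<Sum>i\<in>{1..v}. real (hits \<alpha> \<eta> (b0 + i))) - 2 * \<eta> * real v\<bar> \<le> 3"
proof -
  define S where "S = Sigma {1..v} (\<lambda>i. {c::int. \<bar>\<alpha> * real (b0 + i) - real_of_int c\<bar> \<le> \<eta>})"
  define g where "g = (\<lambda>(i::nat, c::int). u * int (b0 + i) - int v * c)"
  define t where "t = \<alpha> * real v - real_of_int u"
  define \<beta> where "\<beta> = t * real b0 / real v"
  have finS: "finite S" unfolding S_def by (intro finite_SigmaI finite_hits) auto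
  have cardS: "real (card S) = (\<Sum>i\<in>{1..v}. real (hits \<alpha> \<eta> (b0 + i)))"
    unfolding S_def hits_def by (subst card_SigmaI) (auto intro: finite_hits)
  have v0: "real v > 0" using v by simp
  have rel: "\<alpha> * real (b0 + i) - real_of_int c = real_of_int (g (i, c)) / real v + \<beta> + t * real i / real v" for i c
  proof -
    have al: "\<alpha> = (real_of_int u + t) / real v" using v0 unfolding t_def by simp
    have gr: "real_of_int (g (i, c)) = real_of_int u * real (b0 + i) - real v * real_of_int c" unfolding g_def by simp
    show ?thesis unfolding gr \<beta>_def by (subst al) (use v0 in \<open>simp add: field_simps\<close>)
  qed
  have small: "\<bar>t * real i / real v\<bar> \<le> 1 / real v" if "i \<in> {1..v}" for i
  proof -
    have "\<bar>t * real i\<bar> \<le> 1 / real v * real v" unfolding abs_mult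
      using that app unfolding t_def by (intro mult_mono) auto
    then show ?thesis using v0 by (simp add: abs_divide divide_right_mono)
  qed
  have inj: "inj_on g S"
  proof (rule inj_onI)
    fix x y assume xy: "x \<in> S" "y \<in> S" "g x = g y"
    obtain i c j d where ij: "x = (i, c)" "y = (j, d)" by (cases x, cases y)
    have e: "u * (int i - int j) = int v * (c - d)" using xy(3) unfolding g_def ij by (simp add: algebra_simps)
    then have "int v dvd u * (int i - int j)" by simp
    then have "int v dvd int i - int j" using cop by (simp add: coprime_dvd_mult_right_iff coprime_commute)
    moreover have "\<bar>int i - int j\<bar> < int v" using xy ij unfolding S_def by auto
    ultimately have "int i - int j = 0" by (metis abs_of_nat dvd_imp_le_int not_le)
    then show "x = y" using e v ij by simp
  qed
  have up: "real (card S) \<le> 2 * \<eta> * real v + 3"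
  proof -
    have "g ` S \<subseteq> {s. - (real v * (\<beta> + \<eta>)) - 1 \<le> real_of_int s \<and> real_of_int s \<le> real v * (\<eta> - \<beta>) + 1}"
    proof (rule image_subsetI)
      fix x assume x: "x \<in> S"
      obtain i c where ic: "x = (i, c)" by (cases x)
      have "\<bar>real_of_int (g (i, c)) / real v + \<beta> + t * real i / real v\<bar> \<le> \<eta>" using x ic rel unfolding S_def by auto
      moreover have "\<bar>t * real i / real v\<bar> \<le> 1 / real v" using small x ic unfolding S_def by auto
      ultimately have "real_of_int (g (i, c)) / real v \<le> \<eta> + 1 / real v - \<beta>" "- \<eta> - 1 / real v - \<beta> \<le> real_of_int (g (i, c)) / real v"
        by linarith+
      note y = this
      have "real v * (real_of_int (g (i, c)) / real v) \<le> real v * (\<eta> + 1 / real v - \<beta>)"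
        "real v * (- \<eta> - 1 / real v - \<beta>) \<le> real v * (real_of_int (g (i, c)) / real v)"
        using mult_left_mono[OF y(1), of "real v"] mult_left_mono[OF y(2), of "real v"] by simp_all
      then show "g x \<in> {s. - (real v * (\<beta> + \<eta>)) - 1 \<le> real_of_int s \<and> real_of_int s \<le> real v * (\<eta> - \<beta>) + 1}"
        using v0 ic by (simp add: algebra_simps)
    qed
    then have "card (g ` S) \<le> card {s::int. - (real v * (\<beta> + \<eta>)) - 1 \<le> real_of_int s \<and> real_of_int s \<le> real v * (\<eta> - \<beta>) + 1}"
      by (rule card_mono[OF finite_int_Icc_real])
    also have "real \<dots> \<le> (real v * (\<eta> - \<beta>) + 1) - (- (real v * (\<beta> + \<eta>)) - 1) + 1"
      by (rule card_int_Icc_real_le) (use v0 eta in \<open>simp add: algebra_simps\<close>)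
    finally show ?thesis using inj by (simp add: card_image algebra_simps)
  qed
  have lo: "2 * \<eta> * real v - 3 \<le> real (card S)"
  proof -
    let ?I = "{s::int. - (real v * (\<beta> + \<eta>)) + 1 \<le> real_of_int s \<and> real_of_int s \<le> real v * (\<eta> - \<beta>) - 1}"
    have "?I \<subseteq> g ` S"
    proof
      fix s assume s: "s \<in> ?I"
      obtain w where w: "[u * w = 1] (mod int v)" using cong_solve_coprime_int[OF cop] by blast
      \<comment> \<open>The solution of u (b0 + i) = s modulo v; the 1 that is subtracted and added
        moves the representatives from 0..v-1 to 1..v.\<close>
      define i where "i = nat ((w * s - int b0 - 1) mod int v) + 1"
      have i1: "i \<in> {1..v}" unfolding i_def using v
        by (simp add: nat_less_iff Suc_le_eq)
      have i2: "int i = (w * s - int b0 - 1) mod int v + 1" unfolding i_def using v by simp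
      have "[(w * s - int b0 - 1) mod int v + (int b0 + 1) = w * s - int b0 - 1 + (int b0 + 1)] (mod int v)"
        by (intro cong_add) auto
      then have "[int (b0 + i) = w * s] (mod int v)" using i2 by (simp add: algebra_simps)
      then have "[u * int (b0 + i) = u * (w * s)] (mod int v)" by (rule cong_scalar_left)
      also have "[u * (w * s) = 1 * s] (mod int v)" using cong_scalar_right[OF w, of s] by (simp add: mult.assoc)
      finally have "int v dvd u * int (b0 + i) - s" by (simp add: cong_iff_dvd_diff)
      then obtain c where c: "u * int (b0 + i) - s = int v * c" by blast
      have gs: "g (i, c) = s" unfolding g_def using c by simp
      have "\<bar>real_of_int s / real v + \<beta>\<bar> \<le> \<eta> - 1 / real v" using s v0 by (simp add: abs_le_iff field_simps) linarith
      then have "\<bar>\<alpha> * real (b0 + i) - real_of_int c\<bar> \<le> \<eta>" unfolding rel gs using small[OF i1] by linarith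
      then have "(i, c) \<in> S" unfolding S_def using i1 by auto
      then show "s \<in> g ` S" using gs by force
    qed
    then have "card ?I \<le> card (g ` S)" using finS by (intro card_mono) auto
    moreover have "(real v * (\<eta> - \<beta>) - 1) - (- (real v * (\<beta> + \<eta>)) + 1) - 1 \<le> real (card ?I)"
      by (rule card_int_Icc_real_ge)
    ultimately show ?thesis using inj by (simp add: card_image algebra_simps)
  qed
  show ?thesis using up lo unfolding cardS by linarith
qed

text \<open>Each full block of length v has an error of at most 3, and the incomplete last block
  contains at most 2 \<eta> v + 3 hits.\<close>

lemma hits_asymp:
  fixes u :: int and v :: nat
  assumes cop: "coprime u (int v)" and v: "v \<ge> 1" and app: "\<bar>\<alpha> * real v - real_of_int u\<bar> \<le> 1 / real v" and eta: "\<eta> \<ge> 0" and N: "N \<ge> 0"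
  shows "\<bar>(\<Sum>b\<in>{1..nat \<lfloor>N\<rfloor>}. real (hits \<alpha> \<eta> b)) - 2 * \<eta> * N\<bar> \<le> 3 * N / real v + 2 * \<eta> * real v + 3"
proof -
  let ?h = "\<lambda>b. real (hits \<alpha> \<eta> b)"
  define m where "m = nat \<lfloor>N\<rfloor>"
  define Q where "Q = m div v"
  have block: "\<bar>(\<Sum>b\<in>{b0+1..b0+v}. ?h b) - 2 * \<eta> * real v\<bar> \<le> 3" for b0
  proof -
    have "(\<Sum>b\<in>{b0+1..b0+v}. ?h b) = (\<Sum>i\<in>{1..v}. ?h (b0 + i))"
      using sum.shift_bounds_cl_nat_ivl[of ?h 1 b0 v] by (simp add: add.commute)
    then show ?thesis using hits_block[OF cop v app eta, of b0] by simp
  qed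
  have full: "\<bar>(\<Sum>b\<in>{1..v * k}. ?h b) - 2 * \<eta> * real v * real k\<bar> \<le> 3 * real k" for k
  proof (induction k)
    case (Suc k)
    have "{1..v * Suc k} = {1..v * k} \<union> {v * k + 1..v * k + v}" by auto
    then have "(\<Sum>b\<in>{1..v * Suc k}. ?h b) = (\<Sum>b\<in>{1..v * k}. ?h b) + (\<Sum>b\<in>{v * k + 1..v * k + v}. ?h b)"
      by (subst sum.union_disjoint[symmetric]) auto
    then show ?case using Suc block[of "v * k"] by (simp add: algebra_simps)
  qed simp
  have "v * Q + m mod v = m" unfolding Q_def by simp
  moreover have "m mod v < v" using v by simp
  ultimately have vQ: "v * Q \<le> m" "m < v * Q + v" by linarith+
  have mN: "real m \<le> N" "N < real m + 1" unfolding m_def using N by linarith+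
  have "(\<Sum>b\<in>{1..m}. ?h b) = (\<Sum>b\<in>{1..v * Q}. ?h b) + (\<Sum>b\<in>{v * Q + 1..m}. ?h b)"
    using vQ by (subst sum.union_disjoint[symmetric]) (auto intro: sum.cong)
  moreover have "(\<Sum>b\<in>{v * Q + 1..m}. ?h b) \<ge> 0" by (intro sum_nonneg) auto
  moreover have "(\<Sum>b\<in>{v * Q + 1..m}. ?h b) \<le> (\<Sum>b\<in>{v * Q + 1..v * Q + v}. ?h b)"
    using vQ by (intro sum_mono2) auto
  moreover have "real Q \<le> N / real v"
  proof -
    have "real Q \<le> real m / real v" unfolding Q_def by (rule real_div_ge)
    also have "\<dots> \<le> N / real v" using mN by (intro divide_right_mono) auto
    finally show ?thesis .
  qed
  moreover have "2 * \<eta> * (real v * real Q) \<le> 2 * \<eta> * N" "2 * \<eta> * N \<le> 2 * \<eta> * (real v * real Q + real v)"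
  proof -
    have "real (v * Q) \<le> real m" by (rule of_nat_mono[OF vQ(1)])
    moreover have "real (m + 1) \<le> real (v * Q + v)" by (rule of_nat_mono) (use vQ(2) in simp)
    ultimately have "real v * real Q \<le> N" "N \<le> real v * real Q + real v" using mN by auto
    then show "2 * \<eta> * (real v * real Q) \<le> 2 * \<eta> * N" "2 * \<eta> * N \<le> 2 * \<eta> * (real v * real Q + real v)"
      using eta by (auto intro!: mult_left_mono)
  qed
  moreover have "\<bar>(\<Sum>b\<in>{1..v * Q}. ?h b) - 2 * \<eta> * (real v * real Q)\<bar> \<le> 3 * real Q"
    using full[of Q] by (simp add: mult.assoc)
  moreover have "2 * \<eta> * (real v * real Q + real v) = 2 * \<eta> * (real v * real Q) + 2 * \<eta> * real v"
    by (simp add: algebra_simps)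
  moreover have "3 * N / real v = 3 * (N / real v)" by simp
  ultimately show ?thesis using block[of "v * Q"] unfolding m_def[symmetric] abs_le_iff by linarith
qed

text \<open>The block bound 3 N / v + 2 \<eta> v + 3 is at most 10 E unless the denominator v of a
  Dirichlet approximation is small. If then \<alpha> v is not an integer, (v, u) is a short lattice
  vector; the third alternative is phrased so that it is a point of
  \<open>near_multiples \<alpha> (N / n) (2 * \<eta> / n)\<close>.\<close>

lemma hits_trichotomy:
  fixes \<alpha> \<eta> N E :: real
  assumes eta: "\<eta> > 0" and N: "N \<ge> 1" and E: "E \<ge> 1" "\<eta> * N \<le> E * E" "\<eta> \<le> E"
  defines "err \<equiv> \<bar>(\<Sum>b\<in>{1..nat \<lfloor>N\<rfloor>}. real (hits \<alpha> \<eta> b)) - 2 * \<eta> * N\<bar>"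
  shows "err \<le> 10 * E \<or>
    (\<exists>(v::nat) (u::int). v \<ge> 1 \<and> \<alpha> * real v = real_of_int u \<and> err \<le> 10 * E + 3 * N / real v) \<or>
    (\<exists>(v::nat) (u::int) n. v \<ge> 1 \<and> n > E \<and> real v \<le> N / n \<and> 0 < \<bar>\<alpha> * real v - real_of_int u\<bar> \<and>
       \<bar>\<alpha> * real v - real_of_int u\<bar> \<le> 2 * \<eta> / n \<and> err \<le> 10 * E + 6 * n)"
proof -
  \<comment> \<open>Denominators up to about E / \<eta> keep \<eta> v below E + \<eta> and force |t|
    < \<eta> / E.\<close>
  define V where "V = nat \<lceil>E / \<eta>\<rceil>"
  have Ee: "E / \<eta> > 0" using E eta by simp
  have V: "E / \<eta> \<le> real V" "real V \<le> E / \<eta> + 1" "V > 0" unfolding V_def using Ee by linarith+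
  obtain u k where uk: "coprime u k" "0 < k" "k \<le> int V" "\<bar>of_int k * \<alpha> - of_int u\<bar> < 1 / real V"
    using Dirichlet_approx_coprime[OF V(3), of \<alpha>] by metis
  define v where "v = nat k"
  have k: "k = int v" "v \<ge> 1" "v \<le> V" using uk unfolding v_def by auto
  have rv: "real v \<ge> 1" "real v \<le> real V" using k by auto
  define t where "t = \<alpha> * real v - real_of_int u"
  have tV: "\<bar>t\<bar> < 1 / real V" using uk(4) k unfolding t_def by (simp add: mult.commute)
  have Vv: "1 / real V \<le> 1 / real v" using rv by (intro divide_left_mono) auto
  have tv: "\<bar>t\<bar> \<le> 1 / real v" using tV Vv by linarith
  have tv1: "real v * \<bar>t\<bar> \<le> 1" using tv rv by (simp add: field_simps)
  have tE: "\<bar>t\<bar> < \<eta> / E"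
  proof -
    have "1 / real V \<le> 1 / (E / \<eta>)" using V Ee by (intro divide_left_mono mult_pos_pos) auto
    then show ?thesis using tV by simp
  qed
  have cop: "coprime u (int v)" using uk(1) k by simp
  have e1: "err \<le> 3 * N / real v + 2 * \<eta> * real v + 3"
    unfolding err_def using hits_asymp[OF cop k(2), of \<alpha> \<eta> N] tv eta N unfolding t_def by simp
  show ?thesis
  proof (cases "N / real v \<le> E")
    case True
    have "\<eta> * real v \<le> \<eta> * (E / \<eta> + 1)" using rv V eta by (intro mult_left_mono) auto
    also have "\<dots> = E + \<eta>" using eta by (simp add: field_simps)
    finally show ?thesis using e1 True E by simp
  next
    case False
    then have vN: "real v * E \<le> N" using rv by (simp add: field_simps)
    have "(\<eta> * real v) * E \<le> E * E"
    proof -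
      have "\<eta> * (real v * E) \<le> \<eta> * N" using vN eta by (intro mult_left_mono) auto
      moreover have "(\<eta> * real v) * E = \<eta> * (real v * E)" by simp
      ultimately show ?thesis using E(2) by linarith
    qed
    then have "\<eta> * real v \<le> E" using E by simp
    then have e2: "err \<le> 5 * E + 3 * (N / real v)" using e1 E by simp
    show ?thesis
    proof (cases "t = 0")
      case True
      then have "\<alpha> * real v = real_of_int u" unfolding t_def by simp
      then show ?thesis using e2 k E by (intro disjI2 disjI1 exI[of _ v] exI[of _ u]) auto
    next
      case t0: False
      show ?thesis
      \<comment> \<open>In the first case n = N / v satisfies both requirements on the vector, and
        the error term 3 N / v is 3 n.\<close>
      proof (cases "N / real v \<le> 2 * \<eta> / \<bar>t\<bar>")
        case True
        have "\<bar>t\<bar> \<le> 2 * \<eta> / (N / real v)" using True t0 rv N by (simp add: field_simps)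
        moreover have "real v \<le> N / (N / real v)" using rv N by simp
        ultimately show ?thesis using e2 k E False t0 N rv unfolding t_def
          by (intro disjI2 exI[of _ v] exI[of _ u] exI[of _ "N / real v"]) auto
      next
        case F2: False
        \<comment> \<open>Here t limits the vector and N / v may be far above n, so the first
          approximation is too coarse. A second one, with error at most |t| / 2, has a denominator
          v' of order 1 / |t|; then \<eta> v' is at most 3 n and N / v' at most 2 E.\<close>
        define n where "n = \<eta> / \<bar>t\<bar>"
        have n: "n > E" unfolding n_def using tE t0 E by (simp add: field_simps)
        have tn: "\<bar>t\<bar> = \<eta> / n" unfolding n_def using eta t0 by simp
        define V' where "V' = nat \<lceil>2 / \<bar>t\<bar>\<rceil>"
        have "2 / \<bar>t\<bar> > 0" using t0 by simp
        then have V': "2 / \<bar>t\<bar> \<le> real V'" "real V' \<le> 2 / \<bar>t\<bar> + 1" "V' > 0" unfolding V'_def by linarith+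
        obtain u' k' where uk': "coprime u' k'" "0 < k'" "k' \<le> int V'" "\<bar>of_int k' * \<alpha> - of_int u'\<bar> < 1 / real V'"
          using Dirichlet_approx_coprime[OF V'(3), of \<alpha>] by metis
        define v' where "v' = nat k'"
        have k': "k' = int v'" "v' \<ge> 1" "v' \<le> V'" using uk' unfolding v'_def by auto
        have rv': "real v' \<ge> 1" "real v' \<le> real V'" using k' by auto
        define t' where "t' = \<alpha> * real v' - real_of_int u'"
        have tV': "\<bar>t'\<bar> < 1 / real V'" using uk'(4) k' unfolding t'_def by (simp add: mult.commute)
        have Vv': "1 / real V' \<le> 1 / real v'" using rv' by (intro divide_left_mono) auto
        have "1 / real V' \<le> 1 / (2 / \<bar>t\<bar>)" using V' t0 by (intro divide_left_mono mult_pos_pos) auto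
        then have tt': "\<bar>t'\<bar> \<le> \<bar>t\<bar> / 2" using tV' by simp
        have e3: "err \<le> 3 * N / real v' + 2 * \<eta> * real v' + 3"
          unfolding err_def using hits_asymp[of u' v' \<alpha> \<eta> N] uk'(1) k' tV' Vv' eta N unfolding t'_def by simp
        \<comment> \<open>The determinant of the two approximations; being nonzero it forces v' |t|
          \<ge> 1/2.\<close>
        define z where "z = int v * u' - int v' * u"
        have zr: "real_of_int z = real v' * t - real v * t'" unfolding z_def t_def t'_def by (simp add: algebra_simps)
        \<comment> \<open>If z = 0, then v divides v', whereas v' t = v t' and |t'| \<le> |t| / 2
          make v' smaller than v.\<close>
        have z0: "z \<noteq> 0"
        proof
          assume "z = 0"
          then have "int v * u' = int v' * u" unfolding z_def by simp
          then have "int v dvd int v' * u" by (metis dvd_triv_left)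
          then have "int v dvd int v'" using cop coprime_dvd_mult_left_iff[of "int v" u "int v'"] by (simp add: coprime_commute)
          then have "v \<le> v'" using k' by (auto intro: dvd_imp_le)
          moreover have "real v' * \<bar>t\<bar> = real v * \<bar>t'\<bar>" proof -
            have "real v' * t = real v * t'" using zr \<open>z = 0\<close> by simp
            then have "\<bar>real v' * t\<bar> = \<bar>real v * t'\<bar>" by simp
            then show ?thesis by (simp add: abs_mult)
          qed
          then have "real v' * \<bar>t\<bar> \<le> real v * (\<bar>t\<bar> / 2)" using mult_left_mono[OF tt', of "real v"] by simp
          then have "real v' \<le> real v / 2" using t0 by simp
          ultimately show False using rv by simp
        qed
        then have "1 \<le> \<bar>real_of_int z\<bar>" by linarith
        also have "\<dots> \<le> real v' * \<bar>t\<bar> + real v * \<bar>t'\<bar>" unfolding zr using abs_triangle_ineq4[of "real v' * t" "real v * t'"] by (simp add: abs_mult)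
        also have "real v * \<bar>t'\<bar> \<le> real v * (\<bar>t\<bar> / 2)" using mult_left_mono[OF tt', of "real v"] by simp
        also have "\<dots> \<le> 1 / 2" using tv1 by simp
        finally have vt: "1 / 2 \<le> real v' * \<bar>t\<bar>" by simp
        have "1 / real v' \<le> 2 * \<bar>t\<bar>" using vt rv' by (simp add: field_simps)
        then have "N * (1 / real v') \<le> N * (2 * \<bar>t\<bar>)" using N by (intro mult_left_mono) auto
        also have "\<dots> \<le> 2 * (\<eta> * N / E)" using mult_left_mono[of "\<bar>t\<bar>" "\<eta> / E" "2 * N"] tE N by (simp add: algebra_simps)
        also have "\<dots> \<le> 2 * E" using E by (simp add: field_simps)
        finally have a1: "N / real v' \<le> 2 * E" by simp
        have "1 / real v \<le> 1" using rv by simp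
        then have "\<bar>t\<bar> \<le> 1" using tv by linarith
        moreover have "1 \<le> 1 / \<bar>t\<bar>" using \<open>\<bar>t\<bar> \<le> 1\<close> t0 by simp
        moreover have "2 / \<bar>t\<bar> + 1 / \<bar>t\<bar> = 3 / \<bar>t\<bar>" by (simp add: add_divide_distrib[symmetric])
        ultimately have "real v' \<le> 3 / \<bar>t\<bar>" using rv' V'(2) by linarith
        then have "\<eta> * real v' \<le> 3 * n" unfolding n_def using eta mult_left_mono[of "real v'" "3 / \<bar>t\<bar>" \<eta>] by (simp add: algebra_simps)
        then have "err \<le> 10 * E + 6 * n" using e3 a1 E by simp
        moreover have "real v \<le> N / n"
        proof -
          have "2 * n < N / real v" using F2 unfolding n_def by simp
          then have "2 * n * real v < N" using rv by (simp add: field_simps)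
          moreover have "n * real v \<ge> 0" using n E rv by simp
          ultimately have "n * real v \<le> N" by linarith
          then show ?thesis using n E by (simp add: field_simps)
        qed
        moreover have "\<bar>t\<bar> \<le> 2 * \<eta> / n" using tn eta n E by (simp add: divide_right_mono)
        ultimately show ?thesis using k n t0 unfolding t_def
          by (intro disjI2 exI[of _ v] exI[of _ u] exI[of _ n]) auto
      qed
    qed
  qed
qed

section \<open>The induction over scales\<close>

lemma card_le_sum_fibres:
  assumes "finite S" shows "card S \<le> (\<Sum>k\<in>f ` S. card {x\<in>S. f x = k})"
proof -
  have "S = (\<Union>k\<in>f ` S. {x\<in>S. f x = k})" by auto
  then show ?thesis using card_UN_le[of "f ` S" "\<lambda>k. {x\<in>S. f x = k}"] assms by simp
qed

text \<open>\<open>equi\<close> bounds the number of multiples of d up to \<kappa> N^2 in the Bohr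
  set of radius \<kappa> \<eta> by the expected order \<kappa>^2 W / d plus a power saving. The
  second term has no 1 / d, so it is useful only for d up to a small power of N. \<open>NW\<close>
  is the form taken by KN/q \<ge> 1; through it counts of order N are charged to W.\<close>

locale equidistributed_bohr =
  fixes \<alpha> \<eta> N W c D :: real
  assumes N3: "N \<ge> 3" and eta: "\<eta> > 0" and W: "W = \<eta> * N\<^sup>2" and NW: "N \<le> 2 * W"
    and c: "0 < c" "c \<le> 1" and D: "D \<ge> 0"
    and equi: "\<And>\<kappa> d. 0 < \<kappa> \<Longrightarrow> \<kappa> \<le> 1 \<Longrightarrow> d \<ge> 1 \<Longrightarrow>
      real (card (near_multiples (\<alpha> * real d) (\<kappa> * N\<^sup>2 / real d) (\<kappa> * \<eta>))) \<le> 10 * \<kappa>\<^sup>2 * W / real d + D * \<kappa> * N powr (- c) * W"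
begin

text \<open>The expected number of triples is of order \<open>\<kappa>\<^sup>2W\<close>; any exponent strictly between \<open>8/7\<close> and
  \<open>5/4\<close> instead of \<open>1 + 1/5\<close> would do.\<close>

definition claim_upto :: "real \<Rightarrow> real \<Rightarrow> real \<Rightarrow> real \<Rightarrow> bool" where
  "claim_upto C \<epsilon> r \<kappa>0 \<longleftrightarrow> (\<forall>\<kappa> A B. 0 < \<kappa> \<longrightarrow> \<kappa> \<le> \<kappa>0 \<longrightarrow> 0 < A \<longrightarrow> 0 < B \<longrightarrow> A * B \<le> \<kappa> * N\<^sup>2 \<longrightarrow>
     real (card (near_products \<alpha> A B (\<kappa> * \<eta>))) \<le> C * (\<kappa> powr (1 + 1/5) + \<epsilon> * \<kappa> powr (1 + r)) * W)"

lemma W_pos: "W > 0" using NW N3 by linarith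

text \<open>The factor 2 in the bound on A B leaves room for rounding a moved prime to a power of 2.
  The tail runs over scales 2 \<kappa> / 2^j of at most 4 \<kappa> / J, where the induction
  hypothesis is available; in the secondary term the gain from J is dropped.\<close>

lemma near_products_recursion:
  assumes r: "0 < r" "r \<le> 1/5" and k: "\<kappa> > 0" and J: "J \<ge> 1" and A: "A > 0" and B: "B > 0" and AB: "A * B \<le> 2 * \<kappa> * N\<^sup>2"
    and C: "C \<ge> 0" and eps: "\<epsilon> \<ge> 0" and IH: "claim_upto C \<epsilon> r (4 * \<kappa> / J)" and Sb: "Sb \<subseteq> {b. 1 \<le> b \<and> real b \<le> B}"
  shows "real (card {(a, b, c). (a, b, c) \<in> near_products \<alpha> A B (\<kappa> * \<eta>) \<and> b \<in> Sb}) \<le> 2 * J * real (card Sb) + 20 * \<kappa>\<^sup>2 * W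
     + rec_const r * C * (\<kappa> powr (1 + 1/5) * J powr (- (1/5)) + \<epsilon> * \<kappa> powr (1 + r)) * W"
proof -
  let ?Js = "{j. J < 2 ^ (j + 1) \<and> 2 ^ j \<le> A}"
  have finJ: "finite ?Js" by (rule finite_dyadic_range)
  have "real (card Sb) \<le> B"
  proof -
    have "Sb \<subseteq> {1..nat \<lfloor>B\<rfloor>}" using Sb by (auto simp: le_nat_floor)
    then have "card Sb \<le> nat \<lfloor>B\<rfloor>" using card_mono[of "{1..nat \<lfloor>B\<rfloor>}" Sb] by simp
    then show ?thesis using B by linarith
  qed
  then have "real (card Sb) * (10 * A * (\<kappa> * \<eta>)) \<le> B * (10 * A * (\<kappa> * \<eta>))"
    using A k eta by (intro mult_right_mono) auto
  also have "\<dots> = 10 * (A * B) * (\<kappa> * \<eta>)" by simp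
  also have "\<dots> \<le> 10 * (2 * \<kappa> * N\<^sup>2) * (\<kappa> * \<eta>)" using AB k eta by (intro mult_right_mono mult_left_mono) auto
  also have "\<dots> = 20 * \<kappa>\<^sup>2 * W" unfolding W by (simp add: power2_eq_square)
  finally have t1: "real (card Sb) * (10 * A * (\<kappa> * \<eta>)) \<le> 20 * \<kappa>\<^sup>2 * W" .
  have "(\<Sum>j\<in>?Js. 2 ^ (j + 2) * real (card (near_products \<alpha> (A / 2 ^ j) B (2 * (\<kappa> * \<eta>) / 2 ^ j))))
     \<le> (\<Sum>j\<in>?Js. 2 ^ (j + 2) * (C * ((2 * \<kappa> / 2 ^ j) powr (1 + 1/5) + \<epsilon> * (2 * \<kappa> / 2 ^ j) powr (1 + r)) * W))"
  proof (intro sum_mono mult_left_mono)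
    fix j assume j: "j \<in> ?Js"
    have "2 * \<kappa> / 2 ^ j \<le> 4 * \<kappa> / J" using j k J by (auto simp: field_simps)
    moreover have "A / 2 ^ j * B \<le> 2 * \<kappa> / 2 ^ j * N\<^sup>2" using AB by (simp add: field_simps)
    ultimately have "real (card (near_products \<alpha> (A / 2 ^ j) B (2 * \<kappa> / 2 ^ j * \<eta>))) \<le> C * ((2 * \<kappa> / 2 ^ j) powr (1 + 1/5) + \<epsilon> * (2 * \<kappa> / 2 ^ j) powr (1 + r)) * W"
      using IH[unfolded claim_upto_def, rule_format, of "2 * \<kappa> / 2 ^ j" "A / 2 ^ j" B] A B k by simp
    then show "real (card (near_products \<alpha> (A / 2 ^ j) B (2 * (\<kappa> * \<eta>) / 2 ^ j))) \<le> C * ((2 * \<kappa> / 2 ^ j) powr (1 + 1/5) + \<epsilon> * (2 * \<kappa> / 2 ^ j) powr (1 + r)) * W"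
      by (simp add: mult.assoc)
  qed auto
  also have "\<dots> = C * W * ((\<Sum>j\<in>?Js. 2 ^ (j + 2) * (2 * \<kappa> / 2 ^ j) powr (1 + 1/5)) + \<epsilon> * (\<Sum>j\<in>?Js. 2 ^ (j + 2) * (2 * \<kappa> / 2 ^ j) powr (1 + r)))"
    by (simp only: sum_distrib_left sum.distrib[symmetric]) (rule sum.cong, auto simp: algebra_simps)
  also have "\<dots> \<le> C * W * (rec_const r * (\<kappa> powr (1 + 1/5) * J powr (- (1/5))) + \<epsilon> * (rec_const r * (\<kappa> powr (1 + r) * 1)))"
  proof (intro mult_left_mono add_mono)
    show "(\<Sum>j\<in>?Js. 2 ^ (j + 2) * (2 * \<kappa> / 2 ^ j) powr (1 + 1/5)) \<le> rec_const r * (\<kappa> powr (1 + 1/5) * J powr (- (1/5)))"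
      by (rule dyadic_power_sum_le[OF finJ _ J]) (use r k in auto)
    have "(\<Sum>j\<in>?Js. 2 ^ (j + 2) * (2 * \<kappa> / 2 ^ j) powr (1 + r)) \<le> rec_const r * (\<kappa> powr (1 + r) * J powr (- r))"
      by (rule dyadic_power_sum_le[OF finJ _ J]) (use r k in auto)
    also have "\<dots> \<le> rec_const r * (\<kappa> powr (1 + r) * 1)"
    proof (intro mult_left_mono)
      show "J powr (- r) \<le> 1" using J r by (simp add: powr_minus ge_one_powr_ge_zero inverse_le_1_iff)
    qed (use rec_const_ge[OF r(1)] in auto)
    finally show "(\<Sum>j\<in>?Js. 2 ^ (j + 2) * (2 * \<kappa> / 2 ^ j) powr (1 + r)) \<le> rec_const r * (\<kappa> powr (1 + r) * 1)" .
  qed (use C W_pos eps in auto)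
  also have "\<dots> = rec_const r * C * (\<kappa> powr (1 + 1/5) * J powr (- (1/5)) + \<epsilon> * \<kappa> powr (1 + r)) * W"
    by (simp add: algebra_simps)
  finally have t2: "(\<Sum>j\<in>?Js. 2 ^ (j + 2) * real (card (near_products \<alpha> (A / 2 ^ j) B (2 * (\<kappa> * \<eta>) / 2 ^ j))))
     \<le> rec_const r * C * (\<kappa> powr (1 + 1/5) * J powr (- (1/5)) + \<epsilon> * \<kappa> powr (1 + r)) * W" .
  show ?thesis using near_products_fibre_recursion[of "\<kappa> * \<eta>" A J Sb B \<alpha>] k eta A J Sb t1 t2 by (simp add: algebra_simps)
qed

text \<open>8 bounds the divisors of the rough part, 2^(2^j) comes from Landreau's inequality,
  34^(2^(2^j)) from the reciprocal sum over smooth numbers, and 10 + D from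
  \<open>equi\<close>.\<close>

definition div_const :: "nat \<Rightarrow> real" where
  "div_const j = 8 * 2 ^ (2 ^ j) * 34 ^ (2 ^ (2 ^ j)) * (10 + D)"

text \<open>At most \<tau>(n) triples share the product n = a b and the integer e. With n = s t,
  Landreau's inequality replaces \<tau>(s) by divisors d \<le> N^(c/2) of s, for which
  \<open>equi\<close> is effective. As these d are y-smooth, the loss is a power of 1 + ln y and not
  of ln N, which is affordable when y is a power of 1 / \<kappa>.\<close>

lemma near_products_divisor_bound:
  assumes k: "0 < \<kappa>" "\<kappa> \<le> 1" and AB: "A * B \<le> \<kappa> * N\<^sup>2" and y: "y \<ge> 1" and j: "4 \<le> c * 2 ^ j"
    and T: "T \<subseteq> near_products \<alpha> A B (\<kappa> * \<eta>)"
    and fac: "\<And>a b e. (a, b, e) \<in> T \<Longrightarrow> \<exists>s t. a * b = s * t \<and> smooth y s \<and> divisor_tau t \<le> 8"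
  shows "real (card T) \<le> div_const j * (1 + ln y) ^ (2 ^ (2 ^ j)) * (\<kappa>\<^sup>2 + \<kappa> * N powr (- (c / 2))) * W"
proof -
  let ?m = "2 ^ j :: nat"
  define f where "f = (\<lambda>(a::nat, b::nat, e::int). (a * b, e))"
  define X where "X = f ` T"
  define DD where "DD = {d\<in>{1..nat \<lfloor>N powr (c / 2)\<rfloor>}. smooth y d}"
  have finT: "finite T" using T finite_near_products finite_subset by blast
  have finX: "finite X" unfolding X_def using finT by simp
  have XN: "X \<subseteq> near_multiples \<alpha> (\<kappa> * N\<^sup>2) (\<kappa> * \<eta>)"
  proof
    fix x assume "x \<in> X"
    then obtain a b e where x: "x = (a * b, e)" "(a, b, e) \<in> T" unfolding X_def f_def by auto
    then have t: "(a, b, e) \<in> near_products \<alpha> A B (\<kappa> * \<eta>)" using T by blast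
    then have "real a * real b \<le> A * B" unfolding near_products_def by (auto intro!: mult_mono)
    then show "x \<in> near_multiples \<alpha> (\<kappa> * N\<^sup>2) (\<kappa> * \<eta>)" using t AB x unfolding near_products_def near_multiples_def by (auto simp: Suc_le_eq)
  qed
  have pos: "fst x > 0" if "x \<in> X" for x using that XN unfolding near_multiples_def by auto
  have "real (card T) \<le> (\<Sum>x\<in>X. real (divisor_tau (fst x)))"
  proof -
    have "card T \<le> (\<Sum>x\<in>X. card {w\<in>T. f w = x})" unfolding X_def by (rule card_le_sum_fibres[OF finT])
    also have "\<dots> \<le> (\<Sum>x\<in>X. divisor_tau (fst x))"
    proof (rule sum_mono)
      fix x assume x: "x \<in> X"
      have "card {w\<in>T. f w = x} = card (fst ` {w\<in>T. f w = x})"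
      proof (rule card_image[symmetric], rule inj_onI)
        fix w w' assume w: "w \<in> {w\<in>T. f w = x}" "w' \<in> {w\<in>T. f w = x}" "fst w = fst w'"
        obtain a b e a' b' e' where ww: "w = (a, b, e)" "w' = (a', b', e')" by (cases w, cases w')
        have "a > 0" using w ww T unfolding near_products_def by auto
        then show "w = w'" using w ww unfolding f_def by auto
      qed
      also have "\<dots> \<le> card {d. d dvd fst x}"
        by (rule card_mono) (use pos[OF x] finite_divisors_nat in \<open>auto simp: f_def\<close>)
      finally show "card {w\<in>T. f w = x} \<le> divisor_tau (fst x)" unfolding divisor_tau_def .
    qed
    finally show ?thesis by (metis of_nat_le_iff of_nat_sum)
  qed
  also have "\<dots> \<le> (\<Sum>x\<in>X. \<Sum>d\<in>{d\<in>DD. d dvd fst x}. 8 * 2 ^ ?m * real (divisor_tau d) ^ ?m)"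
  proof (rule sum_mono)
    fix x assume x: "x \<in> X"
    then obtain s t where st: "fst x = s * t" "smooth y s" "divisor_tau t \<le> 8"
      using fac unfolding X_def f_def by fastforce
    have st0: "s > 0" "t > 0" using pos[OF x] st by (auto intro: Nat.gr0I)
    obtain d where d: "d dvd s" "d ^ ?m \<le> s" "divisor_tau s \<le> 2 ^ ?m * divisor_tau d ^ ?m"
      using divisor_tau_small_divisor[OF st0(1), of j] by blast
    have d0: "d > 0" using d(1) st0 by (auto intro: Nat.gr0I)
    have "real d \<le> N powr (c / 2)"
    proof -
      have "real (fst x) \<le> \<kappa> * N\<^sup>2" using x XN unfolding near_multiples_def by auto
      also have "\<dots> \<le> N\<^sup>2" using k by (simp add: mult_left_le_one_le)
      finally have "real (fst x) \<le> N\<^sup>2" .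
      moreover have "s \<le> fst x" using st st0 by simp
      ultimately have "real (d ^ ?m) \<le> N\<^sup>2" using d(2) by linarith
      moreover have "real d powr real ?m = real (d ^ ?m)" using powr_realpow[of "real d" ?m] d0 by simp
      moreover have "N powr 2 = N\<^sup>2" using N3 by simp
      ultimately have "real d powr real ?m \<le> N powr 2" by linarith
      then have "(real d powr real ?m) powr (1 / real ?m) \<le> (N powr 2) powr (1 / real ?m)"
        by (intro powr_mono2) auto
      then have "real d \<le> N powr (2 / real ?m)" using d0 by (simp add: powr_powr)
      \<comment> \<open>The size of j enters here: 2 / 2^j \<le> c / 2.\<close>
      also have "\<dots> \<le> N powr (c / 2)" using N3 j by (intro powr_mono) (auto simp: field_simps)
      finally show ?thesis .
    qed
    then have dD: "d \<in> {d\<in>DD. d dvd fst x}" unfolding DD_def using d st smooth_dvd[OF st(2) d(1)] d0 by (auto simp: le_nat_floor)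
    have "divisor_tau (fst x) \<le> divisor_tau s * divisor_tau t" unfolding st(1) by (rule divisor_tau_mult_le[OF st0])
    also have "\<dots> \<le> (2 ^ ?m * divisor_tau d ^ ?m) * 8" by (rule mult_le_mono[OF d(3) st(3)])
    finally have "real (divisor_tau (fst x)) \<le> real ((2 ^ ?m * divisor_tau d ^ ?m) * 8)" by (rule of_nat_mono)
    then have "real (divisor_tau (fst x)) \<le> 8 * 2 ^ ?m * real (divisor_tau d) ^ ?m" by simp
    also have "\<dots> \<le> (\<Sum>d\<in>{d\<in>DD. d dvd fst x}. 8 * 2 ^ ?m * real (divisor_tau d) ^ ?m)"
      by (rule member_le_sum[OF dD]) (auto simp: DD_def)
    finally show "real (divisor_tau (fst x)) \<le> (\<Sum>d\<in>{d\<in>DD. d dvd fst x}. 8 * 2 ^ ?m * real (divisor_tau d) ^ ?m)" .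
  qed
  also have "\<dots> = (\<Sum>d\<in>DD. \<Sum>x\<in>{x\<in>X. d dvd fst x}. 8 * 2 ^ ?m * real (divisor_tau d) ^ ?m)"
    by (rule sum.swap_restrict) (auto simp: finX DD_def)
  also have "\<dots> = (\<Sum>d\<in>DD. 8 * 2 ^ ?m * real (divisor_tau d) ^ ?m * real (card {x\<in>X. d dvd fst x}))"
    by (simp add: mult.commute)
  also have "\<dots> \<le> (\<Sum>d\<in>DD. 8 * 2 ^ ?m * real (divisor_tau d) ^ ?m * ((10 * \<kappa>\<^sup>2 + D * \<kappa> * N powr (- (c / 2))) * W / real d))"
  proof (intro sum_mono mult_left_mono)
    fix d assume d: "d \<in> DD"
    have d1: "d \<ge> 1" "real d \<le> N powr (c / 2)" using d unfolding DD_def by (auto simp: le_nat_floor) (metis le_nat_floor of_nat_le_iff order_trans of_nat_floor powr_ge_zero)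
    have "card {x\<in>X. d dvd fst x} = card ((\<lambda>x. (fst x div d, snd x)) ` {x\<in>X. d dvd fst x})"
      by (rule card_image[symmetric]) (use d1 in \<open>auto intro!: inj_onI prod_eqI elim!: dvdE\<close>)
    also have "\<dots> \<le> card (near_multiples (\<alpha> * real d) (\<kappa> * N\<^sup>2 / real d) (\<kappa> * \<eta>))"
    proof (rule card_mono[OF finite_near_multiples], rule image_subsetI)
      fix x assume x: "x \<in> {x\<in>X. d dvd fst x}"
      then obtain m where m: "fst x = d * m" by blast
      have x': "x \<in> near_multiples \<alpha> (\<kappa> * N\<^sup>2) (\<kappa> * \<eta>)" using x XN by blast
      then have "m > 0" using m unfolding near_multiples_def by (auto intro: Nat.gr0I)
      then show "(fst x div d, snd x) \<in> near_multiples (\<alpha> * real d) (\<kappa> * N\<^sup>2 / real d) (\<kappa> * \<eta>)"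
        using x' m d1 unfolding near_multiples_def by (auto simp: field_simps split: prod.splits)
    qed
    finally have "real (card {x\<in>X. d dvd fst x}) \<le> real (card (near_multiples (\<alpha> * real d) (\<kappa> * N\<^sup>2 / real d) (\<kappa> * \<eta>)))" by simp
    also have "\<dots> \<le> 10 * \<kappa>\<^sup>2 * W / real d + D * \<kappa> * N powr (- c) * W" by (rule equi[OF k d1(1)])
    \<comment> \<open>Half of the power saving is spent on creating a factor 1 / d, which d \<le>
      N^(c/2) allows.\<close>
    also have "D * \<kappa> * N powr (- c) * W \<le> D * \<kappa> * (N powr (- (c / 2)) / real d) * W"
    proof (intro mult_right_mono mult_left_mono)
      have "real d * N powr (- c) \<le> N powr (c / 2) * N powr (- c)" using d1 by (intro mult_right_mono) auto
      also have "\<dots> = N powr (- (c / 2))" using N3 by (simp add: powr_add[symmetric])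
      finally show "N powr (- c) \<le> N powr (- (c / 2)) / real d" using d1 by (simp add: field_simps)
    qed (use D k W_pos in auto)
    also have "10 * \<kappa>\<^sup>2 * W / real d + D * \<kappa> * (N powr (- (c / 2)) / real d) * W = (10 * \<kappa>\<^sup>2 + D * \<kappa> * N powr (- (c / 2))) * W / real d"
      by (simp add: add_divide_distrib algebra_simps)
    finally show "real (card {x\<in>X. d dvd fst x}) \<le> (10 * \<kappa>\<^sup>2 + D * \<kappa> * N powr (- (c / 2))) * W / real d" by simp
  qed auto
  also have "\<dots> = 8 * 2 ^ ?m * ((10 * \<kappa>\<^sup>2 + D * \<kappa> * N powr (- (c / 2))) * W) * (\<Sum>d\<in>DD. real (divisor_tau d) ^ ?m / real d)"
    by (subst sum_distrib_left) (rule sum.cong, auto)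
  also have "\<dots> \<le> 8 * 2 ^ ?m * ((10 + D) * (\<kappa>\<^sup>2 + \<kappa> * N powr (- (c / 2))) * W) * (34 * (1 + ln y)) ^ (2 ^ ?m)"
  proof (intro mult_mono mult_left_mono mult_right_mono)
    have "10 * \<kappa>\<^sup>2 \<le> (10 + D) * \<kappa>\<^sup>2" "D * (\<kappa> * N powr (- (c / 2))) \<le> (10 + D) * (\<kappa> * N powr (- (c / 2)))"
      using D k by (auto intro!: mult_right_mono)
    then show "10 * \<kappa>\<^sup>2 + D * \<kappa> * N powr (- (c / 2)) \<le> (10 + D) * (\<kappa>\<^sup>2 + \<kappa> * N powr (- (c / 2)))"
      by (simp add: algebra_simps)
    have "(\<Sum>d\<in>DD. real (divisor_tau d) ^ ?m / real d) \<le> (\<Sum>d\<in>DD. 1 / real d) ^ (2 ^ ?m)"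
    proof (rule sum_divisor_tau_power_le)
      fix d e assume "d \<in> DD" "e dvd d"
      then show "e \<in> DD" unfolding DD_def using smooth_dvd[of y d e] dvd_imp_le[of e d] dvd_pos_nat[of d e] by auto
    qed (auto simp: DD_def)
    also have "\<dots> \<le> (34 * (1 + ln y)) ^ (2 ^ ?m)"
      using smooth_sum_le[OF y, of "nat \<lfloor>N powr (c / 2)\<rfloor>"] unfolding smooth_sum_def DD_def
      by (intro power_mono) (auto intro: sum_nonneg)
    finally show "(\<Sum>d\<in>DD. real (divisor_tau d) ^ ?m / real d) \<le> (34 * (1 + ln y)) ^ (2 ^ ?m)" .
  qed (use D k W_pos in \<open>auto intro!: sum_nonneg mult_nonneg_nonneg add_nonneg_nonneg\<close>)
  also have "\<dots> = div_const j * (1 + ln y) ^ (2 ^ (2 ^ j)) * (\<kappa>\<^sup>2 + \<kappa> * N powr (- (c / 2))) * W"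
    unfolding div_const_def power_mult_distrib by (simp only: mult_ac)
  finally show ?thesis .
qed

end

section \<open>Moving a prime factor to the other variable\<close>

lemma omega_in_times_prime:
  assumes "prime l" shows "omega_in P z (l * a) \<le> omega_in P z a + 1"
proof -
  have "finite {p::nat. prime p \<and> P < real p \<and> real p \<le> z \<and> p dvd a}"
    by (rule finite_subset[OF _ finite_nat_le_real[of z]]) auto
  moreover have "{p. prime p \<and> P < real p \<and> real p \<le> z \<and> p dvd l * a} \<subseteq> insert l {p. prime p \<and> P < real p \<and> real p \<le> z \<and> p dvd a}"
    using assms by (auto simp: prime_dvd_mult_iff dest: primes_dvd_imp_eq[OF _ assms])
  ultimately have "omega_in P z (l * a) \<le> card (insert l {p. prime p \<and> P < real p \<and> real p \<le> z \<and> p dvd a})"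
    unfolding omega_in_def by (intro card_mono) auto
  also have "\<dots> \<le> omega_in P z a + 1" unfolding omega_in_def by (simp add: card_insert_le_m1 card_insert_if \<open>finite _\<close>)
  finally show ?thesis .
qed

lemma card_nat_le_real: "y \<ge> 0 \<Longrightarrow> real (card {n::nat. real n \<le> y}) \<le> y + 1"
proof -
  assume y: "y \<ge> 0"
  have "{n::nat. real n \<le> y} = {0..nat \<lfloor>y\<rfloor>}" using y by (auto simp: le_nat_floor le_nat_iff le_floor_iff)
  then show ?thesis using y by simp
qed

lemma card_near_products_pred_swap:
  "card {(a, b, e). (a, b, e) \<in> near_products \<alpha> A B \<xi> \<and> Q b a} = card {(a, b, e). (a, b, e) \<in> near_products \<alpha> B A \<xi> \<and> Q a b}"
proof -
  have "{(a, b, e). (a, b, e) \<in> near_products \<alpha> A B \<xi> \<and> Q b a} = (\<lambda>(a, b, e). (b, a, e)) ` {(a, b, e). (a, b, e) \<in> near_products \<alpha> B A \<xi> \<and> Q a b}"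
    by (auto simp: near_products_def image_iff mult.commute)
  then show ?thesis by (simp only:) (rule card_image, auto intro: inj_onI)
qed

context equidistributed_bohr
begin

text \<open>A prime factor \<open>l\<close> of \<open>b\<close> is moved over to \<open>a\<close>. The new pair \<open>(l a, b/l)\<close> is unbalanced
  enough for the lattice bound, and it determines \<open>l\<close> up to \<open>k'\<close> choices.\<close>

lemma near_products_prime_shift:
  assumes r: "0 < r" "r \<le> 1/5" and k: "\<kappa> > 0" and J: "J \<ge> 1" and A: "A > 0" and B: "B > 0" and AB: "A * B \<le> \<kappa> * N\<^sup>2"
    and C: "C \<ge> 0" and eps: "\<epsilon> \<ge> 0" and IH: "claim_upto C \<epsilon> r (4 * \<kappa> / J)" and P: "P \<ge> 1" and z: "z \<ge> 1"
  shows "real (card {(a, b, e). (a, b, e) \<in> near_products \<alpha> A B (\<kappa> * \<eta>) \<and> (\<exists>l. prime l \<and> P < real l \<and> real l \<le> z \<and> l dvd b) \<and> omega_in P z a < k'})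
    \<le> real k' * (log 2 z + 1) * (4 * J * B / P + 20 * \<kappa>\<^sup>2 * W + rec_const r * C * (\<kappa> powr (1 + 1/5) * J powr (- (1/5)) + \<epsilon> * \<kappa> powr (1 + r)) * W)"
proof -
  let ?T = "{(a, b, e). (a, b, e) \<in> near_products \<alpha> A B (\<kappa> * \<eta>) \<and> (\<exists>l. prime l \<and> P < real l \<and> real l \<le> z \<and> l dvd b) \<and> omega_in P z a < k'}"
  let ?R = "4 * J * B / P + 20 * \<kappa>\<^sup>2 * W + rec_const r * C * (\<kappa> powr (1 + 1/5) * J powr (- (1/5)) + \<epsilon> * \<kappa> powr (1 + r)) * W"
  have finT: "finite ?T" by (rule finite_subset[OF _ finite_near_products[of \<alpha> A B "\<kappa> * \<eta>"]]) auto
  define l where "l = (\<lambda>b::nat. SOME l. prime l \<and> P < real l \<and> real l \<le> z \<and> l dvd b)"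
  define ii where "ii = (\<lambda>m::nat. SOME i::nat. 2 ^ i \<le> real m \<and> real m < 2 ^ (i + 1))"
  have l: "prime (l b) \<and> P < real (l b) \<and> real (l b) \<le> z \<and> l b dvd b" if "(a, b, e) \<in> ?T" for a b e
  proof -
    have "\<exists>l. prime l \<and> P < real l \<and> real l \<le> z \<and> l dvd b" using that by auto
    from someI_ex[OF this] show ?thesis unfolding l_def .
  qed
  have ii: "2 ^ ii m \<le> real m \<and> real m < 2 ^ (ii m + 1)" if "m \<ge> 1" for m
  proof -
    have "1 \<le> real m" using that by simp
    then obtain i :: nat where "2 ^ i \<le> real m" "real m < 2 ^ (i + 1)" by (rule dyadic_exponent)
    then have "\<exists>i::nat. 2 ^ i \<le> real m \<and> real m < 2 ^ (i + 1)" by blast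
    from someI_ex[OF this] show ?thesis unfolding ii_def .
  qed
  \<comment> \<open>Besides the new pair, \<open>f\<close> records the dyadic size of the moved
    prime, since that fixes the box containing the pair.\<close>
  define f where "f = (\<lambda>(a::nat, b::nat, e::int). (ii (l b), l b * a, b div l b, e))"
  define I where "I = {i::nat. P < 2 ^ (i + 1) \<and> 2 ^ i \<le> z}"
  have I: "I \<subseteq> {i. real i \<le> log 2 z}"
  proof
    fix i assume "i \<in> I"
    then have "2 powr real i \<le> z" unfolding I_def by (simp add: powr_realpow)
    then show "i \<in> {i. real i \<le> log 2 z}" using z by (simp add: le_log_iff)
  qed
  have finI: "finite I" by (rule finite_subset[OF I finite_nat_le_real])
  have lz: "log 2 z \<ge> 0" using z by simp
  have cardI: "real (card I) \<le> log 2 z + 1"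
    using card_mono[OF finite_nat_le_real I] card_nat_le_real[OF lz] by linarith
  let ?S = "Sigma I (\<lambda>i. near_products \<alpha> (2 ^ (i + 1) * A) (B / 2 ^ i) (\<kappa> * \<eta>))"
  have sub: "f ` ?T \<subseteq> ?S"
  proof (rule image_subsetI)
    fix x assume x: "x \<in> ?T"
    obtain a b e where abe: "x = (a, b, e)" by (cases x)
    have t: "(a, b, e) \<in> near_products \<alpha> A B (\<kappa> * \<eta>)" using x abe by auto
    note l' = l[of a b e, OF x[unfolded abe]]
    have l1: "l b \<ge> 1" using l' by (simp add: prime_gt_0_nat Suc_le_eq)
    note i' = ii[OF l1]
    obtain v where v: "b = l b * v" using l' by blast
    have bv: "b div l b = v" using v l1 by (metis One_nat_def Suc_le_eq nonzero_mult_div_cancel_left not_gr_zero)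
    have "b \<noteq> 0" using t unfolding near_products_def by auto
    then have v1: "v \<ge> 1" using v by (cases v) auto
    have "ii (l b) \<in> I" unfolding I_def mem_Collect_eq using l' i' by (intro conjI) linarith+
    moreover have "(l b * a, v, e) \<in> near_products \<alpha> (2 ^ (ii (l b) + 1) * A) (B / 2 ^ ii (l b)) (\<kappa> * \<eta>)"
    proof -
      have "real (l b * a) \<le> 2 ^ (ii (l b) + 1) * A" unfolding of_nat_mult using i' t A unfolding near_products_def by (intro mult_mono) auto
      moreover have "2 ^ ii (l b) * real v \<le> B"
      proof -
        have "2 ^ ii (l b) * real v \<le> real (l b) * real v" using i' by (intro mult_right_mono) auto
        also have "\<dots> = real b" using v by (metis of_nat_mult)
        finally show ?thesis using t unfolding near_products_def by auto
      qed
      then have "real v \<le> B / 2 ^ ii (l b)" by (simp add: field_simps)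
      moreover have "l b * a * v = a * b" using v by (metis mult.assoc mult.commute)
      then have "0 < \<bar>\<alpha> * real (l b * a * v) - real_of_int e\<bar> \<and> \<bar>\<alpha> * real (l b * a * v) - real_of_int e\<bar> \<le> \<kappa> * \<eta>"
        using t unfolding near_products_def by (simp only: mem_Collect_eq prod.case)
      moreover have "1 \<le> l b * a" using l1 t unfolding near_products_def by auto
      ultimately show ?thesis using t v1 unfolding near_products_def by auto
    qed
    ultimately show "f x \<in> ?S" unfolding f_def abe using bv by simp
  qed
  have fib: "real (card {x \<in> ?T. f x = w}) \<le> real k'" if w: "w \<in> f ` ?T" for w
  proof -
    obtain i n v e where wi: "w = (i, n, v, e)" by (cases w)
    obtain x0 where x0: "x0 \<in> ?T" "f x0 = w" using w by auto
    obtain a0 b0 e0 where abe0: "x0 = (a0, b0, e0)" by (cases x0)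
    have n0: "n = l b0 * a0" using x0 abe0 wi unfolding f_def by auto
    \<comment> \<open>a0 has fewer than k' primes in the range and the moved prime adds at most one,
      so k' itself is the bound.\<close>
    have "omega_in P z n \<le> omega_in P z a0 + 1" unfolding n0 using l[of a0 b0 e0] x0 abe0 by (intro omega_in_times_prime) auto
    also have "\<dots> \<le> k'" using x0 abe0 by auto
    finally have om: "omega_in P z n \<le> k'" .
    let ?F = "{x \<in> ?T. f x = w}"
    have "card ?F = card ((\<lambda>(a, b, e). l b) ` ?F)"
    proof (rule card_image[symmetric], rule inj_onI)
      fix x y assume xy: "x \<in> ?F" "y \<in> ?F" "(case x of (a, b, e) \<Rightarrow> l b) = (case y of (a, b, e) \<Rightarrow> l b)"
      obtain a b e a' b' e' where ww: "x = (a, b, e)" "y = (a', b', e')" by (cases x, cases y)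
      have ll: "l b = l b'" using xy ww by simp
      have pl: "l b > 0" "l b dvd b" "l b' dvd b'" using l[of a b e] l[of a' b' e'] xy ww by (auto simp: prime_gt_0_nat)
      have eqs: "l b * a = n" "b div l b = v" "e' = e" "l b' * a' = n" "b' div l b' = v"
        using xy ww wi unfolding f_def by auto
      have "a = a'" using eqs ll pl by (metis mult_left_cancel not_gr_zero)
      moreover have "b = b'" using eqs ll pl by (metis dvd_div_mult_self)
      ultimately show "x = y" using ww eqs by simp
    qed
    also have "\<dots> \<le> card {p. prime p \<and> P < real p \<and> real p \<le> z \<and> p dvd n}"
    proof (rule card_mono)
      show "finite {p. prime p \<and> P < real p \<and> real p \<le> z \<and> p dvd n}" by (rule finite_subset[OF _ finite_nat_le_real[of z]]) auto
      show "(\<lambda>(a, b, e). l b) ` ?F \<subseteq> {p. prime p \<and> P < real p \<and> real p \<le> z \<and> p dvd n}"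
      proof (rule image_subsetI)
        fix x assume x: "x \<in> ?F"
        obtain a b e where abe: "x = (a, b, e)" by (cases x)
        have "l b * a = n" using x abe wi unfolding f_def by auto
        then show "(case x of (a, b, e) \<Rightarrow> l b) \<in> {p. prime p \<and> P < real p \<and> real p \<le> z \<and> p dvd n}"
          using l[of a b e] x abe by auto
      qed
    qed
    also have "\<dots> = omega_in P z n" by (simp add: omega_in_def)
    finally show ?thesis using om by simp
  qed
  \<comment> \<open>The box has area at most 2 \<kappa> N^2, and its second side is below 2 B / P,
    which makes the multiplicity term cheap.\<close>
  have each: "real (card (near_products \<alpha> (2 ^ (i + 1) * A) (B / 2 ^ i) (\<kappa> * \<eta>))) \<le> ?R" if i: "i \<in> I" for i
  proof -
    let ?Sb = "{b::nat. 1 \<le> b \<and> real b \<le> B / 2 ^ i}"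
    have "real (card (near_products \<alpha> (2 ^ (i + 1) * A) (B / 2 ^ i) (\<kappa> * \<eta>))) \<le> 2 * J * real (card ?Sb) + 20 * \<kappa>\<^sup>2 * W
      + rec_const r * C * (\<kappa> powr (1 + 1/5) * J powr (- (1/5)) + \<epsilon> * \<kappa> powr (1 + r)) * W"
      by (subst near_products_fibre_conv, rule near_products_recursion[OF r k J]) (use A B AB C eps IH in \<open>auto simp: field_simps\<close>)
    moreover have "2 * J * real (card ?Sb) \<le> 4 * J * B / P"
    proof -
      have "?Sb \<subseteq> {1..nat \<lfloor>B / 2 ^ i\<rfloor>}" by (auto simp: le_nat_floor)
      then have "card ?Sb \<le> nat \<lfloor>B / 2 ^ i\<rfloor>" using card_mono[of "{1..nat \<lfloor>B / 2 ^ i\<rfloor>}" ?Sb] by simp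
      moreover have "real (nat \<lfloor>B / 2 ^ i\<rfloor>) \<le> B / 2 ^ i" using B by simp
      ultimately have "real (card ?Sb) \<le> B / 2 ^ i" by linarith
      also have "\<dots> \<le> B / (P / 2)" using i B P unfolding I_def by (intro divide_left_mono) auto
      finally have "real (card ?Sb) \<le> 2 * B / P" by (simp add: mult.commute)
      then have "2 * J * real (card ?Sb) \<le> 2 * J * (2 * B / P)" using J by (intro mult_left_mono) auto
      then show ?thesis by simp
    qed
    ultimately show ?thesis by linarith
  qed
  have R0: "?R \<ge> 0"
  proof -
    have "rec_const r \<ge> 0" using rec_const_ge[OF r(1)] by simp
    then show ?thesis using J B P W_pos C eps by (intro add_nonneg_nonneg mult_nonneg_nonneg divide_nonneg_nonneg) auto
  qed
  have "real (card ?T) \<le> real (card (f ` ?T)) * real k'" by (rule card_le_fibres[OF finT fib])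
  also have "\<dots> \<le> ((log 2 z + 1) * ?R) * real k'"
  proof (rule mult_right_mono)
    have "card (f ` ?T) \<le> card ?S" by (rule card_mono[OF _ sub]) (intro finite_SigmaI finI finite_near_products)
    then have "real (card (f ` ?T)) \<le> (\<Sum>i\<in>I. real (card (near_products \<alpha> (2 ^ (i + 1) * A) (B / 2 ^ i) (\<kappa> * \<eta>))))"
      using finI by (subst (asm) card_SigmaI) (auto simp: finite_near_products simp flip: of_nat_sum)
    also have "\<dots> \<le> real (card I) * ?R" by (rule sum_bounded_above) (rule each)
    also have "\<dots> \<le> (log 2 z + 1) * ?R" by (rule mult_right_mono[OF cardI R0])
    finally show "real (card (f ` ?T)) \<le> (log 2 z + 1) * ?R" .
  qed simp
  finally show ?thesis by (simp add: mult_ac)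
qed

end

text \<open>The cut-offs of the induction step are \<open>J = \<kappa>\<^bsup>-1/50\<^esup>\<close> for lattice multiplicities and for the number
  of prime factors, \<open>\<kappa>\<^bsup>-4\<^esup>\<close> for lattice multiplicities after moving a prime, and \<open>\<kappa>\<^bsup>-8\<^esup>\<close> as the lower
  end of the range of the moved primes.\<close>

definition small_scale :: "real \<Rightarrow> real \<Rightarrow> nat \<Rightarrow> real \<Rightarrow> bool" where
  "small_scale K L m \<kappa> \<longleftrightarrow> \<kappa> \<le> 1/2 \<and> 8 \<le> \<kappa> powr (-1/50) \<and>
     K * (\<kappa> powr (-1/50)) powr (- (1/5)) \<le> 1/40 \<and> K * \<kappa> ^ 3 \<le> \<kappa> powr (1 + 1/5) / 40 \<and> 20 * \<kappa>\<^sup>2 \<le> \<kappa> powr (1 + 1/5) \<and>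
     136 * \<kappa> powr (-51/50) * (1 + \<kappa> powr (-3/4)) * 2 powr (- (\<kappa> powr (-1/50))) \<le> \<kappa> powr (1 + 1/5) \<and>
     (\<kappa> powr (-1/50) + 1) * (2 * \<kappa> powr (-3/4) + 1) * (8 * \<kappa> ^ 3 + 20 * \<kappa>\<^sup>2) \<le> \<kappa> powr (1 + 1/5) \<and>
     (\<kappa> powr (-1/50) + 1) * (2 * \<kappa> powr (-3/4) + 1) * (K * (\<kappa> powr (1 + 1/5) * (\<kappa> powr (-4)) powr (- (1/5)) + \<kappa> ^ 3)) \<le> \<kappa> powr (1 + 1/5) / 20 \<and>
     2040 * \<kappa> powr (123/100) * (1 - 8 * ln \<kappa>) \<le> \<kappa> powr (1 + 1/5) \<and>
     L * (1 - 8 * ln \<kappa>) ^ m * (2 * \<kappa>\<^sup>2) \<le> \<kappa> powr (1 + 1/5)"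

lemma eventually_small_scale:
  assumes K: "K > 0" and L: "L > 0" and m: "m > 0"
  shows "eventually (small_scale K L m) (at_right 0)"
proof -
  have 1: "\<forall>\<^sub>F \<kappa> in at_right (0::real). \<kappa> \<le> 1/2" by real_asymp
  have 2: "\<forall>\<^sub>F \<kappa> in at_right (0::real). 8 \<le> \<kappa> powr (-1/50)" by real_asymp
  have 3: "\<forall>\<^sub>F \<kappa> in at_right (0::real). K * (\<kappa> powr (-1/50)) powr (- (1/5)) \<le> 1/40" using K by real_asymp
  have 4: "\<forall>\<^sub>F \<kappa> in at_right (0::real). K * \<kappa> ^ 3 \<le> \<kappa> powr (1 + 1/5) / 40" using K by real_asymp
  have 5: "\<forall>\<^sub>F \<kappa> in at_right (0::real). 20 * \<kappa>\<^sup>2 \<le> \<kappa> powr (1 + 1/5)" by real_asymp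
  have 6: "\<forall>\<^sub>F \<kappa> in at_right (0::real). 136 * \<kappa> powr (-51/50) * (1 + \<kappa> powr (-3/4)) * 2 powr (- (\<kappa> powr (-1/50))) \<le> \<kappa> powr (1 + 1/5)"
    by real_asymp
  have 7: "\<forall>\<^sub>F \<kappa> in at_right (0::real). (\<kappa> powr (-1/50) + 1) * (2 * \<kappa> powr (-3/4) + 1) * (8 * \<kappa> ^ 3 + 20 * \<kappa>\<^sup>2) \<le> \<kappa> powr (1 + 1/5)"
    by real_asymp
  have 8: "\<forall>\<^sub>F \<kappa> in at_right (0::real). (\<kappa> powr (-1/50) + 1) * (2 * \<kappa> powr (-3/4) + 1) * (K * (\<kappa> powr (1 + 1/5) * (\<kappa> powr (-4)) powr (- (1/5)) + \<kappa> ^ 3)) \<le> \<kappa> powr (1 + 1/5) / 20"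
    using K by real_asymp
  have 9: "\<forall>\<^sub>F \<kappa> in at_right (0::real). 2040 * \<kappa> powr (123/100) * (1 - 8 * ln \<kappa>) \<le> \<kappa> powr (1 + 1/5)" by real_asymp
  \<comment> \<open>With q m = 1/10 the m-th power of the logarithm costs only \<kappa>^(-1/10), and
    2 - 1/10 still exceeds 6/5.\<close>
  define q where "q = 1 / (10 * real m)"
  have q: "q > 0" unfolding q_def using m by simp
  have 10: "\<forall>\<^sub>F \<kappa> in at_right (0::real). 1 - 8 * ln \<kappa> \<le> \<kappa> powr (- q)" using q by real_asymp
  have 11: "\<forall>\<^sub>F \<kappa> in at_right (0::real). 1 - 8 * ln \<kappa> \<ge> 0" by real_asymp
  have 12: "\<forall>\<^sub>F \<kappa> in at_right (0::real). L * \<kappa> powr (- (1/10)) * (2 * \<kappa>\<^sup>2) \<le> \<kappa> powr (1 + 1/5)" using L by real_asymp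
  have 0: "\<forall>\<^sub>F \<kappa> in at_right (0::real). \<kappa> > 0" by (rule eventually_at_right_less)
  show ?thesis using 0 1 2 3 4 5 6 7 8 9 10 11 12
  proof eventually_elim
    case (elim \<kappa>)
    have "(1 - 8 * ln \<kappa>) ^ m \<le> (\<kappa> powr (- q)) ^ m" using elim by (intro power_mono) auto
    also have "\<dots> = \<kappa> powr (- (1/10))" using elim m by (simp add: powr_power q_def)
    finally have "L * (1 - 8 * ln \<kappa>) ^ m * (2 * \<kappa>\<^sup>2) \<le> L * \<kappa> powr (- (1/10)) * (2 * \<kappa>\<^sup>2)"
      using L by (intro mult_right_mono mult_left_mono) auto
    also have "\<dots> \<le> \<kappa> powr (1 + 1/5)" using elim by simp
    finally show ?case unfolding small_scale_def using elim by blast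
  qed
qed

lemma nat_Icc_real: "{a::nat. 1 \<le> a \<and> real a \<le> X} = {1..nat \<lfloor>X\<rfloor>}"
proof -
  have "real a \<le> X \<longleftrightarrow> a \<le> nat \<lfloor>X\<rfloor>" if "1 \<le> a" for a :: nat using that by linarith
  then show ?thesis by auto
qed

section \<open>The induction step\<close>

context equidistributed_bohr
begin

lemma claim_upto_mono: "claim_upto C \<epsilon> r x \<Longrightarrow> y \<le> x \<Longrightarrow> claim_upto C \<epsilon> r y"
  unfolding claim_upto_def by force

text \<open>For B \<le> \<kappa>^(61/50) N the term 2 J B is small enough. Otherwise there are five
  classes of triples: many primes from (P, z] in b or in a, a movable prime in b or in a, no such
  prime in either. Each class takes at most C u W / 20 from the induction hypothesis, and together
  they add at most 8 u W. So C reproduces itself exactly, as it must, because the step is repeated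
  at every doubling of \<kappa>.\<close>

lemma near_products_step_ordered:
  assumes r: "0 < r" "r \<le> 1/5" and k: "\<kappa> > 0" and A: "A > 0" and B: "B > 0" and AB: "A * B \<le> \<kappa> * N\<^sup>2" and BA: "B \<le> A"
    and C: "C \<ge> 100" and eps: "0 \<le> \<epsilon>" "\<epsilon> \<le> \<kappa>\<^sup>2" and Nc: "N powr (- (c / 2)) \<le> \<kappa>" and j: "4 \<le> c * 2 ^ j"
    and N9: "N \<ge> 9" and NB: "sqrt N + 1 \<le> \<kappa> powr (61/50) * N"
    and small_scale: "small_scale (rec_const r) (div_const j) (2 ^ (2 ^ j)) \<kappa>" and IH: "claim_upto C \<epsilon> r (\<kappa> / 2)"
  shows "real (card (near_products \<alpha> A B (\<kappa> * \<eta>))) \<le> C * \<kappa> powr (1 + 1/5) * W"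
proof -
  define u where "u = \<kappa> powr (1 + 1/5)"
  define J where "J = \<kappa> powr (-1/50)"
  define K where "K = rec_const r"
  have K: "K > 0" unfolding K_def using rec_const_ge[OF r(1)] by simp
  have ty: "\<kappa> \<le> 1/2" "8 \<le> J" "K * J powr (- (1/5)) \<le> 1/40" "K * \<kappa> ^ 3 \<le> u / 40" "20 * \<kappa>\<^sup>2 \<le> u"
    "136 * \<kappa> powr (-51/50) * (1 + \<kappa> powr (-3/4)) * 2 powr (- J) \<le> u"
    "(J + 1) * (2 * \<kappa> powr (-3/4) + 1) * (8 * \<kappa> ^ 3 + 20 * \<kappa>\<^sup>2) \<le> u"
    "(J + 1) * (2 * \<kappa> powr (-3/4) + 1) * (K * (u * (\<kappa> powr (-4)) powr (- (1/5)) + \<kappa> ^ 3)) \<le> u / 20"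
    "2040 * \<kappa> powr (123/100) * (1 - 8 * ln \<kappa>) \<le> u"
    "div_const j * (1 - 8 * ln \<kappa>) ^ (2 ^ (2 ^ j)) * (2 * \<kappa>\<^sup>2) \<le> u"
    using small_scale unfolding small_scale_def u_def J_def K_def by blast+
  have k1: "\<kappa> \<le> 1/2" "\<kappa> \<le> 1" using ty(1) by auto
  have u0: "u > 0" unfolding u_def using k by simp
  have W0: "W > 0" by (rule W_pos)
  have uW: "u * W > 0" using u0 W0 by simp
  have J8: "J \<ge> 8" by (rule ty(2))
  have C0: "C \<ge> 0" using C by simp
  have IHJ: "claim_upto C \<epsilon> r (4 * \<kappa> / J')" if "J' \<ge> 8" for J'
  proof (rule claim_upto_mono[OF IH])
    have "4 * \<kappa> / J' \<le> 4 * \<kappa> / 8" using that k by (intro divide_left_mono) auto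
    then show "4 * \<kappa> / J' \<le> \<kappa> / 2" by simp
  qed
  \<comment> \<open>In this range \<epsilon> \<le> \<kappa>^2, so the secondary term falls to
    \<kappa>^3 and is absorbed; the conclusion is free of \<epsilon>.\<close>
  have epsk: "\<epsilon> * \<kappa> powr (1 + r) \<le> \<kappa> ^ 3"
  proof -
    have "\<kappa> powr (1 + r) \<le> \<kappa> powr 1" using k k1 r by (intro powr_mono') auto
    then have "\<epsilon> * \<kappa> powr (1 + r) \<le> \<kappa>\<^sup>2 * \<kappa>" using eps k by (intro mult_mono) auto
    then show ?thesis by (simp add: power2_eq_square power3_eq_cube)
  qed
  have rec: "K * C * (u * J' powr (- (1/5)) + \<epsilon> * \<kappa> powr (1 + r)) * W \<le> C * W * (K * (u * J' powr (- (1/5)) + \<kappa> ^ 3))" for J'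
  proof -
    have "K * C * (u * J' powr (- (1/5)) + \<epsilon> * \<kappa> powr (1 + r)) * W \<le> K * C * (u * J' powr (- (1/5)) + \<kappa> ^ 3) * W"
      using epsk K C0 W0 by (intro mult_right_mono mult_left_mono add_left_mono) auto
    then show ?thesis by (simp add: mult_ac)
  qed
  have rec1: "K * C * (u * J powr (- (1/5)) + \<epsilon> * \<kappa> powr (1 + r)) * W \<le> C * (u * W) / 20"
  proof -
    have "u * (K * J powr (- (1/5))) \<le> u * (1/40)" using ty(3) u0 by (intro mult_left_mono) auto
    moreover have "K * \<kappa> ^ 3 \<le> u / 40" by (rule ty(4))
    ultimately have "K * (u * J powr (- (1/5)) + \<kappa> ^ 3) \<le> u / 20" by (simp add: algebra_simps)
    then have "C * W * (K * (u * J powr (- (1/5)) + \<kappa> ^ 3)) \<le> C * W * (u / 20)" using C0 W0 by (intro mult_left_mono) auto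
    moreover have "C * W * (u / 20) = C * (u * W) / 20" by simp
    ultimately show ?thesis using rec[of J] by linarith
  qed
  have k2: "20 * \<kappa>\<^sup>2 * W \<le> u * W" using ty(5) W0 by (intro mult_right_mono) auto
  have lat: "real (card {(a, b, e). (a, b, e) \<in> near_products \<alpha> X Y (\<kappa> * \<eta>) \<and> b \<in> Sb}) \<le> 2 * J * real (card Sb) + u * W + C * (u * W) / 20"
    if "X > 0" "Y > 0" "X * Y \<le> \<kappa> * N\<^sup>2" "Sb \<subseteq> {b. 1 \<le> b \<and> real b \<le> Y}" for X Y Sb
  proof -
    have "0 \<le> \<kappa> * N\<^sup>2" "2 * \<kappa> * N\<^sup>2 = \<kappa> * N\<^sup>2 + \<kappa> * N\<^sup>2" using k by auto
    then have XY2: "X * Y \<le> 2 * \<kappa> * N\<^sup>2" using that(3) by linarith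
    have J1: "J \<ge> 1" using J8 by simp
    have "real (card {(a, b, e). (a, b, e) \<in> near_products \<alpha> X Y (\<kappa> * \<eta>) \<and> b \<in> Sb}) \<le> 2 * J * real (card Sb) + 20 * \<kappa>\<^sup>2 * W
      + rec_const r * C * (\<kappa> powr (1 + 1/5) * J powr (- (1/5)) + \<epsilon> * \<kappa> powr (1 + r)) * W"
      by (rule near_products_recursion[OF r k J1 that(1,2) XY2 C0 eps(1) IHJ[OF J8] that(4)])
    then show ?thesis using rec1 k2 unfolding K_def[symmetric] u_def[symmetric] by linarith
  qed
  have cardle: "real (card {b::nat. 1 \<le> b \<and> real b \<le> Y}) \<le> Y" if "Y > 0" for Y
    unfolding nat_Icc_real using that by simp
  show ?thesis
  \<comment> \<open>61/50 = 6/5 + 1/50, and the extra 1/50 pays for J = \<kappa>^(-1/50).\<close>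
  proof (cases "B \<le> \<kappa> powr (61/50) * N")
    case True
    let ?Sb = "{b::nat. 1 \<le> b \<and> real b \<le> B}"
    have "2 * J * real (card ?Sb) \<le> 2 * J * (\<kappa> powr (61/50) * N)"
      using cardle[OF B] True J8 by (intro mult_left_mono) auto
    also have "\<dots> = 2 * u * N" unfolding J_def u_def using k by (simp add: powr_add[symmetric])
    also have "\<dots> \<le> 2 * u * (2 * W)" using NW u0 by (intro mult_left_mono) auto
    finally have "2 * J * real (card ?Sb) \<le> 4 * (u * W)" by simp
    moreover have "card (near_products \<alpha> A B (\<kappa> * \<eta>)) = card {(a, b, e). (a, b, e) \<in> near_products \<alpha> A B (\<kappa> * \<eta>) \<and> b \<in> ?Sb}"
      by (rule arg_cong[where f = card, OF near_products_fibre_conv])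
    ultimately have "real (card (near_products \<alpha> A B (\<kappa> * \<eta>))) \<le> 5 * (u * W) + C * (u * W) / 20"
      using lat[OF A B AB order_refl] by linarith
    also have "\<dots> \<le> C * (u * W)"
    proof -
      have "100 * (u * W) \<le> C * (u * W)" using C uW by (intro mult_right_mono) auto
      then show ?thesis using uW by linarith
    qed
    finally show ?thesis unfolding u_def by (simp add: mult.assoc)
  next
    case False
    define P where "P = \<kappa> powr (-8)"
    have P1: "P \<ge> 1" unfolding P_def using powr_mono'[of "-8" 0 \<kappa>] k k1 by simp
    have lnP: "1 + ln P = 1 - 8 * ln \<kappa>" unfolding P_def using k by (simp add: ln_powr)
    have Bk: "B \<le> \<kappa> powr (1/2) * N"
    proof -
      have "B * B \<le> A * B" using BA B by (intro mult_right_mono) auto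
      then have "B\<^sup>2 \<le> \<kappa> * N\<^sup>2" using AB unfolding power2_eq_square[of B] by linarith
      then have "sqrt (B\<^sup>2) \<le> sqrt (\<kappa> * N\<^sup>2)" by (rule real_sqrt_le_mono)
      then show ?thesis using B N3 k by (simp add: real_sqrt_mult powr_half_sqrt)
    qed
    \<comment> \<open>The lower bound on B becomes an upper bound on A. The crude N / \<kappa> is
      enough, because it only meets the factors 2^(-J) and 1 / P.\<close>
    have Ak: "A \<le> N / \<kappa>"
    proof -
      have "A * (\<kappa> powr (61/50) * N) \<le> A * B" using False A by (intro mult_left_mono) auto
      then have "N * (A * \<kappa> powr (61/50)) \<le> N * (\<kappa> * N)" using AB by (simp add: power2_eq_square mult_ac)
      then have "A * \<kappa> powr (61/50) \<le> \<kappa> * N" using N3 by simp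
      moreover have "\<kappa>\<^sup>2 \<le> \<kappa> powr (61/50)" using powr_mono'[of "61/50" 2 \<kappa>] k k1 by simp
      then have "A * \<kappa>\<^sup>2 \<le> A * \<kappa> powr (61/50)" using A by (intro mult_left_mono) auto
      ultimately have "\<kappa> * (A * \<kappa>) \<le> \<kappa> * N" by (simp add: power2_eq_square mult_ac)
      then show ?thesis using k by (simp add: field_simps)
    qed
    have Bk': "B \<le> N / \<kappa>" using Ak BA by simp
    \<comment> \<open>The cap ln N / 2 keeps z at most sqrt N, hence below B as the sieve requires;
      where it is attained, z^4 = N^2.\<close>
    define lz where "lz = min (\<kappa> powr (-3/4)) (ln N / 2)"
    define z where "z = exp lz"
    have lnN: "ln N > 0" using N9 by simp
    have lz0: "lz > 0" unfolding lz_def using k lnN by simp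
    have z1: "z > 1" "ln z = lz" unfolding z_def using lz0 by auto
    have lzk: "lz \<le> \<kappa> powr (-3/4)" unfolding lz_def by simp
    have zN: "z \<le> sqrt N"
    proof -
      have "z \<le> exp (ln N / 2)" unfolding z_def lz_def by simp
      also have "\<dots> = sqrt N" using N9 powr_half_sqrt[of N] by (simp add: powr_def)
      finally show ?thesis .
    qed
    define k' where "k' = nat \<lceil>J\<rceil>"
    have k': "J \<le> real k'" "real k' \<le> J + 1" unfolding k'_def using J8 by linarith+
    have kinv: "\<kappa> powr (-1) = 1 / \<kappa>" using k powr_minus_divide[of \<kappa> 1] by simp
    have Jk: "J / \<kappa> = \<kappa> powr (-51/50)"
    proof -
      have "J / \<kappa> = J * \<kappa> powr (-1)" unfolding kinv by simp
      also have "\<dots> = \<kappa> powr (-51/50)" unfolding J_def powr_add[symmetric] by simp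
      finally show ?thesis .
    qed
    have gen: "2 * J * ((N / \<kappa>) * (34 * p) * q) = 68 * (J / \<kappa>) * p * q * N" for p q by simp
    have gen2: "68 * p * q * s * (2 * W) = (136 * p * q * s) * W" for p q s by simp
    \<comment> \<open>At least k' \<ge> J primes in the range occur with density at most 34 (1 + ln
      z) 2^(-J), which beats every power of \<kappa>.\<close>
    have omega: "2 * J * real (card {a::nat. 1 \<le> a \<and> real a \<le> X \<and> k' \<le> omega_in P z a}) \<le> u * W" if X: "X > 0" "X \<le> N / \<kappa>" for X
    proof -
      have set: "{a::nat. 1 \<le> a \<and> real a \<le> X \<and> k' \<le> omega_in P z a} = {a\<in>{1..nat \<lfloor>X\<rfloor>}. k' \<le> omega_in P z a}"
        unfolding nat_Icc_real[of X, symmetric] by auto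
      let ?n = "real (card {a::nat. 1 \<le> a \<and> real a \<le> X \<and> k' \<le> omega_in P z a})"
      have "2 ^ k' * ?n \<le> real (nat \<lfloor>X\<rfloor>) * smooth_sum z (nat \<lfloor>X\<rfloor>)"
        unfolding set by (rule many_prime_divisors_card_le)
      also have "\<dots> \<le> (N / \<kappa>) * (34 * (1 + ln z))"
      proof (rule mult_mono)
        show "real (nat \<lfloor>X\<rfloor>) \<le> N / \<kappa>" using X by linarith
        show "smooth_sum z (nat \<lfloor>X\<rfloor>) \<le> 34 * (1 + ln z)" using z1 by (intro smooth_sum_le) simp
        show "0 \<le> N / \<kappa>" using X by linarith
      qed (rule smooth_sum_nonneg)
      also have "\<dots> \<le> (N / \<kappa>) * (34 * (1 + \<kappa> powr (-3/4)))"
        using z1 lzk N3 k by (intro mult_left_mono) auto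
      finally have n: "2 ^ k' * ?n \<le> (N / \<kappa>) * (34 * (1 + \<kappa> powr (-3/4)))" .
      have "2 powr J \<le> 2 powr real k'" using k' by simp
      then have "2 powr J * ?n \<le> 2 ^ k' * ?n" by (intro mult_right_mono) (auto simp: powr_realpow)
      then have "2 powr J * ?n * 2 powr (- J) \<le> (N / \<kappa>) * (34 * (1 + \<kappa> powr (-3/4))) * 2 powr (- J)"
        using n by (intro mult_right_mono) auto
      moreover have "2 powr J * ?n * 2 powr (- J) = ?n" by (simp add: powr_minus)
      ultimately have "?n \<le> (N / \<kappa>) * (34 * (1 + \<kappa> powr (-3/4))) * 2 powr (- J)" by linarith
      then have "2 * J * ?n \<le> 2 * J * ((N / \<kappa>) * (34 * (1 + \<kappa> powr (-3/4))) * 2 powr (- J))"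
        using J8 by (intro mult_left_mono) auto
      also have "\<dots> = 68 * (J / \<kappa>) * (1 + \<kappa> powr (-3/4)) * 2 powr (- J) * N" by (rule gen)
      also have "\<dots> = 68 * \<kappa> powr (-51/50) * (1 + \<kappa> powr (-3/4)) * 2 powr (- J) * N" by (simp only: Jk)
      also have "\<dots> \<le> 68 * \<kappa> powr (-51/50) * (1 + \<kappa> powr (-3/4)) * 2 powr (- J) * (2 * W)"
        by (rule mult_left_mono[OF NW]) (intro mult_nonneg_nonneg add_nonneg_nonneg, auto)
      also have "\<dots> = (136 * \<kappa> powr (-51/50) * (1 + \<kappa> powr (-3/4)) * 2 powr (- J)) * W" by (rule gen2)
      also have "\<dots> \<le> u * W" using ty(6) W0 by (intro mult_right_mono) auto
      finally show ?thesis .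
    qed
    have many: "real (card {(a, b, e). (a, b, e) \<in> near_products \<alpha> X Y (\<kappa> * \<eta>) \<and> b \<in> {b. 1 \<le> b \<and> real b \<le> Y \<and> k' \<le> omega_in P z b}}) \<le> 2 * (u * W) + C * (u * W) / 20"
      if "X > 0" "Y > 0" "X * Y \<le> \<kappa> * N\<^sup>2" "Y \<le> N / \<kappa>" for X Y
    proof -
      have "{b. 1 \<le> b \<and> real b \<le> Y \<and> k' \<le> omega_in P z b} \<subseteq> {b. 1 \<le> b \<and> real b \<le> Y}" by blast
      from lat[OF that(1-3) this] omega[OF that(2,4)] show ?thesis by linarith
    qed
    \<comment> \<open>After the move a larger cut-off is affordable: J2^(-1/5) = \<kappa>^(4/5)
      outweighs the loss of order J \<kappa>^(-3/4) from the choices of the prime. In turn P =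
      \<kappa>^(-8) is large enough for J2 (N / \<kappa>) / P = \<kappa>^3 N.\<close>
    define J2 where "J2 = \<kappa> powr (-4)"
    have J2J: "J2 \<ge> J" unfolding J_def J2_def using k k1 by (intro powr_mono') auto
    have gen3: "g * (w * x + c * w * y) = w * (g * x) + c * w * (g * y)" for g w x c y :: real by (simp add: algebra_simps)
    have J2k: "J2 * (1 / \<kappa>) / P = \<kappa> ^ 3"
    proof -
      have "1 / P = \<kappa> powr 8" unfolding P_def using k powr_minus_divide[of \<kappa> 8] by simp
      moreover have "J2 * (1 / \<kappa>) / P = J2 * (1 / \<kappa>) * (1 / P)" by simp
      ultimately have "J2 * (1 / \<kappa>) / P = \<kappa> powr (-4) * \<kappa> powr (-1) * \<kappa> powr 8" unfolding J2_def kinv by simp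
      also have "\<dots> = \<kappa> powr 3" unfolding powr_add[symmetric] by simp
      finally show ?thesis using k by simp
    qed
    have shift: "real (card {(a, b, e). (a, b, e) \<in> near_products \<alpha> X Y (\<kappa> * \<eta>) \<and> (\<exists>l. prime l \<and> P < real l \<and> real l \<le> z \<and> l dvd b) \<and> omega_in P z a < k'})
       \<le> u * W + C * (u * W) / 20" if XY: "X > 0" "Y > 0" "X * Y \<le> \<kappa> * N\<^sup>2" "Y \<le> N / \<kappa>" for X Y
    proof -
      let ?G = "(J + 1) * (2 * \<kappa> powr (-3/4) + 1)"
      have "real (card {(a, b, e). (a, b, e) \<in> near_products \<alpha> X Y (\<kappa> * \<eta>) \<and> (\<exists>l. prime l \<and> P < real l \<and> real l \<le> z \<and> l dvd b) \<and> omega_in P z a < k'})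
        \<le> real k' * (log 2 z + 1) * (4 * J2 * Y / P + 20 * \<kappa>\<^sup>2 * W + rec_const r * C * (\<kappa> powr (1 + 1/5) * J2 powr (- (1/5)) + \<epsilon> * \<kappa> powr (1 + r)) * W)"
        by (rule near_products_prime_shift[OF r k _ XY(1-3) C0 eps(1) IHJ P1]) (use J8 J2J z1 in linarith)+
      also have "\<dots> \<le> ?G * (W * (8 * \<kappa> ^ 3 + 20 * \<kappa>\<^sup>2) + C * W * (K * (u * J2 powr (- (1/5)) + \<kappa> ^ 3)))"
      proof (rule mult_mono)
        show "real k' * (log 2 z + 1) \<le> ?G"
        proof (rule mult_mono)
          have "log 2 z = lz / ln 2" using z1 by (simp add: log_def)
          also have "\<dots> \<le> lz / (1/2)" using lz0 ln2_ge_two_thirds by (intro divide_left_mono) auto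
          finally show "log 2 z + 1 \<le> 2 * \<kappa> powr (-3/4) + 1" using lzk by simp
          show "0 \<le> log 2 z + 1" using z1 by (simp add: add_nonneg_nonneg)
        qed (use k' J8 in auto)
        have "4 * J2 * Y / P \<le> 4 * J2 * (N / \<kappa>) / P" using XY J8 J2J P1 by (intro divide_right_mono mult_left_mono) auto
        also have "\<dots> = 4 * (J2 * (1 / \<kappa>) / P) * N" by simp
        also have "\<dots> = 4 * \<kappa> ^ 3 * N" unfolding J2k ..
        also have "\<dots> \<le> 4 * \<kappa> ^ 3 * (2 * W)" using NW k by (intro mult_left_mono) auto
        finally have "4 * J2 * Y / P \<le> W * (8 * \<kappa> ^ 3)" by (simp add: mult_ac)
        moreover have "W * (8 * \<kappa> ^ 3 + 20 * \<kappa>\<^sup>2) = W * (8 * \<kappa> ^ 3) + 20 * \<kappa>\<^sup>2 * W" by (simp add: distrib_left mult_ac)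
        ultimately show "4 * J2 * Y / P + 20 * \<kappa>\<^sup>2 * W + rec_const r * C * (\<kappa> powr (1 + 1/5) * J2 powr (- (1/5)) + \<epsilon> * \<kappa> powr (1 + r)) * W
           \<le> W * (8 * \<kappa> ^ 3 + 20 * \<kappa>\<^sup>2) + C * W * (K * (u * J2 powr (- (1/5)) + \<kappa> ^ 3))"
          using rec[of J2] unfolding K_def[symmetric] u_def[symmetric] by linarith
        show "0 \<le> ?G" using J8 by (intro mult_nonneg_nonneg add_nonneg_nonneg) auto
        have "J2 \<ge> 0" "rec_const r \<ge> 0" using J8 J2J rec_const_ge[OF r(1)] by auto
        then show "0 \<le> 4 * J2 * Y / P + 20 * \<kappa>\<^sup>2 * W + rec_const r * C * (\<kappa> powr (1 + 1/5) * J2 powr (- (1/5)) + \<epsilon> * \<kappa> powr (1 + r)) * W"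
          using XY P1 W0 C0 eps by (intro add_nonneg_nonneg mult_nonneg_nonneg divide_nonneg_nonneg) auto
      qed
      also have "\<dots> = W * (?G * (8 * \<kappa> ^ 3 + 20 * \<kappa>\<^sup>2)) + C * W * (?G * (K * (u * J2 powr (- (1/5)) + \<kappa> ^ 3)))"
        by (rule gen3)
      also have "\<dots> \<le> W * u + C * W * (u / 20)"
        using ty(7,8) W0 C0 unfolding J2_def by (intro add_mono mult_left_mono) auto
      also have "\<dots> = u * W + C * (u * W) / 20" by simp
      finally show ?thesis .
    qed
    let ?no = "\<lambda>a. \<forall>l. prime l \<longrightarrow> l dvd a \<longrightarrow> \<not> (P < real l \<and> real l \<le> z)"
    have rest: "real (card {(a, b, e). (a, b, e) \<in> near_products \<alpha> A B (\<kappa> * \<eta>) \<and> ?no a \<and> ?no b}) \<le> 2 * (u * W) + C * (u * W) / 20"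
    proof (cases "\<kappa> powr (-3/4) \<le> ln N / 2")
      case True
      then have lz: "lz = \<kappa> powr (-3/4)" unfolding lz_def by simp
      let ?Sb = "{b\<in>{1..nat \<lfloor>B\<rfloor>}. ?no b}"
      have "sqrt 9 \<le> sqrt N" using N9 by (intro real_sqrt_le_mono)
      moreover have "sqrt 9 = (3::real)" by (rule real_sqrt_unique) auto
      ultimately have "sqrt N \<ge> 3" by linarith
      \<comment> \<open>The 1 covers the passage from B to its floor.\<close>
      moreover have "sqrt N + 1 \<le> B" using NB False by linarith
      ultimately have X: "z \<le> real (nat \<lfloor>B\<rfloor>)" "nat \<lfloor>B\<rfloor> \<ge> 3" using zN by linarith+
      have "real (card ?Sb) * ln z \<le> 510 * real (nat \<lfloor>B\<rfloor>) * (1 + ln P)"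
        by (rule sifted_card_le[OF P1 z1(1) X])
      also have "\<dots> \<le> 510 * (\<kappa> powr (1/2) * N) * (1 + ln P)"
      proof (intro mult_right_mono mult_left_mono)
        show "real (nat \<lfloor>B\<rfloor>) \<le> \<kappa> powr (1/2) * N" using Bk B by linarith
      qed (use P1 in auto)
      also have "\<dots> \<le> 510 * (\<kappa> powr (1/2) * (2 * W)) * (1 + ln P)"
        using NW P1 by (intro mult_right_mono mult_left_mono) auto
      finally have c1: "real (card ?Sb) * \<kappa> powr (-3/4) \<le> 1020 * \<kappa> powr (1/2) * W * (1 - 8 * ln \<kappa>)"
        unfolding z1 lz lnP by simp
      have "2 * J * real (card ?Sb) = 2 * \<kappa> powr (73/100) * (real (card ?Sb) * \<kappa> powr (-3/4))"
        unfolding J_def by (simp add: powr_add[symmetric])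
      also have "\<dots> \<le> 2 * \<kappa> powr (73/100) * (1020 * \<kappa> powr (1/2) * W * (1 - 8 * ln \<kappa>))"
        using c1 by (intro mult_left_mono) auto
      also have "\<dots> = (2040 * (\<kappa> powr (73/100) * \<kappa> powr (1/2)) * (1 - 8 * ln \<kappa>)) * W" by simp
      also have "\<kappa> powr (73/100) * \<kappa> powr (1/2) = \<kappa> powr (123/100)" by (simp add: powr_add[symmetric])
      also have "(2040 * \<kappa> powr (123/100) * (1 - 8 * ln \<kappa>)) * W \<le> u * W" using ty(9) W0 by (intro mult_right_mono) auto
      finally have c2: "2 * J * real (card ?Sb) \<le> u * W" .
      have "card {(a, b, e). (a, b, e) \<in> near_products \<alpha> A B (\<kappa> * \<eta>) \<and> ?no a \<and> ?no b} \<le> card {(a, b, e). (a, b, e) \<in> near_products \<alpha> A B (\<kappa> * \<eta>) \<and> b \<in> ?Sb}"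
      proof (rule card_mono)
        show "finite {(a, b, e). (a, b, e) \<in> near_products \<alpha> A B (\<kappa> * \<eta>) \<and> b \<in> ?Sb}"
          by (rule finite_subset[OF _ finite_near_products[of \<alpha> A B "\<kappa> * \<eta>"]]) auto
        show "{(a, b, e). (a, b, e) \<in> near_products \<alpha> A B (\<kappa> * \<eta>) \<and> ?no a \<and> ?no b} \<subseteq> {(a, b, e). (a, b, e) \<in> near_products \<alpha> A B (\<kappa> * \<eta>) \<and> b \<in> ?Sb}"
          unfolding near_products_def by (auto simp: le_nat_floor)
      qed
      moreover have "real (card {(a, b, e). (a, b, e) \<in> near_products \<alpha> A B (\<kappa> * \<eta>) \<and> b \<in> ?Sb}) \<le> 2 * J * real (card ?Sb) + u * W + C * (u * W) / 20"
        by (rule lat[OF A B AB]) (unfold nat_Icc_real, auto)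
      ultimately show ?thesis using c2 by linarith
    next
      case F2: False
      then have lz: "lz = ln N / 2" unfolding lz_def by simp
      \<comment> \<open>The rough part t of a b has no prime up to z = sqrt N, and t < N^2 = z^4, so
        it has at most three prime factors and at most 8 divisors. The other part is smooth for P =
        \<kappa>^(-8), so only powers of ln(1 / \<kappa>) are lost; this carries the induction below
        the range of the sieve.\<close>
      have z4: "z ^ Suc 3 = N\<^sup>2"
      proof -
        have "z ^ 4 = exp (4 * lz)" unfolding z_def by (simp add: exp_of_nat_mult[symmetric])
        also have "\<dots> = exp (ln N + ln N)" unfolding lz by simp
        also have "\<dots> = N\<^sup>2" unfolding exp_add using N9 by (simp add: power2_eq_square)
        finally show ?thesis by simp
      qed
      let ?T = "{(a, b, e). (a, b, e) \<in> near_products \<alpha> A B (\<kappa> * \<eta>) \<and> ?no a \<and> ?no b}"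
      have "real (card ?T) \<le> div_const j * (1 + ln P) ^ (2 ^ (2 ^ j)) * (\<kappa>\<^sup>2 + \<kappa> * N powr (- (c / 2))) * W"
      proof (rule near_products_divisor_bound[OF k k1(2) AB P1 j])
        fix a b e assume abe: "(a, b, e) \<in> ?T"
        then have t: "(a, b, e) \<in> near_products \<alpha> A B (\<kappa> * \<eta>)" "?no a" "?no b" by auto
        then have ab: "1 \<le> a" "1 \<le> b" "real a \<le> A" "real b \<le> B" unfolding near_products_def by auto
        then obtain s t where st: "a * b = s * t" "smooth P s" "\<forall>p. prime p \<longrightarrow> p dvd t \<longrightarrow> P < real p"
          using smooth_rough_factorization[of "a * b" P] by auto
        have "s * t \<ge> 1" using ab st by (metis mult_le_mono nat_mult_1)
        then have st0: "s > 0" "t > 0" by (auto intro: Nat.gr0I)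
        have "divisor_tau t \<le> 2 ^ 3"
        proof (rule divisor_tau_rough[OF st0(2)])
          show "1 \<le> z" using z1 by simp
          fix p assume p: "prime p" "p dvd t"
          then have "p dvd a * b" using st by simp
          then have "p dvd a \<or> p dvd b" using p by (simp add: prime_dvd_mult_iff)
          then have "\<not> (P < real p \<and> real p \<le> z)" using t(2,3) p(1) by blast
          moreover have "P < real p" using st(3) p by blast
          ultimately show "z < real p" by linarith
        next
          have "t \<le> s * t" using st0 by simp
          then have "real t \<le> real (a * b)" unfolding st(1) by (rule of_nat_mono)
          then have "real t \<le> real a * real b" by simp
          also have "\<dots> \<le> A * B" using ab A by (intro mult_mono) auto
          also have "\<dots> \<le> \<kappa> * N\<^sup>2" by (rule AB)
          also have "\<dots> \<le> (1/2) * N\<^sup>2" using k1 by (intro mult_right_mono) auto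
          also have "\<dots> < N\<^sup>2" using N3 by simp
          finally show "real t < z ^ Suc 3" unfolding z4 .
        qed
        then show "\<exists>s t. a * b = s * t \<and> smooth P s \<and> divisor_tau t \<le> 8" using st by auto
      qed auto
      also have "\<dots> \<le> div_const j * (1 + ln P) ^ (2 ^ (2 ^ j)) * (2 * \<kappa>\<^sup>2) * W"
      proof (intro mult_right_mono mult_left_mono)
        have "\<kappa> * N powr (- (c / 2)) \<le> \<kappa> * \<kappa>" using Nc k by (intro mult_left_mono) auto
        then show "\<kappa>\<^sup>2 + \<kappa> * N powr (- (c / 2)) \<le> 2 * \<kappa>\<^sup>2" by (simp add: power2_eq_square)
      qed (use P1 W0 D in \<open>auto simp: div_const_def\<close>)
      also have "\<dots> \<le> u * W" unfolding lnP using ty(10) W0 by (intro mult_right_mono) auto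
      finally have "real (card ?T) \<le> u * W" .
      moreover have "0 \<le> C * (u * W) / 20" using uW C by simp
      ultimately show ?thesis using uW by linarith
    qed
    have BA': "B * A \<le> \<kappa> * N\<^sup>2" using AB by (simp add: mult.commute)
    let ?ex = "\<lambda>b. \<exists>l. prime l \<and> P < real l \<and> real l \<le> z \<and> l dvd b"
    let ?T = "near_products \<alpha> A B (\<kappa> * \<eta>)"
    let ?S1 = "{(a, b, e). (a, b, e) \<in> ?T \<and> b \<in> {b. 1 \<le> b \<and> real b \<le> B \<and> k' \<le> omega_in P z b}}"
    let ?S2 = "{(a, b, e). (a, b, e) \<in> ?T \<and> a \<in> {b. 1 \<le> b \<and> real b \<le> A \<and> k' \<le> omega_in P z b}}"
    let ?S3 = "{(a, b, e). (a, b, e) \<in> ?T \<and> (?ex b \<and> omega_in P z a < k')}"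
    let ?S4 = "{(a, b, e). (a, b, e) \<in> ?T \<and> (?ex a \<and> omega_in P z b < k')}"
    let ?S5 = "{(a, b, e). (a, b, e) \<in> ?T \<and> ?no a \<and> ?no b}"
    have s1: "real (card ?S1) \<le> 2 * (u * W) + C * (u * W) / 20" by (rule many[OF A B AB Bk'])
    have s2: "real (card ?S2) \<le> 2 * (u * W) + C * (u * W) / 20"
    proof -
      have "card ?S2 = card {(a, b, e). (a, b, e) \<in> near_products \<alpha> B A (\<kappa> * \<eta>) \<and> b \<in> {b. 1 \<le> b \<and> real b \<le> A \<and> k' \<le> omega_in P z b}}"
        by (rule card_near_products_pred_swap)
      then show ?thesis using many[OF B A BA' Ak] by linarith
    qed
    have s3: "real (card ?S3) \<le> u * W + C * (u * W) / 20" by (rule shift[OF A B AB Bk'])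
    have s4: "real (card ?S4) \<le> u * W + C * (u * W) / 20"
    proof -
      have "card ?S4 = card {(a, b, e). (a, b, e) \<in> near_products \<alpha> B A (\<kappa> * \<eta>) \<and> (?ex b \<and> omega_in P z a < k')}"
        by (rule card_near_products_pred_swap)
      then show ?thesis using shift[OF B A BA' Ak] by linarith
    qed
    have "?T \<subseteq> ?S1 \<union> ?S2 \<union> ?S3 \<union> ?S4 \<union> ?S5"
    proof
      fix x assume x: "x \<in> ?T"
      obtain a b e where abe: "x = (a, b, e)" by (cases x)
      have ab: "1 \<le> a" "real a \<le> A" "1 \<le> b" "real b \<le> B" using x abe unfolding near_products_def by auto
      have t: "(a, b, e) \<in> ?T" using x abe by simp
      have no: "?no y \<longleftrightarrow> \<not> ?ex y" for y by blast
      show "x \<in> ?S1 \<union> ?S2 \<union> ?S3 \<union> ?S4 \<union> ?S5"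
      proof (cases "k' \<le> omega_in P z b")
        case True
        then have "x \<in> ?S1" using t ab abe by simp
        then show ?thesis by blast
      next
        case b: False
        show ?thesis
        proof (cases "k' \<le> omega_in P z a")
          case True
          then have "x \<in> ?S2" using t ab abe by simp
          then show ?thesis by blast
        next
          case a: False
          show ?thesis
          proof (cases "?ex b")
            case True
            then have "x \<in> ?S3" using t a unfolding abe by simp
            then show ?thesis by blast
          next
            case exb: False
            show ?thesis
            proof (cases "?ex a")
              case True
              then have "x \<in> ?S4" using t b unfolding abe by simp
              then show ?thesis by blast
            next
              case False
              then have "?no a \<and> ?no b" using exb no by blast
              then have "x \<in> ?S5" using t unfolding abe by blast
              then show ?thesis by blast
            qed
          qed
        qed
      qed
    qed
    then have "card ?T \<le> card (?S1 \<union> ?S2 \<union> ?S3 \<union> ?S4 \<union> ?S5)"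
      by (rule card_mono[rotated]) (rule finite_subset[OF _ finite_near_products[of \<alpha> A B "\<kappa> * \<eta>"]], auto)
    also have "\<dots> \<le> card ?S1 + card ?S2 + card ?S3 + card ?S4 + card ?S5"
      by (meson add_le_mono card_Un_le le_trans order_refl)
    finally have "real (card ?T) \<le> real (card ?S1) + real (card ?S2) + real (card ?S3) + real (card ?S4) + real (card ?S5)" by linarith
    also have "\<dots> \<le> 8 * (u * W) + C * (u * W) / 4" using s1 s2 s3 s4 rest by linarith
    also have "\<dots> \<le> C * (u * W)"
    proof -
      have "100 * (u * W) \<le> C * (u * W)" using C uW by (intro mult_right_mono) auto
      then show ?thesis using uW by linarith
    qed
    finally show ?thesis unfolding u_def by (simp add: mult.assoc)
  qed
qed

end

section \<open>Small scales and the conclusion of the induction\<close>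

context equidistributed_bohr
begin

lemma near_products_step:
  assumes r: "0 < r" "r \<le> 1/5" and k: "\<kappa> > 0" and A: "A > 0" and B: "B > 0" and AB: "A * B \<le> \<kappa> * N\<^sup>2"
    and C: "C \<ge> 100" and eps: "0 \<le> \<epsilon>" "\<epsilon> \<le> \<kappa>\<^sup>2" and Nc: "N powr (- (c / 2)) \<le> \<kappa>" and j: "4 \<le> c * 2 ^ j"
    and N9: "N \<ge> 9" and NB: "sqrt N + 1 \<le> \<kappa> powr (61/50) * N"
    and small_scale: "small_scale (rec_const r) (div_const j) (2 ^ (2 ^ j)) \<kappa>" and IH: "claim_upto C \<epsilon> r (\<kappa> / 2)"
  shows "real (card (near_products \<alpha> A B (\<kappa> * \<eta>))) \<le> C * \<kappa> powr (1 + 1/5) * W"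
proof (cases "B \<le> A")
  case True
  show ?thesis by (rule near_products_step_ordered[OF r k A B AB True C eps Nc j N9 NB small_scale IH])
next
  case False
  then have BA: "A \<le> B" by simp
  have AB': "B * A \<le> \<kappa> * N\<^sup>2" using AB by (simp add: mult.commute)
  show ?thesis unfolding card_near_products_swap[of \<alpha> A B] by (rule near_products_step_ordered[OF r k B A AB' BA C eps Nc j N9 NB small_scale IH])
qed

text \<open>Every product is N^2-smooth, so the divisor bound applies to all triples, with a loss
  Y^m for Y = 1 + 2 ln N and m = 2^(2^j). As \<kappa>^2 = \<kappa>^(6/5) \<kappa>^(4/5), the loss is
  absorbed once \<kappa> \<le> Y^(-5m/4).\<close>

lemma near_products_base:
  assumes k: "0 < \<kappa>" "\<kappa> \<le> 1" and A: "A > 0" and AB: "A * B \<le> \<kappa> * N\<^sup>2" and j: "4 \<le> c * 2 ^ j"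
    and kb: "\<kappa> \<le> (1 + 2 * ln N) powr (- (5/4 * 2 ^ (2 ^ j)))"
    and Nb: "(1 + 2 * ln N) powr (2 ^ (2 ^ j)) * N powr (- (c / 4)) \<le> 1"
  shows "real (card (near_products \<alpha> A B (\<kappa> * \<eta>))) \<le> div_const j * (\<kappa> powr (1 + 1/5) + N powr (- (c / 8)) * \<kappa> powr (1 + c / 16)) * W"
proof (cases "near_products \<alpha> A B (\<kappa> * \<eta>) = {}")
  case True
  have "div_const j \<ge> 0" unfolding div_const_def using D by simp
  then show ?thesis using True W_pos by simp
next
  case False
  define m :: nat where "m = 2 ^ (2 ^ j)"
  define Y where "Y = 1 + 2 * ln N"
  have L0: "div_const j \<ge> 0" unfolding div_const_def using D by simp
  have Y1: "Y \<ge> 1" unfolding Y_def using N3 by simp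
  have AN: "A * B \<le> N\<^sup>2"
  proof -
    have "\<kappa> * N\<^sup>2 \<le> 1 * N\<^sup>2" using k by (intro mult_right_mono) auto
    then show ?thesis using AB by simp
  qed
  have prodle: "real (a * b) \<le> A * B" if "(a, b, e) \<in> near_products \<alpha> A B (\<kappa> * \<eta>)" for a b e
    unfolding of_nat_mult using that A unfolding near_products_def by (intro mult_mono) auto
  \<comment> \<open>A nonempty set contains a product between 1 and \<kappa> N^2. This turns a power
    of 1 / N into a power of \<kappa> and is the origin of the exponent 1 + c / 16.\<close>
  have kN: "1 \<le> \<kappa> * N\<^sup>2"
  proof -
    obtain a b e where t: "(a, b, e) \<in> near_products \<alpha> A B (\<kappa> * \<eta>)" using False by auto
    then have "1 \<le> a" "1 \<le> b" unfolding near_products_def by auto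
    then have "1 \<le> a * b" by simp
    then have "1 \<le> real (a * b)" by linarith
    then show ?thesis using prodle[OF t] AB by linarith
  qed
  have lnN2: "1 + ln (N\<^sup>2) = Y" unfolding Y_def using N3 by (simp add: ln_realpow)
  have "real (card (near_products \<alpha> A B (\<kappa> * \<eta>))) \<le> div_const j * (1 + ln (N\<^sup>2)) ^ (2 ^ (2 ^ j)) * (\<kappa>\<^sup>2 + \<kappa> * N powr (- (c / 2))) * W"
  proof (rule near_products_divisor_bound[OF k AB _ j order_refl])
    have "1\<^sup>2 \<le> N\<^sup>2" using N3 by (intro power_mono) auto
    then show "1 \<le> N\<^sup>2" by simp
    fix a b e assume t: "(a, b, e) \<in> near_products \<alpha> A B (\<kappa> * \<eta>)"
    have "smooth (N\<^sup>2) (a * b)" unfolding smooth_def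
    proof (intro allI impI)
      fix p assume p: "prime p" "p dvd a * b"
      have "a * b > 0" using t unfolding near_products_def by auto
      then have "p \<le> a * b" using p(2) by (rule dvd_imp_le[rotated])
      then have "real p \<le> real (a * b)" by (rule of_nat_mono)
      then show "real p \<le> N\<^sup>2" using prodle[OF t] AN by linarith
    qed
    then show "\<exists>s t. a * b = s * t \<and> smooth (N\<^sup>2) s \<and> divisor_tau t \<le> 8"
      by (intro exI[of _ "a * b"] exI[of _ 1]) (simp add: divisor_tau_def)
  qed
  also have "\<dots> = div_const j * (Y ^ m * \<kappa>\<^sup>2 + Y ^ m * (\<kappa> * N powr (- (c / 2)))) * W"
    unfolding lnN2 m_def by (simp only: distrib_left mult.assoc)
  also have "\<dots> \<le> div_const j * (\<kappa> powr (1 + 1/5) + N powr (- (c / 8)) * \<kappa> powr (1 + c / 16)) * W"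
  proof (intro mult_right_mono mult_left_mono add_mono)
    have Ym: "Y ^ m = Y powr real m" using Y1 by (simp add: powr_realpow)
    have "\<kappa> powr (4/5) \<le> (Y powr (- (5/4 * real m))) powr (4/5)"
      using kb k unfolding Y_def m_def by (intro powr_mono2) auto
    also have "\<dots> = Y powr (- real m)" by (simp add: powr_powr)
    finally have "Y ^ m * \<kappa> powr (4/5) \<le> Y ^ m * Y powr (- real m)" using Y1 by (intro mult_left_mono) auto
    also have "\<dots> = 1" unfolding Ym using Y1 by (simp add: powr_minus)
    finally have "(Y ^ m * \<kappa> powr (4/5)) * \<kappa> powr (1 + 1/5) \<le> 1 * \<kappa> powr (1 + 1/5)" by (intro mult_right_mono) auto
    moreover have "\<kappa> powr (4/5) * \<kappa> powr (1 + 1/5) = \<kappa>\<^sup>2" unfolding powr_add[symmetric] using k by simp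
    ultimately show "Y ^ m * \<kappa>\<^sup>2 \<le> \<kappa> powr (1 + 1/5)" by (simp add: mult.assoc)
    \<comment> \<open>The exponent c/2 is spent in three parts: c/4 against the logarithms, c/8 to
      become \<kappa>^(c/16), and c/8 kept as \<epsilon>.\<close>
    have n2: "N powr (- (c / 2)) = N powr (- (c / 4)) * (N powr (- (c / 8)) * N powr (- (c / 8)))"
      unfolding powr_add[symmetric] by simp
    have "N powr (- (c / 8)) \<le> \<kappa> powr (c / 16)"
    proof -
      have "1 powr (c / 16) \<le> (\<kappa> * N\<^sup>2) powr (c / 16)" using kN c by (intro powr_mono2) auto
      also have "\<dots> = \<kappa> powr (c / 16) * (N\<^sup>2) powr (c / 16)" using k by (simp add: powr_mult)
      also have "(N\<^sup>2) powr (c / 16) = N powr (c / 8)"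
      proof -
        have "N\<^sup>2 = N powr 2" using N3 by simp
        then show ?thesis by (simp only: powr_powr) simp
      qed
      finally have "1 \<le> \<kappa> powr (c / 16) * N powr (c / 8)" by simp
      then have "1 * N powr (- (c / 8)) \<le> \<kappa> powr (c / 16) * N powr (c / 8) * N powr (- (c / 8))" by (intro mult_right_mono) auto
      also have "\<dots> = \<kappa> powr (c / 16)" using N3 by (simp add: powr_minus)
      finally show ?thesis by simp
    qed
    then have "\<kappa> * N powr (- (c / 8)) * N powr (- (c / 8)) \<le> \<kappa> * N powr (- (c / 8)) * \<kappa> powr (c / 16)"
      using k by (intro mult_left_mono) auto
    also have "\<dots> = N powr (- (c / 8)) * \<kappa> powr (1 + c / 16)" using k by (simp add: powr_add)
    finally have b: "\<kappa> * N powr (- (c / 8)) * N powr (- (c / 8)) \<le> N powr (- (c / 8)) * \<kappa> powr (1 + c / 16)" .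
    have "Y ^ m * (\<kappa> * N powr (- (c / 2))) = (Y ^ m * N powr (- (c / 4))) * (\<kappa> * N powr (- (c / 8)) * N powr (- (c / 8)))"
      unfolding n2 by simp
    also have "\<dots> \<le> 1 * (\<kappa> * N powr (- (c / 8)) * N powr (- (c / 8)))"
    proof (rule mult_right_mono)
      have "Y powr real m * N powr (- (c / 4)) \<le> 1" using Nb unfolding m_def Y_def by simp
      then show "Y ^ m * N powr (- (c / 4)) \<le> 1" unfolding Ym .
    qed (use k in auto)
    finally show "Y ^ m * (\<kappa> * N powr (- (c / 2))) \<le> N powr (- (c / 8)) * \<kappa> powr (1 + c / 16)" using b by simp
  qed (use L0 W_pos in auto)
  finally show ?thesis .
qed

text \<open>From \<kappa>b on, the admissible scale doubles with unchanged C until it reaches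
  \<kappa>1. The number of doublings grows with N, so C must not move. The conditions on N ensure
  \<epsilon> \<le> \<kappa>^2 and N^(-c/2) \<le> \<kappa> for all \<kappa> \<ge> \<kappa>b.\<close>

lemma near_products_claim:
  assumes j: "4 \<le> c * 2 ^ j" and k1: "\<kappa>1 > 0" "\<And>\<kappa>. 0 < \<kappa> \<Longrightarrow> \<kappa> \<le> \<kappa>1 \<Longrightarrow> small_scale (rec_const (c / 16)) (div_const j) (2 ^ (2 ^ j)) \<kappa>"
    and kb: "\<kappa>b = (1 + 2 * ln N) powr (- (5/4 * 2 ^ (2 ^ j)))"
    and Nb: "(1 + 2 * ln N) powr (2 ^ (2 ^ j)) * N powr (- (c / 4)) \<le> 1"
    and N9: "N \<ge> 9" and N1: "N powr (- (c / 8)) \<le> \<kappa>b\<^sup>2" and N2: "N powr (- (c / 2)) \<le> \<kappa>b" and N3': "sqrt N + 1 \<le> \<kappa>b powr (61/50) * N"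
    and C: "C \<ge> 100" "C \<ge> div_const j"
  shows "claim_upto C (N powr (- (c / 8))) (c / 16) \<kappa>1"
proof -
  have r: "0 < c / 16" "c / 16 \<le> 1/5" using c by auto
  let ?F = "\<lambda>\<kappa>. \<kappa> powr (1 + 1/5) + N powr (- (c / 8)) * \<kappa> powr (1 + c / 16)"
  have lnN: "ln N > 0" using N9 by simp
  have kb0: "\<kappa>b > 0" "\<kappa>b \<le> 1"
  proof -
    show "\<kappa>b > 0" unfolding kb using lnN by simp
    have "(1 + 2 * ln N) powr (- (5/4 * 2 ^ (2 ^ j))) \<le> (1 + 2 * ln N) powr 0" using lnN by (intro powr_mono) auto
    then show "\<kappa>b \<le> 1" unfolding kb using lnN by simp
  qed
  have base: "real (card (near_products \<alpha> A B (\<kappa> * \<eta>))) \<le> C * ?F \<kappa> * W" if "0 < \<kappa>" "\<kappa> \<le> \<kappa>b" "A > 0" "A * B \<le> \<kappa> * N\<^sup>2" for \<kappa> A B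
  proof -
    have "real (card (near_products \<alpha> A B (\<kappa> * \<eta>))) \<le> div_const j * ?F \<kappa> * W"
      by (rule near_products_base[OF that(1) _ that(3,4) j _ Nb]) (use that kb kb0 in auto)
    also have "\<dots> \<le> C * ?F \<kappa> * W" using C W_pos by (intro mult_right_mono) (auto intro: add_nonneg_nonneg)
    finally show ?thesis .
  qed
  have "claim_upto C (N powr (- (c / 8))) (c / 16) (min \<kappa>1 (2 ^ n * \<kappa>b))" for n
  proof (induction n)
    case 0
    show ?case unfolding claim_upto_def using base by simp
  next
    case (Suc n)
    show ?case unfolding claim_upto_def
    proof (intro allI impI)
      fix \<kappa> A B assume k: "0 < \<kappa>" "\<kappa> \<le> min \<kappa>1 (2 ^ Suc n * \<kappa>b)" and A: "0 < A" and B: "0 < B" and AB: "A * B \<le> \<kappa> * N\<^sup>2"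
      show "real (card (near_products \<alpha> A B (\<kappa> * \<eta>))) \<le> C * ?F \<kappa> * W"
      proof (cases "\<kappa> \<le> \<kappa>b")
        case True
        show ?thesis by (rule base[OF k(1) True A AB])
      next
        case False
        then have kbk: "\<kappa>b \<le> \<kappa>" by simp
        have IH: "claim_upto C (N powr (- (c / 8))) (c / 16) (\<kappa> / 2)"
          by (rule claim_upto_mono[OF Suc.IH]) (use k in auto)
        have e1: "N powr (- (c / 8)) \<le> \<kappa>\<^sup>2" using N1 power_mono[OF kbk, of 2] kb0 by linarith
        have e2: "N powr (- (c / 2)) \<le> \<kappa>" using N2 kbk by linarith
        have "\<kappa>b powr (61/50) * N \<le> \<kappa> powr (61/50) * N" using kbk kb0 N9 by (intro mult_right_mono powr_mono2) auto
        then have e3: "sqrt N + 1 \<le> \<kappa> powr (61/50) * N" using N3' by linarith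
        have ti: "small_scale (rec_const (c / 16)) (div_const j) (2 ^ (2 ^ j)) \<kappa>" by (rule k1(2)) (use k in auto)
        have "real (card (near_products \<alpha> A B (\<kappa> * \<eta>))) \<le> C * \<kappa> powr (1 + 1/5) * W"
          by (rule near_products_step[OF r k(1) A B AB C(1) _ e1 e2 j N9 e3 ti IH]) simp
        also have "\<dots> \<le> C * ?F \<kappa> * W" using C W_pos by (intro mult_right_mono mult_left_mono) auto
        finally show ?thesis .
      qed
    qed
  qed
  moreover obtain n :: nat where n: "\<kappa>1 / \<kappa>b < 2 ^ n" using real_arch_pow[of 2 "\<kappa>1 / \<kappa>b"] by auto
  ultimately have "claim_upto C (N powr (- (c / 8))) (c / 16) (min \<kappa>1 (2 ^ n * \<kappa>b))" by blast
  moreover have "min \<kappa>1 (2 ^ n * \<kappa>b) = \<kappa>1" using n kb0 by (simp add: field_simps min_def)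
  ultimately show ?thesis by simp
qed

end

theorem near_products_claim_uniform:
  fixes c D :: real
  assumes c: "0 < c" "c \<le> 1" and D: "D \<ge> 0"
  shows "\<exists>\<kappa>1 C N0. \<kappa>1 > 0 \<and> C \<ge> 0 \<and> (\<forall>\<alpha> \<eta> N W. equidistributed_bohr \<alpha> \<eta> N W c D \<longrightarrow> N \<ge> N0 \<longrightarrow>
    equidistributed_bohr.claim_upto \<alpha> \<eta> N W C (N powr (- (c / 8))) (c / 16) \<kappa>1)"
proof -
  \<comment> \<open>j depends on c alone, so the constants built from it are uniform in \<alpha>,
    \<eta> and N.\<close>
  obtain j :: nat where "4 / c < 2 ^ j" using real_arch_pow[of 2 "4 / c"] by auto
  then have j: "4 \<le> c * 2 ^ j" using c by (simp add: field_simps)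
  define L where "L = equidistributed_bohr.div_const D j"
  define m :: nat where "m = 2 ^ (2 ^ j)"
  define s where "s = real m"
  have s0: "s > 0" unfolding s_def m_def by simp
  have K: "rec_const (c / 16) > 0" using rec_const_ge[of "c / 16"] c by simp
  show ?thesis
  \<comment> \<open>The defining equation of \<open>div_const\<close> holds under the assumptions of
    the locale, so one instance is used to see L > 0; without any instance the claim is
    vacuous.\<close>
  proof (cases "\<exists>\<alpha> \<eta> N W. equidistributed_bohr \<alpha> \<eta> N W c D")
    case False
    then show ?thesis by (intro exI[of _ 1] exI[of _ 1]) auto
  next
    case True
    then obtain \<alpha>0 \<eta>0 N0 W0 where b0: "equidistributed_bohr \<alpha>0 \<eta>0 N0 W0 c D" by blast
    have L: "L > 0" unfolding L_def equidistributed_bohr.div_const_def[OF b0] using D by simp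
    have "eventually (small_scale (rec_const (c / 16)) L m) (at_right 0)"
      by (rule eventually_small_scale[OF K L]) (simp add: m_def)
    then obtain b where b: "b > 0" "\<And>\<kappa>. 0 < \<kappa> \<Longrightarrow> \<kappa> < b \<Longrightarrow> small_scale (rec_const (c / 16)) L m \<kappa>"
      unfolding eventually_at_right_field by auto
    have e1: "\<forall>\<^sub>F N in at_top. (1 + 2 * ln N) powr s * N powr (- (c / 4)) \<le> 1" using c s0 by real_asymp
    have e2: "\<forall>\<^sub>F N in at_top. N powr (- (c / 8)) \<le> ((1 + 2 * ln N) powr (- (5/4 * s)))\<^sup>2" using c s0 by real_asymp
    have e3: "\<forall>\<^sub>F N in at_top. N powr (- (c / 2)) \<le> (1 + 2 * ln N) powr (- (5/4 * s))" using c s0 by real_asymp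
    have e4: "\<forall>\<^sub>F N in at_top. sqrt N + 1 \<le> ((1 + 2 * ln N) powr (- (5/4 * s))) powr (61/50) * N" using c s0 by real_asymp
    have e5: "\<forall>\<^sub>F N in at_top. N \<ge> (9::real)" by real_asymp
    from e1 e2 e3 e4 e5 have "\<forall>\<^sub>F N in at_top. (1 + 2 * ln N) powr s * N powr (- (c / 4)) \<le> 1 \<and>
      N powr (- (c / 8)) \<le> ((1 + 2 * ln N) powr (- (5/4 * s)))\<^sup>2 \<and> N powr (- (c / 2)) \<le> (1 + 2 * ln N) powr (- (5/4 * s)) \<and>
      sqrt N + 1 \<le> ((1 + 2 * ln N) powr (- (5/4 * s))) powr (61/50) * N \<and> N \<ge> 9"
      by eventually_elim blast
    then obtain N1 where N1: "\<And>N. N \<ge> N1 \<Longrightarrow> (1 + 2 * ln N) powr s * N powr (- (c / 4)) \<le> 1 \<and>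
      N powr (- (c / 8)) \<le> ((1 + 2 * ln N) powr (- (5/4 * s)))\<^sup>2 \<and> N powr (- (c / 2)) \<le> (1 + 2 * ln N) powr (- (5/4 * s)) \<and>
      sqrt N + 1 \<le> ((1 + 2 * ln N) powr (- (5/4 * s))) powr (61/50) * N \<and> N \<ge> 9"
      unfolding eventually_at_top_linorder by blast
    have sm: "s = 2 ^ (2 ^ j)" unfolding s_def m_def by simp
    have "equidistributed_bohr.claim_upto \<alpha> \<eta> N W (max 100 L) (N powr (- (c / 8))) (c / 16) (b / 2)" if B: "equidistributed_bohr \<alpha> \<eta> N W c D" and N: "N \<ge> N1" for \<alpha> \<eta> N W
    proof (rule equidistributed_bohr.near_products_claim[OF B j _ _ refl])
      fix \<kappa> :: real assume "0 < \<kappa>" "\<kappa> \<le> b / 2"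
      then show "small_scale (rec_const (c / 16)) (equidistributed_bohr.div_const D j) (2 ^ (2 ^ j)) \<kappa>" using b unfolding L_def[symmetric] m_def[symmetric] by simp
    qed (use N1[OF N] b in \<open>auto simp: sm L_def\<close>)
    then show ?thesis using b by (intro exI[of _ "b / 2"] exI[of _ "max 100 L"] exI[of _ N1]) auto
  qed
qed

section \<open>The residue sum\<close>

text \<open>gcd(a, q) is bounded by the sum of the common divisors of a and q; a divisor d of q
  contributes (n div d) d \<le> n in total.\<close>

lemma sum_gcd_le:
  assumes "q > 0" shows "(\<Sum>a\<in>{1..n}. gcd a q) \<le> n * divisor_tau q"
proof -
  let ?D = "{d. d dvd q}"
  have fin: "finite ?D" using assms by (rule finite_divisors_nat)
  have "(\<Sum>a\<in>{1..n}. gcd a q) \<le> (\<Sum>a\<in>{1..n}. \<Sum>d\<in>{d\<in>?D. d dvd a}. d)"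
  proof (rule sum_mono)
    fix a
    show "gcd a q \<le> (\<Sum>d\<in>{d\<in>?D. d dvd a}. d)" using fin by (intro member_le_sum[of _ _ "\<lambda>d. d"]) auto
  qed
  also have "\<dots> = (\<Sum>d\<in>?D. \<Sum>a\<in>{a\<in>{1..n}. d dvd a}. d)" by (rule sum.swap_restrict) (use fin in auto)
  also have "\<dots> = (\<Sum>d\<in>?D. (n div d) * d)"
  proof (rule sum.cong[OF refl])
    fix d assume "d \<in> ?D"
    then have "d > 0" using assms by (auto intro: Nat.gr0I)
    then show "(\<Sum>a\<in>{a\<in>{1..n}. d dvd a}. d) = (n div d) * d" using card_multiples[of d n] by simp
  qed
  also have "\<dots> \<le> (\<Sum>d\<in>?D. n)" by (rule sum_mono) simp
  finally show ?thesis unfolding divisor_tau_def by (simp add: mult.commute)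
qed

text \<open>c corresponds to r = p a b - q c. As r is an integer, |r| \<le> floor K + 1/2 means |r|
  \<le> K, and the 1/2 makes 2 \<eta> q the exact number 2 floor K + 1 of admissible r when K \<ge>
  0.\<close>

lemma hits_eq_card_residues:
  fixes p :: int and q :: nat
  assumes q: "q > 0"
  shows "hits (real_of_int p / real q * real a) ((real_of_int \<lfloor>K\<rfloor> + 1/2) / real q) b
    = card {r::int. \<bar>real_of_int r\<bar> \<le> K \<and> [p * int (a * b) = r] (mod int q)}"
proof -
  let ?E = "{c::int. \<bar>real_of_int p / real q * real a * real b - real_of_int c\<bar> \<le> (real_of_int \<lfloor>K\<rfloor> + 1/2) / real q}"
  let ?R = "{r::int. \<bar>real_of_int r\<bar> \<le> K \<and> [p * int (a * b) = r] (mod int q)}"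
  let ?g = "\<lambda>c. p * int (a * b) - int q * c"
  have q0: "real q > 0" using q by simp
  have iff: "c \<in> ?E \<longleftrightarrow> \<bar>real_of_int (?g c)\<bar> \<le> K" for c
  proof -
    have "real_of_int p / real q * real a * real b - real_of_int c = real_of_int (?g c) / real q"
      using q0 by (simp add: field_simps)
    then have "c \<in> ?E \<longleftrightarrow> \<bar>real_of_int (?g c)\<bar> \<le> real_of_int \<lfloor>K\<rfloor> + 1/2"
      using q0 by (simp add: abs_divide divide_le_cancel)
    also have "\<dots> \<longleftrightarrow> \<bar>?g c\<bar> \<le> \<lfloor>K\<rfloor>" by linarith
    also have "\<dots> \<longleftrightarrow> \<bar>real_of_int (?g c)\<bar> \<le> K" by linarith
    finally show ?thesis .
  qed
  have "bij_betw ?g ?E ?R"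
  proof (rule bij_betwI')
    fix x y show "(?g x = ?g y) = (x = y)" using q by simp
  next
    fix x assume "x \<in> ?E"
    then have "\<bar>real_of_int (?g x)\<bar> \<le> K" using iff by blast
    moreover have "[p * int (a * b) = ?g x] (mod int q)" by (simp add: cong_iff_dvd_diff)
    ultimately show "?g x \<in> ?R" by blast
  next
    fix r assume r: "r \<in> ?R"
    then have "int q dvd p * int (a * b) - r" by (simp add: cong_iff_dvd_diff)
    then obtain c where c: "p * int (a * b) - r = int q * c" by blast
    then have "r = ?g c" by simp
    moreover have "c \<in> ?E" using iff[of c] r \<open>r = ?g c\<close> by blast
    ultimately show "\<exists>c\<in>?E. r = ?g c" by blast
  qed
  then show ?thesis unfolding hits_def by (rule bij_betw_same_card)
qed

lemma residue_sum_eq_hits: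
  assumes q: "q > 0"
  shows "residue_sum p q K M N = (\<Sum>a\<in>{1..nat \<lfloor>M\<rfloor>}. \<Sum>b\<in>{1..nat \<lfloor>N\<rfloor>}.
    real (hits (real_of_int p / real q * real a) ((real_of_int \<lfloor>K\<rfloor> + 1/2) / real q) b))"
proof -
  let ?R = "{r::int. \<bar>real_of_int r\<bar> \<le> K}"
  let ?box = "{1..nat \<lfloor>M\<rfloor>} \<times> {1..nat \<lfloor>N\<rfloor>}"
  let ?pr = "\<lambda>x::nat \<times> nat. fst x * snd x"
  have inner: "(\<Sum>\<^sub>\<infinity>m\<in>{m::nat. 0 < m \<and> [p * int m = r] (mod int q)}. real (tau_box M N m))
    = (\<Sum>x\<in>?box. if [p * int (?pr x) = r] (mod int q) then 1 else 0)" for r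
  proof -
    let ?S = "{m\<in>{m::nat. 0 < m \<and> [p * int m = r] (mod int q)}. real m \<le> M * N}"
    have finS: "finite ?S" by (rule finite_subset[OF _ finite_nat_le_real[of "M * N"]]) auto
    have tb: "real (tau_box M N m) = (\<Sum>x\<in>?box. if ?pr x = m then 1 else 0)" for m
    proof -
      have "{(a::nat, b::nat). 0 < a \<and> 0 < b \<and> real a \<le> M \<and> real b \<le> N \<and> a * b = m} = {x\<in>?box. ?pr x = m}"
        unfolding nat_Icc_real[symmetric] by auto
      then have "tau_box M N m = card {x\<in>?box. ?pr x = m}" unfolding tau_box_def by simp
      then show ?thesis by (simp add: sum.If_cases Int_def)
    qed
    have "(\<Sum>\<^sub>\<infinity>m\<in>{m::nat. 0 < m \<and> [p * int m = r] (mod int q)}. real (tau_box M N m)) = (\<Sum>m\<in>?S. real (tau_box M N m))"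
      by (rule infsum_tau_box_eq_sum)
    also have "\<dots> = (\<Sum>x\<in>?box. \<Sum>m\<in>?S. if ?pr x = m then 1 else 0)" unfolding tb by (rule sum.swap)
    also have "\<dots> = (\<Sum>x\<in>?box. if ?pr x \<in> ?S then 1 else 0)" using finS by (intro sum.cong refl) (simp add: sum.delta')
    also have "\<dots> = (\<Sum>x\<in>?box. if [p * int (?pr x) = r] (mod int q) then 1 else 0)"
    proof (rule sum.cong[OF refl])
      fix x assume x: "x \<in> ?box"
      then have "1 \<le> fst x" "real (fst x) \<le> M" "1 \<le> snd x" "real (snd x) \<le> N"
        using nat_Icc_real[of M] nat_Icc_real[of N] by (metis (no_types, lifting) SigmaE mem_Collect_eq prod.sel)+
      then have "real (fst x) * real (snd x) \<le> M * N" "0 < ?pr x" by (auto intro!: mult_mono)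
      then show "(if ?pr x \<in> ?S then 1 else 0) = (if [p * int (?pr x) = r] (mod int q) then 1 else (0::real))" by simp
    qed
    finally show ?thesis .
  qed
  have finR: "finite ?R" by (rule finite_abs_le_real)
  have "residue_sum p q K M N = (\<Sum>r\<in>?R. \<Sum>x\<in>?box. if [p * int (?pr x) = r] (mod int q) then 1 else 0)"
    unfolding residue_sum_def inner ..
  also have "\<dots> = (\<Sum>x\<in>?box. \<Sum>r\<in>?R. if [p * int (?pr x) = r] (mod int q) then 1 else 0)" by (rule sum.swap)
  also have "\<dots> = (\<Sum>x\<in>?box. real (hits (real_of_int p / real q * real (fst x)) ((real_of_int \<lfloor>K\<rfloor> + 1/2) / real q) (snd x)))"
  proof (rule sum.cong[OF refl])
    fix x
    have "(\<Sum>r\<in>?R. if [p * int (?pr x) = r] (mod int q) then 1 else 0) = real (card {r\<in>?R. [p * int (?pr x) = r] (mod int q)})"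
      using finR by (simp add: sum.If_cases Int_def)
    then show "(\<Sum>r\<in>?R. if [p * int (?pr x) = r] (mod int q) then 1 else 0)
      = real (hits (real_of_int p / real q * real (fst x)) ((real_of_int \<lfloor>K\<rfloor> + 1/2) / real q) (snd x))"
      unfolding hits_eq_card_residues[OF q] by simp
  qed
  also have "\<dots> = (\<Sum>a\<in>{1..nat \<lfloor>M\<rfloor>}. \<Sum>b\<in>{1..nat \<lfloor>N\<rfloor>}.
    real (hits (real_of_int p / real q * real a) ((real_of_int \<lfloor>K\<rfloor> + 1/2) / real q) b))"
    by (subst sum.cartesian_product) (simp add: case_prod_unfold)
  finally show ?thesis .
qed

section \<open>The Diophantine type of p/q\<close>

lemma rat_of_type_real:
  fixes p :: int and q :: nat
  assumes "rat_of_type (of_int p / of_nat q) e \<K>" "v > 0" "real_of_int u / real v \<noteq> real_of_int p / real q"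
  shows "1 / (\<K> * real v powr e) \<le> \<bar>real_of_int p / real q - real_of_int u / real v\<bar>"
proof -
  let ?x = "of_int p / of_nat q :: rat"
  let ?y = "of_int u / of_nat v :: rat"
  have r: "(of_rat ?x :: real) = real_of_int p / real q" "(of_rat ?y :: real) = real_of_int u / real v"
    by (simp_all add: of_rat_divide)
  have "?y \<noteq> ?x" using assms(3) r by metis
  then have "1 / (\<K> * real v powr e) \<le> (of_rat \<bar>?x - ?y\<bar> :: real)"
    using assms(1,2) unfolding rat_of_type_def by blast
  also have "\<dots> = \<bar>of_rat (?x - ?y)\<bar>" by (simp add: abs_if of_rat_minus[symmetric])
  also have "\<dots> = \<bar>real_of_int p / real q - real_of_int u / real v\<bar>" by (simp only: of_rat_diff r)
  finally show ?thesis .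
qed

text \<open>This is where the Diophantine type enters: a short lattice vector \<open>(m, m\<alpha> - e)\<close> satisfies
  \<open>n \<le> \<kappa> min(N\<^sup>2/m, 2\<K>\<eta>m\<^bsup>1+\<gamma>\<^esup>)\<close>, which saves a power of \<open>N\<close> over \<open>\<kappa>\<eta>N\<^sup>2\<close>.\<close>

lemma card_near_multiples_rat_of_type:
  fixes p :: int and q d :: nat
  assumes type: "rat_of_type (of_int p / of_nat q) (2 + \<gamma>) \<K>" and \<gamma>: "0 < \<gamma>" and \<K>: "\<K> > 0" and N: "N \<ge> 1" and q: "q > 0"
    and eta: "1 / real q \<le> \<eta>" and qN: "N powr (c * (2 + \<gamma>)) * real q powr (1 + \<gamma>) \<le> N\<^sup>2" and c: "c > 0"
    and k: "\<kappa> > 0" and d: "d \<ge> 1"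
  shows "real (card (near_multiples (real_of_int p / real q * real d) (\<kappa> * N\<^sup>2 / real d) (\<kappa> * \<eta>)))
    \<le> 10 * \<kappa>\<^sup>2 * (\<eta> * N\<^sup>2) / real d + 2 * (1 + 2 * \<K>) * \<kappa> * N powr (- c) * (\<eta> * N\<^sup>2)"
proof -
  let ?\<alpha> = "real_of_int p / real q"
  have eta0: "\<eta> > 0" using eta q by (smt (verit) divide_pos_pos of_nat_0_less_iff)
  show ?thesis
  proof (cases "near_multiples (?\<alpha> * real d) (\<kappa> * N\<^sup>2 / real d) (\<kappa> * \<eta>) = {}")
    case True
    show ?thesis unfolding True using k \<K> eta0 by (simp add: add_nonneg_nonneg)
  next
    case False
    then obtain a e n where n: "(a, e) \<in> near_multiples (?\<alpha> * real d) (\<kappa> * N\<^sup>2 / real d) (\<kappa> * \<eta>)" "1 \<le> n"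
      "real a \<le> (\<kappa> * N\<^sup>2 / real d) / n" "\<bar>?\<alpha> * real d * real a - real_of_int e\<bar> \<le> 2 * (\<kappa> * \<eta>) / n"
      "real (card (near_multiples (?\<alpha> * real d) (\<kappa> * N\<^sup>2 / real d) (\<kappa> * \<eta>))) \<le> 10 * (\<kappa> * N\<^sup>2 / real d) * (\<kappa> * \<eta>) + 2 * n"
      by (rule card_near_multiples_le)
    define m where "m = d * a"
    have "a \<ge> 1" using n(1) unfolding near_multiples_def by simp
    then have "m \<ge> 1" unfolding m_def using d by simp
    then have m0: "real m \<ge> 1" "m > 0" by auto
    have rm: "real m = real d * real a" unfolding m_def by simp
    have d0: "real d > 0" using d by simp
    have n1: "n \<le> \<kappa> * N\<^sup>2 / real m"
    proof -
      have "n * (real d * real a) \<le> \<kappa> * N\<^sup>2" using n(2,3) d0 by (simp add: field_simps)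
      then show ?thesis unfolding rm[symmetric] using m0 by (simp add: field_simps)
    qed
    \<comment> \<open>The type bounds |\<alpha> m - e| below by 1 / (\<K> m^(1+\<gamma>)), and the
      short vector bounds it above by 2 \<kappa> \<eta> / n.\<close>
    have n2: "n \<le> 2 * \<K> * (\<kappa> * \<eta>) * real m powr (1 + \<gamma>)"
    proof -
      have t0: "0 < \<bar>?\<alpha> * real m - real_of_int e\<bar>" using n(1) unfolding rm near_multiples_def by (auto simp: mult.assoc)
      then have ne: "real_of_int e / real m \<noteq> ?\<alpha>" using m0 by (auto simp: field_simps)
      have "1 / (\<K> * real m powr (2 + \<gamma>)) \<le> \<bar>?\<alpha> - real_of_int e / real m\<bar>"
        by (rule rat_of_type_real[OF type m0(2) ne])
      then have "real m * (1 / (\<K> * real m powr (2 + \<gamma>))) \<le> real m * \<bar>?\<alpha> - real_of_int e / real m\<bar>"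
        by (intro mult_left_mono) auto
      also have "real m * \<bar>?\<alpha> - real_of_int e / real m\<bar> = \<bar>real m * (?\<alpha> - real_of_int e / real m)\<bar>" by (simp add: abs_mult)
      also have "real m * (?\<alpha> - real_of_int e / real m) = ?\<alpha> * real m - real_of_int e" using m0 by (simp add: algebra_simps)
      also have "\<bar>?\<alpha> * real m - real_of_int e\<bar> \<le> 2 * (\<kappa> * \<eta>) / n" using n(4) unfolding rm by (simp add: mult.assoc)
      finally have a: "real m * (1 / (\<K> * real m powr (2 + \<gamma>))) \<le> 2 * (\<kappa> * \<eta>) / n" .
      have "real m powr (2 + \<gamma>) = real m powr (1 + (1 + \<gamma>))" by (simp add: add.assoc[symmetric])
      also have "\<dots> = real m * real m powr (1 + \<gamma>)" using m0 by (subst powr_add) simp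
      finally have "real m * (1 / (\<K> * real m powr (2 + \<gamma>))) = 1 / (\<K> * real m powr (1 + \<gamma>))" using m0 by simp
      then have "1 / (\<K> * real m powr (1 + \<gamma>)) \<le> 2 * (\<kappa> * \<eta>) / n" using a by simp
      then show ?thesis using n(2) \<K> m0 by (simp add: field_simps)
    qed
    have "n \<le> (1 + 2 * \<K>) * \<kappa> * N powr (- c) * (\<eta> * N\<^sup>2)"
    \<comment> \<open>For m \<ge> N^c / \<eta> the first bound on n suffices. Below this, the second
      one does: 1 / \<eta> \<le> q, and \<open>qN\<close> then leaves the saving N^(-c).\<close>
    proof (cases "N powr c / \<eta> \<le> real m")
      case True
      have "n \<le> \<kappa> * N\<^sup>2 / (N powr c / \<eta>)" using n1 divide_left_mono[OF True, of "\<kappa> * N\<^sup>2"] k N eta0 m0 by simp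
      also have "\<dots> = 1 * (\<kappa> * N powr (- c) * (\<eta> * N\<^sup>2))" using N eta0 by (simp add: powr_minus field_simps)
      also have "\<dots> \<le> (1 + 2 * \<K>) * (\<kappa> * N powr (- c) * (\<eta> * N\<^sup>2))" using \<K> k eta0 by (intro mult_right_mono) auto
      finally show ?thesis by (simp add: mult.assoc)
    next
      case False
      have g: "1 + \<gamma> > 0" using \<gamma> by simp
      have "real m powr (1 + \<gamma>) \<le> (N powr c / \<eta>) powr (1 + \<gamma>)" using False g by (intro powr_mono2) auto
      also have "\<dots> = N powr (c * (1 + \<gamma>)) * (1 / \<eta>) powr (1 + \<gamma>)"
        using eta0 N by (subst powr_divide) (auto simp: powr_powr powr_divide)
      also have "\<dots> \<le> N powr (c * (1 + \<gamma>)) * real q powr (1 + \<gamma>)"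
      proof (intro mult_left_mono powr_mono2)
        show "1 / \<eta> \<le> real q" using eta eta0 q by (simp add: field_simps)
      qed (use g eta0 in auto)
      also have "\<dots> = N powr (- c) * (N powr (c * (2 + \<gamma>)) * real q powr (1 + \<gamma>))"
        by (simp add: powr_add[symmetric] algebra_simps)
      also have "\<dots> \<le> N powr (- c) * N\<^sup>2" by (intro mult_left_mono qN) auto
      finally have "2 * \<K> * (\<kappa> * \<eta>) * real m powr (1 + \<gamma>) \<le> 2 * \<K> * (\<kappa> * \<eta>) * (N powr (- c) * N\<^sup>2)"
        using \<K> k eta0 by (intro mult_left_mono) auto
      then have "n \<le> 2 * \<K> * (\<kappa> * \<eta>) * (N powr (- c) * N\<^sup>2)" using n2 by linarith
      also have "\<dots> = 2 * \<K> * (\<kappa> * N powr (- c) * (\<eta> * N\<^sup>2))" by simp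
      also have "\<dots> \<le> (1 + 2 * \<K>) * (\<kappa> * N powr (- c) * (\<eta> * N\<^sup>2))" using \<K> k eta0 by (intro mult_right_mono) auto
      finally show ?thesis by (simp add: mult.assoc)
    qed
    moreover have "10 * (\<kappa> * N\<^sup>2 / real d) * (\<kappa> * \<eta>) = 10 * \<kappa>\<^sup>2 * (\<eta> * N\<^sup>2) / real d" by (simp add: power2_eq_square)
    moreover have "2 * (1 + 2 * \<K>) * \<kappa> * N powr (- c) * (\<eta> * N\<^sup>2) = 2 * ((1 + 2 * \<K>) * \<kappa> * N powr (- c) * (\<eta> * N\<^sup>2))" by simp
    ultimately show ?thesis using n(5) by linarith
  qed
qed

text \<open>The alternatives of the trichotomy become the three terms. An exact relation means q | a
  v, hence q \<le> v gcd(a, q) and N / v \<le> N gcd(a, q) / q; a short vector makes some term of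
  the dyadic sum at least 12 * 2^j > 6 n.\<close>

lemma hits_error_le:
  fixes p :: int and q a :: nat
  assumes q: "q > 0" and cop: "coprime p (int q)" and eta: "\<eta> > 0" and N: "N \<ge> 1" and a: "a \<ge> 1"
    and E: "E \<ge> 1" "\<eta> * N \<le> E * E" "\<eta> \<le> E" and \<alpha>: "\<alpha> = real_of_int p / real q"
  shows "\<bar>(\<Sum>b\<in>{1..nat \<lfloor>N\<rfloor>}. real (hits (\<alpha> * real a) \<eta> b)) - 2 * \<eta> * N\<bar> \<le> 10 * E + 3 * (N / real q) * real (gcd a q)
     + (\<Sum>j\<in>{j. E < 2 ^ (j + 1) \<and> 2 ^ j \<le> N}. 12 * 2 ^ j * real (card (near_multiples (\<alpha> * real a) (N / 2 ^ j) (2 * \<eta> / 2 ^ j))))"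
    (is "?err \<le> _ + _ + (\<Sum>j\<in>?Js. ?f j)")
proof -
  have finJ: "finite ?Js" by (rule finite_dyadic_range)
  have pos: "(\<Sum>j\<in>?Js. ?f j) \<ge> 0" by (intro sum_nonneg) auto
  have g0: "3 * (N / real q) * real (gcd a q) \<ge> 0" using N by simp
  from hits_trichotomy[OF eta N E, of "\<alpha> * real a"] show ?thesis
  proof (elim disjE exE conjE)
    assume "?err \<le> 10 * E"
    then show ?thesis using pos g0 by linarith
  next
    fix v :: nat and u :: int
    assume v: "1 \<le> v" and av: "\<alpha> * real a * real v = real_of_int u" and err: "?err \<le> 10 * E + 3 * N / real v"
    have "real_of_int p * real a * real v = real_of_int u * real q" using av q unfolding \<alpha> by (simp add: field_simps)
    then have "real_of_int (p * int (a * v)) = real_of_int (u * int q)" by (simp add: mult.assoc)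
    then have "p * int (a * v) = u * int q" by linarith
    then have "int q dvd p * int (a * v)" by simp
    then have "int q dvd int (a * v)" using cop by (simp add: coprime_dvd_mult_right_iff coprime_commute)
    then have "q dvd a * v" by (simp only: int_dvd_int_iff)
    then have "q dvd gcd (v * a) (v * q)" by (simp add: mult.commute)
    then have "q dvd v * gcd a q" by (simp only: gcd_mult_distrib_nat)
    then have "q dvd gcd a q * v" by (simp only: mult.commute)
    moreover have "gcd a q * v > 0" using v q by simp
    ultimately have "q \<le> gcd a q * v" by (rule dvd_imp_le)
    then have "real q \<le> real (gcd a q) * real v" by (metis of_nat_le_iff of_nat_mult)
    then have "N * real q \<le> N * (real (gcd a q) * real v)" using N by (intro mult_left_mono) auto
    then have "N / real v \<le> N / real q * real (gcd a q)" using v q by (simp add: field_simps)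
    then show ?thesis using err pos by simp
  next
    fix v :: nat and u :: int and n
    assume v: "1 \<le> v" and n: "E < n" and vn: "real v \<le> N / n" and u: "0 < \<bar>\<alpha> * real a * real v - real_of_int u\<bar>"
      "\<bar>\<alpha> * real a * real v - real_of_int u\<bar> \<le> 2 * \<eta> / n" and err: "?err \<le> 10 * E + 6 * n"
    have n1: "1 \<le> n" using n E by simp
    obtain j :: nat where j: "2 ^ j \<le> n" "n < 2 ^ (j + 1)" by (rule dyadic_exponent[OF n1])
    have "N / n \<le> N / 2 ^ j" by (rule divide_left_mono) (use N n1 j in auto)
    moreover have "2 * \<eta> / n \<le> 2 * \<eta> / 2 ^ j" by (rule divide_left_mono) (use eta n1 j in auto)
    ultimately have vj: "real v \<le> N / 2 ^ j" "\<bar>\<alpha> * real a * real v - real_of_int u\<bar> \<le> 2 * \<eta> / 2 ^ j" using vn u(2) by linarith+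
    then have "(v, u) \<in> near_multiples (\<alpha> * real a) (N / 2 ^ j) (2 * \<eta> / 2 ^ j)" using v u(1) unfolding near_multiples_def by auto
    then have "card (near_multiples (\<alpha> * real a) (N / 2 ^ j) (2 * \<eta> / 2 ^ j)) \<ge> 1"
      by (metis One_nat_def Suc_leI card_gt_0_iff empty_iff finite_near_multiples)
    then have fj: "12 * 2 ^ j \<le> ?f j" by simp
    have "1 \<le> real v" using v by simp
    then have "1 \<le> N / 2 ^ j" using vj(1) by linarith
    then have "2 ^ j \<le> N" by (simp add: field_simps)
    then have "j \<in> ?Js" using j n by auto
    then have "?f j \<le> (\<Sum>j\<in>?Js. ?f j)" by (intro member_le_sum finJ) auto
    moreover have "6 * n \<le> 12 * 2 ^ j" using j by simp
    ultimately show ?thesis using err fj g0 by linarith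
  qed
qed

text \<open>Averaging over a turns gcd(a, q) into \<tau>(q), and the pairs of a multiplier a and a
  short v into \<open>near_products\<close>.\<close>

lemma sum_hits_error_le:
  fixes p :: int and q :: nat
  assumes q: "q > 0" and cop: "coprime p (int q)" and eta: "\<eta> > 0" and N: "N \<ge> 1" and M: "M > 0"
    and E: "E \<ge> 1" "\<eta> * N \<le> E * E" "\<eta> \<le> E" and \<alpha>: "\<alpha> = real_of_int p / real q"
  shows "\<bar>(\<Sum>a\<in>{1..nat \<lfloor>M\<rfloor>}. \<Sum>b\<in>{1..nat \<lfloor>N\<rfloor>}. real (hits (\<alpha> * real a) \<eta> b)) - 2 * \<eta> * N * real (nat \<lfloor>M\<rfloor>)\<bar>
     \<le> 10 * E * M + 3 * (N / real q) * (M * real (divisor_tau q))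
     + (\<Sum>j\<in>{j. E < 2 ^ (j + 1) \<and> 2 ^ j \<le> N}. 12 * 2 ^ j * real (card (near_products \<alpha> (N / 2 ^ j) M (2 * \<eta> / 2 ^ j))))"
    (is "_ \<le> _ + _ + (\<Sum>j\<in>?Js. _)")
proof -
  let ?A = "{1..nat \<lfloor>M\<rfloor>}"
  have Mf: "real (nat \<lfloor>M\<rfloor>) \<le> M" using M by linarith
  have "\<bar>(\<Sum>a\<in>?A. \<Sum>b\<in>{1..nat \<lfloor>N\<rfloor>}. real (hits (\<alpha> * real a) \<eta> b)) - 2 * \<eta> * N * real (nat \<lfloor>M\<rfloor>)\<bar>
    = \<bar>\<Sum>a\<in>?A. (\<Sum>b\<in>{1..nat \<lfloor>N\<rfloor>}. real (hits (\<alpha> * real a) \<eta> b)) - 2 * \<eta> * N\<bar>"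
    by (simp add: sum_subtractf mult.commute)
  also have "\<dots> \<le> (\<Sum>a\<in>?A. \<bar>(\<Sum>b\<in>{1..nat \<lfloor>N\<rfloor>}. real (hits (\<alpha> * real a) \<eta> b)) - 2 * \<eta> * N\<bar>)" by (rule sum_abs)
  also have "\<dots> \<le> (\<Sum>a\<in>?A. 10 * E + 3 * (N / real q) * real (gcd a q)
     + (\<Sum>j\<in>?Js. 12 * 2 ^ j * real (card (near_multiples (\<alpha> * real a) (N / 2 ^ j) (2 * \<eta> / 2 ^ j)))))"
    by (intro sum_mono hits_error_le[OF q cop eta N _ E \<alpha>]) auto
  also have "\<dots> = 10 * E * real (nat \<lfloor>M\<rfloor>) + 3 * (N / real q) * real (\<Sum>a\<in>?A. gcd a q)
     + (\<Sum>j\<in>?Js. \<Sum>a\<in>?A. 12 * 2 ^ j * real (card (near_multiples (\<alpha> * real a) (N / 2 ^ j) (2 * \<eta> / 2 ^ j))))"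
  proof -
    have "(\<Sum>a\<in>?A. \<Sum>j\<in>?Js. 12 * 2 ^ j * real (card (near_multiples (\<alpha> * real a) (N / 2 ^ j) (2 * \<eta> / 2 ^ j))))
      = (\<Sum>j\<in>?Js. \<Sum>a\<in>?A. 12 * 2 ^ j * real (card (near_multiples (\<alpha> * real a) (N / 2 ^ j) (2 * \<eta> / 2 ^ j))))"
      by (rule sum.swap)
    then show ?thesis unfolding sum.distrib by (simp add: sum_distrib_left)
  qed
  also have "\<dots> \<le> 10 * E * M + 3 * (N / real q) * (M * real (divisor_tau q))
     + (\<Sum>j\<in>?Js. 12 * 2 ^ j * real (card (near_products \<alpha> (N / 2 ^ j) M (2 * \<eta> / 2 ^ j))))"
  proof (intro add_mono mult_left_mono sum_mono)
    have "real (\<Sum>a\<in>?A. gcd a q) \<le> real (nat \<lfloor>M\<rfloor>) * real (divisor_tau q)"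
      using sum_gcd_le[OF q, of "nat \<lfloor>M\<rfloor>"] by (metis of_nat_le_iff of_nat_mult)
    also have "\<dots> \<le> M * real (divisor_tau q)" using Mf by (intro mult_right_mono) auto
    finally show "real (\<Sum>a\<in>?A. gcd a q) \<le> M * real (divisor_tau q)" .
    fix j
    show "(\<Sum>a\<in>?A. 12 * 2 ^ j * real (card (near_multiples (\<alpha> * real a) (N / 2 ^ j) (2 * \<eta> / 2 ^ j)))) \<le> 12 * 2 ^ j * real (card (near_products \<alpha> (N / 2 ^ j) M (2 * \<eta> / 2 ^ j)))"
      unfolding card_near_products nat_Icc_real by (simp add: sum_distrib_left)
  qed (use E Mf N in auto)
  finally show ?thesis .
qed

text \<open>Multipliers up to M \<le> c2 N and vectors up to N / 2^j fit into a box of scale 2 c2 /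
  2^j; E \<ge> 4 c2 / \<kappa>1 keeps that scale within \<kappa>1.\<close>

lemma (in equidistributed_bohr) near_products_dyadic_sum_le:
  assumes cl: "claim_upto C \<epsilon> r \<kappa>1" and r: "0 < r" "r \<le> 1/5" and C: "C \<ge> 0" and eps: "\<epsilon> \<ge> 0" and k1: "\<kappa>1 > 0"
    and c2: "c2 \<ge> 1" and M: "0 < M" "M \<le> c2 * N" and E: "E \<ge> 1" "4 * c2 / \<kappa>1 \<le> E"
  shows "(\<Sum>j\<in>{j. E < 2 ^ (j + 1) \<and> 2 ^ j \<le> N}. 12 * 2 ^ j * real (card (near_products \<alpha> (N / 2 ^ j) M (2 * \<eta> / 2 ^ j))))
     \<le> 3 * rec_const r * C * c2\<^sup>2 * (E powr (- (1/5)) + \<epsilon>) * W" (is "(\<Sum>j\<in>?Js. _) \<le> _")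
proof -
  have finJ: "finite ?Js" by (rule finite_dyadic_range)
  have K0: "rec_const r \<ge> 0" using rec_const_ge[OF r(1)] by simp
  have "(\<Sum>j\<in>?Js. 12 * 2 ^ j * real (card (near_products \<alpha> (N / 2 ^ j) M (2 * \<eta> / 2 ^ j))))
     \<le> (\<Sum>j\<in>?Js. 12 * 2 ^ j * (C * ((2 * c2 / 2 ^ j) powr (1 + 1/5) + \<epsilon> * (2 * c2 / 2 ^ j) powr (1 + r)) * W))"
  proof (intro sum_mono mult_left_mono)
    fix j assume j: "j \<in> ?Js"
    let ?k = "2 * c2 / 2 ^ j"
    have "?k \<le> 4 * c2 / E" using j c2 E by (auto simp: field_simps)
    also have "\<dots> \<le> \<kappa>1" using E k1 by (simp add: field_simps)
    finally have k: "?k \<le> \<kappa>1" .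
    have "N * M \<le> N * (c2 * N)" using M N3 by (intro mult_left_mono) auto
    also have "\<dots> \<le> 2 * c2 * N\<^sup>2" using c2 N3 by (simp add: power2_eq_square)
    finally have "N / 2 ^ j * M \<le> ?k * N\<^sup>2" by (simp add: field_simps)
    then have "real (card (near_products \<alpha> (N / 2 ^ j) M (?k * \<eta>))) \<le> C * (?k powr (1 + 1/5) + \<epsilon> * ?k powr (1 + r)) * W"
      using cl[unfolded claim_upto_def, rule_format, of ?k "N / 2 ^ j" M] k c2 M N3 by simp
    moreover have "2 * \<eta> / 2 ^ j \<le> ?k * \<eta>" using c2 eta by (simp add: divide_right_mono)
    then have "card (near_products \<alpha> (N / 2 ^ j) M (2 * \<eta> / 2 ^ j)) \<le> card (near_products \<alpha> (N / 2 ^ j) M (?k * \<eta>))" by (intro near_products_mono) auto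
    ultimately show "real (card (near_products \<alpha> (N / 2 ^ j) M (2 * \<eta> / 2 ^ j))) \<le> C * (?k powr (1 + 1/5) + \<epsilon> * ?k powr (1 + r)) * W" by linarith
  qed auto
  also have "\<dots> = 3 * C * W * ((\<Sum>j\<in>?Js. 2 ^ (j + 2) * (2 * c2 / 2 ^ j) powr (1 + 1/5)) + \<epsilon> * (\<Sum>j\<in>?Js. 2 ^ (j + 2) * (2 * c2 / 2 ^ j) powr (1 + r)))"
    by (simp only: sum_distrib_left sum.distrib[symmetric]) (rule sum.cong, auto simp: algebra_simps)
  also have "\<dots> \<le> 3 * C * W * (rec_const r * (c2\<^sup>2 * E powr (- (1/5))) + \<epsilon> * (rec_const r * (c2\<^sup>2 * 1)))"
  proof (intro mult_left_mono add_mono)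
    have p2: "c2 powr s \<le> c2\<^sup>2" if "s \<le> 2" for s
    proof -
      have "c2 powr s \<le> c2 powr 2" using that c2 by (intro powr_mono) auto
      then show ?thesis using c2 by simp
    qed
    have "(\<Sum>j\<in>?Js. 2 ^ (j + 2) * (2 * c2 / 2 ^ j) powr (1 + 1/5)) \<le> rec_const r * (c2 powr (1 + 1/5) * E powr (- (1/5)))"
      by (rule dyadic_power_sum_le[OF finJ _ E(1)]) (use r c2 in auto)
    also have "\<dots> \<le> rec_const r * (c2\<^sup>2 * E powr (- (1/5)))" using K0 p2 by (intro mult_left_mono mult_right_mono) auto
    finally show "(\<Sum>j\<in>?Js. 2 ^ (j + 2) * (2 * c2 / 2 ^ j) powr (1 + 1/5)) \<le> rec_const r * (c2\<^sup>2 * E powr (- (1/5)))" .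
    have "(\<Sum>j\<in>?Js. 2 ^ (j + 2) * (2 * c2 / 2 ^ j) powr (1 + r)) \<le> rec_const r * (c2 powr (1 + r) * E powr (- r))"
      by (rule dyadic_power_sum_le[OF finJ _ E(1)]) (use r c2 in auto)
    also have "\<dots> \<le> rec_const r * (c2\<^sup>2 * 1)"
    proof (intro mult_left_mono mult_mono)
      show "E powr (- r) \<le> 1" using E r by (simp add: powr_minus ge_one_powr_ge_zero inverse_le_1_iff)
      show "c2 powr (1 + r) \<le> c2\<^sup>2" using r by (intro p2) simp
    qed (use K0 in auto)
    finally show "(\<Sum>j\<in>?Js. 2 ^ (j + 2) * (2 * c2 / 2 ^ j) powr (1 + r)) \<le> rec_const r * (c2\<^sup>2 * 1)" .
  qed (use C W_pos eps in auto)
  also have "\<dots> = 3 * rec_const r * C * c2\<^sup>2 * (E powr (- (1/5)) + \<epsilon>) * W" by (simp add: algebra_simps)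
  finally show ?thesis .
qed

lemma hits_le: "real (hits \<alpha> \<eta> b) \<le> 2 * \<eta> + 1" if "\<eta> \<ge> 0"
proof -
  have "{c::int. \<bar>\<alpha> * real b - real_of_int c\<bar> \<le> \<eta>} = {c. \<alpha> * real b - \<eta> \<le> real_of_int c \<and> real_of_int c \<le> \<alpha> * real b + \<eta>}"
    by (auto simp: abs_le_iff)
  then show ?thesis unfolding hits_def
    using card_int_Icc_real_le[where x = "\<alpha> * real b - \<eta>" and y = "\<alpha> * real b + \<eta>"] that by simp
qed

theorem theorem1p4:
  fixes C1 C2 \<gamma> \<K> \<delta> :: real
  assumes "C1 > 0" and "C2 > 0"
    and "0 < \<gamma>" and "\<gamma> < 1"
    and "\<K> > 0"
    and "\<delta> > 0"
  shows "\<exists>C::real. \<forall>(K::real) (M::real) (N::real) (p::int) (q::nat).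
    K \<ge> 3 \<longrightarrow> M \<ge> 3 \<longrightarrow> N \<ge> 3 \<longrightarrow>
    C1 * N \<le> M \<longrightarrow> M \<le> C2 * N \<longrightarrow>
    q > 0 \<longrightarrow> coprime p (int q) \<longrightarrow>
    rat_of_type (of_int p / of_nat q) (2 + \<gamma>) \<K> \<longrightarrow>
    real q powr (1 + \<delta>) \<le> (N\<^sup>2 / K) powr (1 / (1 + \<gamma>)) \<longrightarrow>
    K * N / real q \<ge> 1 \<longrightarrow>
    \<bar>residue_sum p q K M N - 2 * K * M * N / real q\<bar>
      \<le> C * (N * (K * N / real q) powr (7/8)
             + N\<^sup>2 / real q * (real (divisor_tau q) ^ 2 * ln N ^ 3
                                + K * ln (ln N) ^ 2 / ln N powr (1/4)))"
proof -
  \<comment> \<open>Chosen so that 3 c = 2 - 2 / (1 + \<delta>): as 2 + \<gamma> < 3, the size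
    condition on q then yields \<open>qN\<close>.\<close>
  define c where "c = 2 * \<delta> / (3 * (1 + \<delta>))"
  define D where "D = 2 * (1 + 2 * \<K>)"
  have c: "0 < c" "c \<le> 1" unfolding c_def using assms(6) by (auto simp: field_simps)
  have c3: "3 * c = 2 - 2 / (1 + \<delta>)" unfolding c_def using assms(6) by (simp add: field_simps)
  have D0: "D \<ge> 0" unfolding D_def using assms(5) by simp
  obtain \<kappa>1 C N0 where k1: "\<kappa>1 > 0" and C: "C \<ge> 0" and
    main: "\<And>\<alpha> \<eta> N W. equidistributed_bohr \<alpha> \<eta> N W c D \<Longrightarrow> N \<ge> N0 \<Longrightarrow> equidistributed_bohr.claim_upto \<alpha> \<eta> N W C (N powr (- (c / 8))) (c / 16) \<kappa>1"
    using near_products_claim_uniform[OF c D0] by metis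
  have "\<forall>\<^sub>F N in at_top. N powr (- (c / 8)) \<le> ln (ln N) ^ 2 / ln N powr (1/4)" using c by real_asymp
  \<comment> \<open>The induction leaves N^(-c/8), which is eventually below the double logarithmic
    factor of the statement.\<close>
  then obtain N1 where N1: "\<And>N. N \<ge> N1 \<Longrightarrow> N powr (- (c / 8)) \<le> ln (ln N) ^ 2 / ln N powr (1/4)"
    unfolding eventually_at_top_linorder by blast
  define N2 where "N2 = max 3 (max N0 N1)"
  define c2 where "c2 = max 1 C2"
  \<comment> \<open>4 c2 / \<kappa>1 brings all scales of the tail within \<kappa>1; the 2 gives E^2
    \<ge> 4 T^(7/4), which exceeds \<eta> N.\<close>
  define E0 where "E0 = max 2 (4 * c2 / \<kappa>1)"
  define r where "r = c / 16"
  have r: "0 < r" "r \<le> 1/5" unfolding r_def using c by auto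
  define Ct where "Ct = 3 * rec_const r * C * c2\<^sup>2"
  have Ct0: "Ct \<ge> 0" unfolding Ct_def using rec_const_ge[OF r(1)] C by simp
  \<comment> \<open>The trivial bound for N < \<open>N2\<close>, using K \<le> N^2; it suffices
    because the error term is at least 3.\<close>
  define C6 where "C6 = c2 * N2\<^sup>2 * (4 * N2\<^sup>2 + 2)"
  define Cf where "Cf = 3 + 10 * E0 * c2 + 4 * c2 + 2 * Ct + C6"
  have c21: "c2 \<ge> 1" "C2 \<le> c2" unfolding c2_def by auto
  have E02: "E0 \<ge> 2" "4 * c2 / \<kappa>1 \<le> E0" unfolding E0_def by auto
  have C60: "C6 \<ge> 0" unfolding C6_def using c21 by simp
  have E0c2: "E0 * c2 \<ge> 0" using E02 c21 by simp
  show ?thesis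
  proof (intro exI[of _ Cf] allI impI)
    fix K M N :: real and p :: int and q :: nat
    assume K: "K \<ge> 3" and M: "M \<ge> 3" and N: "N \<ge> 3" and "C1 * N \<le> M" and MN: "M \<le> C2 * N" and q: "q > 0"
      and cop: "coprime p (int q)" and type: "rat_of_type (of_int p / of_nat q) (2 + \<gamma>) \<K>"
      and size: "real q powr (1 + \<delta>) \<le> (N\<^sup>2 / K) powr (1 / (1 + \<gamma>))" and KN: "K * N / real q \<ge> 1"
    define T where "T = K * N / real q"
    define \<alpha> where "\<alpha> = real_of_int p / real q"
    define \<eta> where "\<eta> = (real_of_int \<lfloor>K\<rfloor> + 1/2) / real q"
    define W where "W = \<eta> * N\<^sup>2"
    define X1 where "X1 = N * T powr (7/8)"
    define X2 where "X2 = N\<^sup>2 / real q * (real (divisor_tau q) ^ 2 * ln N ^ 3)"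
    define X3 where "X3 = N\<^sup>2 / real q * (K * ln (ln N) ^ 2 / ln N powr (1/4))"
    have goalX: "N * (K * N / real q) powr (7/8) + N\<^sup>2 / real q * (real (divisor_tau q) ^ 2 * ln N ^ 3 + K * ln (ln N) ^ 2 / ln N powr (1/4)) = X1 + X2 + X3"
      unfolding X1_def X2_def X3_def T_def by (simp only: distrib_left)
    have T1: "T \<ge> 1" unfolding T_def by (rule KN)
    have q1: "real q \<ge> 1" using q by simp
    have lnN: "ln N \<ge> 1"
    proof -
      have "exp 1 \<le> N" using exp_le N by linarith
      then show ?thesis using N by (subst ln_ge_iff) auto
    qed
    have X10: "X1 \<ge> 3"
    proof -
      have "1 \<le> T powr (7/8)" using T1 by (simp add: ge_one_powr_ge_zero)
      then have "3 * 1 \<le> N * T powr (7/8)" using N by (intro mult_mono) auto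
      then show ?thesis unfolding X1_def by simp
    qed
    have X20: "X2 \<ge> 0" unfolding X2_def using lnN N by (intro mult_nonneg_nonneg divide_nonneg_nonneg) auto
    have X30: "X3 \<ge> 0" unfolding X3_def using lnN N K by (intro mult_nonneg_nonneg divide_nonneg_nonneg) auto
    have g0: "1 + \<gamma> > 0" "1 / (1 + \<gamma>) > 0" using assms(3) by auto
    \<comment> \<open>For K > N^2 the right side of the size condition would be below 1 although q
      \<ge> 1.\<close>
    have KN2: "K \<le> N\<^sup>2"
    proof (rule ccontr)
      assume "\<not> K \<le> N\<^sup>2"
      then have "0 < N\<^sup>2 / K" "N\<^sup>2 / K < 1" using K N by auto
      then have "(N\<^sup>2 / K) powr (1 / (1 + \<gamma>)) < 1 powr (1 / (1 + \<gamma>))" using g0 by (intro powr_less_mono2) auto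
      moreover have "1 \<le> real q powr (1 + \<delta>)" using q1 assms(6) by (simp add: ge_one_powr_ge_zero)
      ultimately show False using size by simp
    qed
    have qg: "real q powr (1 + \<gamma>) \<le> N powr (2 / (1 + \<delta>))"
    proof -
      have N2p: "N\<^sup>2 = N powr 2" using N by simp
      have "real q powr (1 + \<delta>) \<le> (N\<^sup>2) powr (1 / (1 + \<gamma>))"
      proof -
        have "N\<^sup>2 / K \<le> N\<^sup>2 / 1" using K N by (intro divide_left_mono) auto
        then have "(N\<^sup>2 / K) powr (1 / (1 + \<gamma>)) \<le> (N\<^sup>2) powr (1 / (1 + \<gamma>))" using g0 K by (intro powr_mono2) auto
        then show ?thesis using size by linarith
      qed
      then have "(real q powr (1 + \<delta>)) powr ((1 + \<gamma>) / (1 + \<delta>)) \<le> ((N\<^sup>2) powr (1 / (1 + \<gamma>))) powr ((1 + \<gamma>) / (1 + \<delta>))"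
        using assms(3,6) by (intro powr_mono2) auto
      moreover have "(real q powr (1 + \<delta>)) powr ((1 + \<gamma>) / (1 + \<delta>)) = real q powr (1 + \<gamma>)"
        using assms(6) by (simp add: powr_powr)
      moreover have "((N\<^sup>2) powr (1 / (1 + \<gamma>))) powr ((1 + \<gamma>) / (1 + \<delta>)) = N powr (2 / (1 + \<delta>))"
      proof -
        have "2 * (1 / (1 + \<gamma>)) * ((1 + \<gamma>) / (1 + \<delta>)) = 2 / (1 + \<delta>)" using g0 assms(6) by (simp add: divide_simps)
        then show ?thesis unfolding N2p powr_powr by (simp only:)
      qed
      ultimately show ?thesis by simp
    qed
    have qN: "N powr (c * (2 + \<gamma>)) * real q powr (1 + \<gamma>) \<le> N\<^sup>2"
    proof -
      have "c * (2 + \<gamma>) \<le> c * 3" using c assms(4) by (intro mult_left_mono) auto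
      then have "N powr (c * (2 + \<gamma>)) \<le> N powr (2 - 2 / (1 + \<delta>))" using N c3 by (intro powr_mono) auto
      then have "N powr (c * (2 + \<gamma>)) * real q powr (1 + \<gamma>) \<le> N powr (2 - 2 / (1 + \<delta>)) * N powr (2 / (1 + \<delta>))"
        using qg by (intro mult_mono) auto
      also have "\<dots> = N powr 2" unfolding powr_add[symmetric] by simp
      finally show ?thesis using N by simp
    qed
    have fl: "real_of_int \<lfloor>K\<rfloor> + 1/2 \<ge> 5/6 * K" "real_of_int \<lfloor>K\<rfloor> + 1/2 \<le> 7/6 * K" "real_of_int \<lfloor>K\<rfloor> \<ge> 3"
      "\<bar>real_of_int \<lfloor>K\<rfloor> + 1/2 - K\<bar> \<le> 1/2"
    proof -
      show "real_of_int \<lfloor>K\<rfloor> + 1/2 \<ge> 5/6 * K" "real_of_int \<lfloor>K\<rfloor> + 1/2 \<le> 7/6 * K" "\<bar>real_of_int \<lfloor>K\<rfloor> + 1/2 - K\<bar> \<le> 1/2"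
        using K by linarith+
      have "3 \<le> \<lfloor>K\<rfloor>" using K by (simp add: le_floor_iff)
      then show "real_of_int \<lfloor>K\<rfloor> \<ge> 3" by simp
    qed
    have f0: "0 < real_of_int \<lfloor>K\<rfloor> + 1/2" "1 \<le> real_of_int \<lfloor>K\<rfloor> + 1/2" using fl(3) by linarith+
    have eta0: "\<eta> > 0" unfolding \<eta>_def by (rule divide_pos_pos[OF f0(1)]) (use q1 in linarith)
    have etaq: "1 / real q \<le> \<eta>" unfolding \<eta>_def by (rule divide_right_mono[OF f0(2)]) (use q1 in linarith)
    have etaN: "\<eta> * N \<le> 7/6 * T" "1/2 \<le> \<eta> * N"
    proof -
      have "\<eta> * N = (real_of_int \<lfloor>K\<rfloor> + 1/2) * (N / real q)" unfolding \<eta>_def by simp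
      moreover have "T = K * (N / real q)" unfolding T_def by simp
      moreover have "(real_of_int \<lfloor>K\<rfloor> + 1/2) * (N / real q) \<le> 7/6 * K * (N / real q)" "5/6 * K * (N / real q) \<le> (real_of_int \<lfloor>K\<rfloor> + 1/2) * (N / real q)"
        using fl(1,2) N by (intro mult_right_mono; simp)+
      ultimately show "\<eta> * N \<le> 7/6 * T" "1/2 \<le> \<eta> * N" using T1 by linarith+
    qed
    \<comment> \<open>K \<le> N^2 gives T \<le> N^3, ample for T^(1/8) \<le> N.\<close>
    have T8: "T \<le> N * T powr (7/8)" "T powr (1/8) \<le> N"
    proof -
      have "T \<le> K * N" unfolding T_def using q1 K N by (simp add: divide_le_eq mult_left_le)
      also have "\<dots> \<le> N\<^sup>2 * N" using KN2 N by (intro mult_right_mono) auto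
      also have "\<dots> = N powr 3" using N by (simp add: power2_eq_square power3_eq_cube)
      also have "\<dots> \<le> N powr 8" using N by (intro powr_mono) auto
      finally have "T powr (1/8) \<le> (N powr 8) powr (1/8)" using T1 by (intro powr_mono2) auto
      also have "(N powr 8) powr (1/8) = N" unfolding powr_powr using N by simp
      finally show t: "T powr (1/8) \<le> N" .
      have "T = T powr (1/8) * T powr (7/8)" unfolding powr_add[symmetric] using T1 by simp
      also have "\<dots> \<le> N * T powr (7/8)" using t by (intro mult_right_mono) auto
      finally show "T \<le> N * T powr (7/8)" .
    qed
    have alt: "2 * K * M * N / real q = 2 * (K / real q) * M * N" by simp
    have Rsum: "residue_sum p q K M N = (\<Sum>a\<in>{1..nat \<lfloor>M\<rfloor>}. \<Sum>b\<in>{1..nat \<lfloor>N\<rfloor>}. real (hits (\<alpha> * real a) \<eta> b))"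
      unfolding \<alpha>_def \<eta>_def by (rule residue_sum_eq_hits[OF q])
    have Mc: "M \<le> c2 * N" using MN c21 N mult_right_mono[of C2 c2 N] by linarith
    show "\<bar>residue_sum p q K M N - 2 * K * M * N / real q\<bar>
      \<le> Cf * (N * (K * N / real q) powr (7/8) + N\<^sup>2 / real q * (real (divisor_tau q) ^ 2 * ln N ^ 3 + K * ln (ln N) ^ 2 / ln N powr (1/4)))"
      unfolding goalX
    proof (cases "N \<ge> N2")
      case False
      have R0: "residue_sum p q K M N \<ge> 0" unfolding Rsum by (intro sum_nonneg) auto
      have eK: "\<eta> \<le> K + 1/2"
      proof -
        have "\<eta> \<le> (real_of_int \<lfloor>K\<rfloor> + 1/2) / 1" unfolding \<eta>_def by (rule divide_left_mono) (use q1 f0 in linarith)+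
        then have "\<eta> \<le> real_of_int \<lfloor>K\<rfloor> + 1/2" by simp
        then show ?thesis by linarith
      qed
      have "residue_sum p q K M N \<le> (\<Sum>a\<in>{1..nat \<lfloor>M\<rfloor>}. \<Sum>b\<in>{1..nat \<lfloor>N\<rfloor>}. 2 * \<eta> + 1)"
        unfolding Rsum using eta0 by (intro sum_mono hits_le) simp
      also have "\<dots> = real (nat \<lfloor>M\<rfloor>) * (real (nat \<lfloor>N\<rfloor>) * (2 * \<eta> + 1))" by simp
      also have "\<dots> \<le> M * (N * (2 * K + 2))" using M N K eK eta0 by (intro mult_mono) auto
      finally have R1: "residue_sum p q K M N \<le> M * N * (2 * K + 2)" by simp
      have "2 * K * M * N / real q \<le> 2 * K * M * N / 1" using q1 K M N by (intro divide_left_mono) auto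
      have "2 * K * M * N / real q \<ge> 0" using K M N by simp
      have "\<bar>residue_sum p q K M N - 2 * K * M * N / real q\<bar> \<le> M * N * (4 * K + 2)"
      proof -
        have "M * N * (4 * K + 2) = M * N * (2 * K + 2) + 2 * K * M * N" by (simp add: algebra_simps)
        moreover have "M * N * (2 * K + 2) \<ge> 0" using K M N by simp
        ultimately show ?thesis using R0 R1 \<open>2 * K * M * N / real q \<le> 2 * K * M * N / 1\<close> \<open>2 * K * M * N / real q \<ge> 0\<close> unfolding div_by_1 by linarith
      qed
      also have "\<dots> \<le> (c2 * N * N) * (4 * N\<^sup>2 + 2)" using Mc KN2 M N K by (intro mult_mono) auto
      also have "\<dots> = c2 * N\<^sup>2 * (4 * N\<^sup>2 + 2)" by (simp add: power2_eq_square)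
      also have "\<dots> \<le> C6"
      proof -
        have "N\<^sup>2 \<le> N2\<^sup>2" using False N by (intro power_mono) auto
        then show ?thesis unfolding C6_def using c21 by (intro mult_mono) auto
      qed
      also have "\<dots> \<le> Cf * 1" unfolding Cf_def using c21 E0c2 Ct0 by simp
      also have "\<dots> \<le> Cf * (X1 + X2 + X3)"
        unfolding Cf_def using c21 E0c2 Ct0 C60 X10 X20 X30 by (intro mult_left_mono) auto
      finally show "\<bar>residue_sum p q K M N - 2 * K * M * N / real q\<bar> \<le> Cf * (X1 + X2 + X3)" .
    next
      case True
      have B: "equidistributed_bohr \<alpha> \<eta> N W c D"
      proof
        show "N \<le> 2 * W" unfolding W_def using mult_right_mono[OF etaN(2), of N] N by (simp add: power2_eq_square)
        fix \<kappa> :: real and d :: nat assume kd: "0 < \<kappa>" "\<kappa> \<le> 1" "1 \<le> d"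
        have "real (card (near_multiples (\<alpha> * real d) (\<kappa> * N\<^sup>2 / real d) (\<kappa> * \<eta>))) \<le> 10 * \<kappa>\<^sup>2 * (\<eta> * N\<^sup>2) / real d + 2 * (1 + 2 * \<K>) * \<kappa> * N powr (- c) * (\<eta> * N\<^sup>2)"
          unfolding \<alpha>_def by (rule card_near_multiples_rat_of_type[OF type assms(3,5) _ q etaq qN c(1) kd(1,3)]) (use N in simp)
        then show "real (card (near_multiples (\<alpha> * real d) (\<kappa> * N\<^sup>2 / real d) (\<kappa> * \<eta>))) \<le> 10 * \<kappa>\<^sup>2 * W / real d + D * \<kappa> * N powr (- c) * W"
          unfolding W_def D_def .
      qed (use N eta0 c D0 W_def in auto)
      \<comment> \<open>Multiplicities up to E cost E M, of order N T^(7/8). The tail beyond costs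
        E^(-1/5) W, of order at most T^(1-7/40) N, and 7/40 \<ge> 1/8.\<close>
      define E where "E = E0 * T powr (7/8)"
      have Tp: "T powr (7/8) \<ge> 1" using T1 by (simp add: ge_one_powr_ge_zero)
      have E0E: "E0 \<le> E" unfolding E_def using Tp E02 by simp
      have E1: "E \<ge> 1" "4 * c2 / \<kappa>1 \<le> E" using E0E E02 by auto
      have TE: "2 * T powr (7/8) \<le> E" unfolding E_def using E02 by (intro mult_right_mono) auto
      have EE: "\<eta> * N \<le> E * E"
      proof -
        have "T = T powr (1/8) * T powr (7/8)" unfolding powr_add[symmetric] using T1 by simp
        also have "\<dots> \<le> T powr (7/8) * T powr (7/8)" using T1 by (intro mult_right_mono powr_mono) auto
        finally have "T \<le> T powr (7/8) * T powr (7/8)" .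
        moreover have "(2 * T powr (7/8)) * (2 * T powr (7/8)) \<le> E * E" using TE E1(1) by (intro mult_mono) auto
        ultimately show ?thesis using etaN(1) T1 by linarith
      qed
      have eE: "\<eta> \<le> E"
      proof -
        have "\<eta> * N \<le> 2 * (N * T powr (7/8))" using etaN(1) T8(1) T1 by linarith
        also have "\<dots> \<le> E * N" using mult_right_mono[OF TE, of N] N by (simp add: mult_ac)
        finally show ?thesis using N by simp
      qed
      let ?tail = "\<Sum>j\<in>{j. E < 2 ^ (j + 1) \<and> 2 ^ j \<le> N}. 12 * 2 ^ j * real (card (near_products \<alpha> (N / 2 ^ j) M (2 * \<eta> / 2 ^ j)))"
      have m1: "\<bar>residue_sum p q K M N - 2 * \<eta> * N * real (nat \<lfloor>M\<rfloor>)\<bar> \<le> 10 * E * M + 3 * (N / real q) * (M * real (divisor_tau q)) + ?tail"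
        unfolding Rsum by (rule sum_hits_error_le[OF q cop eta0 _ _ E1(1) EE eE \<alpha>_def]) (use N M in auto)
      have NN: "N \<ge> N0" "N \<ge> N1" using True unfolding N2_def by auto
      have tail: "?tail \<le> Ct * (E powr (- (1/5)) + N powr (- (c / 8))) * W"
        unfolding Ct_def r_def
        by (rule equidistributed_bohr.near_products_dyadic_sum_le[OF B main[OF B NN(1)] _ _ C _ k1 c21(1) _ Mc E1]) (use c M in auto)
      have WT: "W \<le> 7/6 * (T * N)" "W \<ge> 0"
        unfolding W_def using mult_right_mono[OF etaN(1), of N] N eta0 by (simp_all add: power2_eq_square mult_ac)
      have w1: "E powr (- (1/5)) * W \<le> 2 * X1"
      proof -
        have "E powr (- (1/5)) \<le> (T powr (7/8)) powr (- (1/5))" using TE Tp by (intro powr_mono2') auto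
        also have "\<dots> = T powr (-7/40)" unfolding powr_powr by simp
        also have "\<dots> \<le> T powr (-1/8)" using T1 by (intro powr_mono) auto
        finally have "E powr (- (1/5)) * W \<le> T powr (-1/8) * (7/6 * (T * N))" using WT by (intro mult_mono) auto
        also have "\<dots> = 7/6 * (N * (T powr (-1/8) * T powr 1))" using T1 by simp
        also have "\<dots> = 7/6 * X1" unfolding X1_def powr_add[symmetric] by simp
        finally show ?thesis using X10 by linarith
      qed
      have w2: "N powr (- (c / 8)) * W \<le> 2 * X3"
      proof -
        have "N powr (- (c / 8)) * W \<le> (ln (ln N) ^ 2 / ln N powr (1/4)) * (7/6 * (T * N))"
          using N1[OF NN(2)] WT by (intro mult_mono) auto
        also have "\<dots> = 7/6 * X3" unfolding X3_def T_def by (simp add: power2_eq_square mult_ac)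
        finally show ?thesis using X30 by linarith
      qed
      have tail2: "?tail \<le> 2 * Ct * X1 + 2 * Ct * X3"
      proof -
        have "Ct * (E powr (- (1/5)) + N powr (- (c / 8))) * W = Ct * (E powr (- (1/5)) * W + N powr (- (c / 8)) * W)" by (simp add: algebra_simps)
        also have "\<dots> \<le> Ct * (2 * X1 + 2 * X3)" using w1 w2 Ct0 by (intro mult_left_mono add_mono) auto
        finally show ?thesis using tail by (simp add: algebra_simps)
      qed
      have EM: "10 * E * M \<le> 10 * E0 * c2 * X1"
      proof -
        have "10 * E * M \<le> 10 * E * (c2 * N)" using Mc E1 by (intro mult_left_mono) auto
        also have "\<dots> = 10 * E0 * c2 * X1" unfolding E_def X1_def by simp
        finally show ?thesis .
      qed
      have tau1: "real (divisor_tau q) \<ge> 1" using divisor_tau_pos[OF q] by simp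
      have tX2: "N\<^sup>2 / real q * real (divisor_tau q) \<le> X2"
      proof -
        have "real (divisor_tau q) * 1 \<le> real (divisor_tau q) ^ 2 * ln N ^ 3"
        proof (rule mult_mono)
          show "real (divisor_tau q) \<le> real (divisor_tau q) ^ 2" using tau1 by (simp add: power2_eq_square)
          show "1 \<le> ln N ^ 3" using lnN by (rule one_le_power)
        qed auto
        then show ?thesis unfolding X2_def using N by (intro mult_left_mono) auto
      qed
      have MNq: "M * N / real q \<le> c2 * (N\<^sup>2 / real q)"
      proof -
        have "M * N / real q \<le> c2 * N * N / real q" using Mc N by (intro divide_right_mono mult_right_mono) auto
        then show ?thesis by (simp add: power2_eq_square)
      qed
      have NX2: "N\<^sup>2 / real q \<le> X2"
      proof -
        have "N\<^sup>2 / real q * 1 \<le> N\<^sup>2 / real q * real (divisor_tau q)" using tau1 by (intro mult_left_mono) auto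
        then show ?thesis using tX2 by simp
      qed
      have g1: "3 * (N / real q) * (M * real (divisor_tau q)) \<le> 3 * c2 * X2"
      proof -
        have "3 * (N / real q) * (M * real (divisor_tau q)) = 3 * (M * N / real q * real (divisor_tau q))" by simp
        also have "\<dots> \<le> 3 * (c2 * (N\<^sup>2 / real q) * real (divisor_tau q))" using MNq by (intro mult_left_mono mult_right_mono) auto
        also have "\<dots> = 3 * c2 * (N\<^sup>2 / real q * real (divisor_tau q))" by simp
        also have "\<dots> \<le> 3 * c2 * X2" using tX2 c21 by (intro mult_left_mono) auto
        finally show ?thesis .
      qed
      \<comment> \<open>Two roundings: floor M for M costs at most 2 \<eta> N \<le> 3 T, absorbed by
        X1, and floor K + 1/2 for K costs at most M N / q, absorbed by X2.\<close>
      have g2: "\<bar>2 * \<eta> * N * real (nat \<lfloor>M\<rfloor>) - 2 * K * M * N / real q\<bar> \<le> 3 * X1 + c2 * X2"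
      proof -
        have Mf: "\<bar>real (nat \<lfloor>M\<rfloor>) - M\<bar> \<le> 1" using M by linarith
        have "\<bar>2 * \<eta> * N * (real (nat \<lfloor>M\<rfloor>) - M)\<bar> = 2 * (\<eta> * N) * \<bar>real (nat \<lfloor>M\<rfloor>) - M\<bar>" using eta0 N by (simp add: abs_mult)
        also have "\<dots> \<le> 2 * (\<eta> * N) * 1" using Mf eta0 N by (intro mult_left_mono) auto
        also have "\<dots> \<le> 3 * X1" using etaN(1) T8(1) T1 unfolding X1_def by linarith
        finally have a1: "\<bar>2 * \<eta> * N * (real (nat \<lfloor>M\<rfloor>) - M)\<bar> \<le> 3 * X1" .
        have "2 * \<eta> * N * M - 2 * K * M * N / real q = (real_of_int \<lfloor>K\<rfloor> + 1/2 - K) * (2 * (M * N / real q))"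
          unfolding \<eta>_def using q1 by (simp add: field_simps)
        then have "\<bar>2 * \<eta> * N * M - 2 * K * M * N / real q\<bar> = \<bar>real_of_int \<lfloor>K\<rfloor> + 1/2 - K\<bar> * (2 * (M * N / real q))"
          using M N by (simp add: abs_mult)
        also have "\<dots> \<le> 1/2 * (2 * (M * N / real q))" using fl(4) M N by (intro mult_right_mono) auto
        also have "\<dots> \<le> c2 * (N\<^sup>2 / real q)" using MNq by simp
        also have "\<dots> \<le> c2 * X2" using NX2 c21 by (intro mult_left_mono) auto
        finally have a2: "\<bar>2 * \<eta> * N * M - 2 * K * M * N / real q\<bar> \<le> c2 * X2" .
        have "2 * \<eta> * N * real (nat \<lfloor>M\<rfloor>) - 2 * K * M * N / real q = 2 * \<eta> * N * (real (nat \<lfloor>M\<rfloor>) - M) + (2 * \<eta> * N * M - 2 * K * M * N / real q)"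
          by (simp add: right_diff_distrib)
        then show ?thesis using a1 a2 by linarith
      qed
      have "\<bar>residue_sum p q K M N - 2 * K * M * N / real q\<bar> \<le> (3 + 10 * E0 * c2 + 2 * Ct) * X1 + 4 * c2 * X2 + 2 * Ct * X3"
        using m1 tail2 EM g1 g2 by (simp add: distrib_right)
      also have "\<dots> \<le> Cf * X1 + Cf * X2 + Cf * X3"
      proof -
        have "3 + 10 * E0 * c2 + 2 * Ct \<le> Cf" "4 * c2 \<le> Cf" "2 * Ct \<le> Cf"
          unfolding Cf_def using c21 E0c2 Ct0 C60 by simp_all
        then have "(3 + 10 * E0 * c2 + 2 * Ct) * X1 \<le> Cf * X1" "4 * c2 * X2 \<le> Cf * X2" "2 * Ct * X3 \<le> Cf * X3"
          using X10 X20 X30 by (simp_all add: mult_right_mono)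
        then show ?thesis by linarith
      qed
      finally show "\<bar>residue_sum p q K M N - 2 * K * M * N / real q\<bar> \<le> Cf * (X1 + X2 + X3)" by (simp add: distrib_left)
    qed
  qed
qed

end
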